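(* Let $n\in\mathbb N$, let $E$ be a Banach space and let $\mathfrak U$ be an ultrafilter on a set $I$. (a) Let $\alpha$ be a finitely generated s-tensor norm of order $n$ and let $P \in \big( \widetilde{\otimes}^{n,s}_\alpha E \big)'$ be a polynomial. Then the iterated extension $\overline{P}$ of $P$ to the ultrapower $(E)_{\mathfrak U}$ belongs to $\big( \widetilde{\otimes}^{n,s}_\alpha (E)_{\mathfrak U} \big)'$ and $$ \|P\|_{( \widetilde{\otimes}^{n,s}_\alpha E )'} = \|\overline{P}\|_{( \widetilde{\otimes}^{n,s}_\alpha (E)_{\mathfrak U})'}.$$ (b) Equivalently, if $\mathcal Q$ is a maximal ideal of $n$-homogeneous polynomials and $P \in \mathcal Q(E)$, then the iterated extension $\overline{P}$ of $P$ to the ultrapower $(E)_{\mathfrak U}$ belongs to $\mathcal Q((E)_{\mathfrak U})$ and $$\|P\|_{\mathcal Q(E)}=\|\overline{P}\|_{\mathcal Q((E)_{\mathfrak U})}.$$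
   Context: Banach spaces are over $\mathbb K=\mathbb R$ or $\mathbb C$. $\mathcal P^n(E)$ is the space of continuous scalar-valued $n$-homogeneous polynomials on $E$, and $FIN(E)$ is the set of finite-dimensional subspaces of $E$. Ultrapower: $(E)_{\mathfrak U}$ is the Banach space of classes $(z_{\mathfrak i})_{\mathfrak U}$ of bounded families $(z_{\mathfrak i})_{\mathfrak i\in I}$ in $E$, where $(z_{\mathfrak i})$ and $(y_{\mathfrak i})$ are identified if $\lim_{\mathfrak i,\mathfrak U}\|z_{\mathfrak i}-y_{\mathfrak i}\|=0$, with norm $\|(z_{\mathfrak i})_{\mathfrak U}\|=\lim_{\mathfrak i,\mathfrak U}\|z_{\mathfrak i}\|$. Iterated extension: for $P\in\mathcal P^n(E)$ with associated symmetric $n$-linear form $A$ (so $P(x)=A(x,\dots,x)$), $\overline P\in\mathcal P^n((E)_{\mathfrak U})$ is given by $\overline P((z_{\mathfrak i})_{\mathfrak U})=\lim_{\mathfrak i_1,\mathfrak U}\cdots\lim_{\mathfrak i_n,\mathfrak U}A(z_{\mathfrak i_1},\dots,z_{\mathfrak i_n})$. s-tensor norms: $\otimes^{n,s}E$ is the $n$-fold symmetric tensor product of $E$, spanned by the elements $\otimes^n x=x\otimes\cdots\otimes x$. An s-tensor norm $\alpha$ of order $n$ assigns to each normed space $E$ a norm $\alpha(\cdot\,;\otimes^{n,s}E)$ on $\otimes^{n,s}E$ such that $\alpha(\otimes^n 1;\otimes^{n,s}\mathbb K)=1$ and (metric mapping property) for each bounded linear $T:E\to F$ the induced map $\otimes^{n,s}T$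 satisfies $\alpha(\otimes^{n,s}T(w);\otimes^{n,s}F)\le\|T\|^n\alpha(w;\otimes^{n,s}E)$. It is finitely generated if for every Banach space $E$ and $z\in\otimes^{n,s}E$, $\alpha(z;\otimes^{n,s}E)=\inf\{\alpha(z;\otimes^{n,s}M): M\in FIN(E),\ z\in\otimes^{n,s}M\}$. $\widetilde\otimes^{n,s}_\alpha E$ is the completion of $\otimes^{n,s}E$ with norm $\alpha$. Its dual is identified with the space of those $P\in\mathcal P^n(E)$ whose linearization $\langle P,\sum_k\lambda_k\otimes^n x_k\rangle=\sum_k\lambda_kP(x_k)$ is $\alpha$-continuous, with the dual norm. Polynomial ideals: a Banach ideal of continuous scalar-valued $n$-homogeneous polynomials is a pair $(\mathcal Q,\|\cdot\|_{\mathcal Q})$ such that for all Banach spaces: (i) $\mathcal Q(E)=\mathcal Q\cap\mathcal P^n(E)$ is a linear subspace of $\mathcal P^n(E)$ and is a Banach space under $\|\cdot\|_{\mathcal Q(E)}$; (ii) if $T:E_1\to E$ is bounded linear and $P\in\mathcal Q(E)$, then $P\circ T\in\mathcal Q(E_1)$ with $\|P\circ T\|_{\mathcal Q(E_1)}\le\|P\|_{\mathcal Q(E)}\|T\|^n$; (iii) $z\mapsto z^n$ belongs to $\mathcal Q(\mathbb K)$ with norm $1$. For $P\in\mathcal P^n(E)$ let $\|P\|_{\mathcal Q^{max}(E)}=\sup\{\|P|_M\|_{\mathcal Q(M)}:M\in FIN(E)\}\in[0,\infty]$ and let $\mathcal Q^{max}(E)=\{P\in\mathcal P^n(E):\|P\|_{\mathcal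 Q^{max}(E)}<\infty\}$. $\mathcal Q$ is maximal if $\mathcal Q=\mathcal Q^{max}$ with equal norms. *)

theory Defs
  imports "HOL-Analysis.Analysis" "HOL-Algebra.Algebraic_Closure_Type"
begin

text \<open>
  The scalar field is a type of sort {real_normed_field, heine_borel}. Both real and complex are
  of this sort, and by the Gelfand-Mazur theorem they are the only ones up to isometric
  isomorphism.

  Tensor norms and polynomial ideals range over all normed or Banach spaces, so spaces are
  explicit structures with a carrier, and ``all spaces'' means all spaces whose carrier is
  contained in a type 'u. This type is always arbitrary; it plays the role of a universe. A space
  on another type enters through an isometric copy \<open>rename h E\<close> with carrier in 'u. For a space on
  'a and an ultrapower of it, 'u can for example be the sum of the types 'k, 'a and \<open>('i \<Rightarrow> 'a) set\<close>.
  Functions on a carrier are represented by functions that are 0 off the carrier.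
\<close>


section \<open>Normed spaces\<close>

text \<open>The ring fields \<open>mult\<close> and \<open>one\<close> inherited by module records are never used.\<close>

record ('k, 'u) nspace = "('k, 'u) module" +
  vnorm :: "'u \<Rightarrow> real"

locale normed_space = Module.module "ring_of_type_algebra :: 'k ring" E
  for E :: "('k::real_normed_field, 'u) nspace" (structure) +
  assumes vnorm_nonneg: "x \<in> carrier E \<Longrightarrow> 0 \<le> vnorm E x"
    and vnorm_eq_0_iff: "x \<in> carrier E \<Longrightarrow> vnorm E x = 0 \<longleftrightarrow> x = \<zero>\<^bsub>E\<^esub>"
    and vnorm_smult: "x \<in> carrier E \<Longrightarrow> vnorm E (c \<odot>\<^bsub>E\<^esub> x) = norm c * vnorm E x"
    and vnorm_triangle:
      "\<lbrakk>x \<in> carrier E; y \<in> carrier E\<rbrakk> \<Longrightarrow> vnorm E (x \<oplus>\<^bsub>E\<^esub> y) \<le> vnorm E x + vnorm E y"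

text \<open>The locale \<open>Metric_space\<close> requires a nonnegative symmetric distance also off the carrier.\<close>

definition ndist :: "('k, 'u) nspace \<Rightarrow> 'u \<Rightarrow> 'u \<Rightarrow> real" where
  "ndist E x y = (if x \<in> carrier E \<and> y \<in> carrier E then vnorm E (x \<ominus>\<^bsub>E\<^esub> y) else 0)"

definition ntopology :: "('k, 'u) nspace \<Rightarrow> 'u topology" where
  "ntopology E = Metric_space.mtopology (carrier E) (ndist E)"

definition banach_space :: "('k::real_normed_field, 'u) nspace \<Rightarrow> bool" where
  "banach_space E \<longleftrightarrow> normed_space E \<and> Metric_space.mcomplete (carrier E) (ndist E)"

definition scalar_space :: "('k::real_normed_field, 'k) nspace" where
  "scalar_space =
     \<lparr>carrier = UNIV, monoid.mult = (*), one = 1, ring.zero = 0, add = (+),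
      module.smult = (*), vnorm = norm\<rparr>"

text \<open>A linear space of scalar functions with the pointwise operations, normed by \<open>N\<close>.\<close>

definition function_space :: "('x \<Rightarrow> 'k) set \<Rightarrow> (('x \<Rightarrow> 'k) \<Rightarrow> real) \<Rightarrow>
    ('k::real_normed_field, 'x \<Rightarrow> 'k) nspace" where
  "function_space S N =
     \<lparr>carrier = S, monoid.mult = undefined, one = undefined,
      ring.zero = (\<lambda>_. 0), add = (\<lambda>f g x. f x + g x),
      module.smult = (\<lambda>c f x. c * f x), vnorm = N\<rparr>"

definition blinear :: "('k::real_normed_field, 'u) nspace \<Rightarrow> ('k, 'v) nspace \<Rightarrow> ('u \<Rightarrow> 'v) set" where
  "blinear E F = {T \<in> carrier E \<rightarrow> carrier F.
     (\<forall>x\<in>carrier E. \<forall>y\<in>carrier E. T (x \<oplus>\<^bsub>E\<^esub> y) = T x \<oplus>\<^bsub>F\<^esub> T y) \<and>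
     (\<forall>c. \<forall>x\<in>carrier E. T (c \<odot>\<^bsub>E\<^esub> x) = c \<odot>\<^bsub>F\<^esub> T x) \<and>
     (\<exists>C. \<forall>x\<in>carrier E. vnorm F (T x) \<le> C * vnorm E x)}"

definition opnorm :: "('k, 'u) nspace \<Rightarrow> ('k, 'v) nspace \<Rightarrow> ('u \<Rightarrow> 'v) \<Rightarrow> real" where
  "opnorm E F T = Sup {vnorm F (T x) | x. x \<in> carrier E \<and> vnorm E x \<le> 1}"

definition subspace_of :: "('k, 'u) nspace \<Rightarrow> 'u set \<Rightarrow> ('k, 'u) nspace" where
  "subspace_of E M = E\<lparr>carrier := M\<rparr>"

definition FIN :: "('k::real_normed_field, 'u) nspace \<Rightarrow> 'u set set" where
  "FIN E = {M. submodule M (ring_of_type_algebra :: 'k ring) E \<and>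
     (\<exists>B. finite B \<and> B \<subseteq> M \<and> (\<forall>x\<in>M. \<exists>c. x = (\<Oplus>\<^bsub>E\<^esub>b\<in>B. c b \<odot>\<^bsub>E\<^esub> b)))}"

definition zero_ext :: "'u set \<Rightarrow> ('u \<Rightarrow> 'k::zero) \<Rightarrow> 'u \<Rightarrow> 'k" where
  "zero_ext S f = (\<lambda>x. if x \<in> S then f x else 0)"

text \<open>The isometric copy of a space obtained by renaming its points along a map \<open>h\<close> that is
  injective on the carrier, and the corresponding copy of a function on the space.\<close>

definition rename :: "('u \<Rightarrow> 'v) \<Rightarrow> ('k, 'u) nspace \<Rightarrow> ('k, 'v) nspace" where
  "rename h E = (let g = the_inv_into (carrier E) h in
     \<lparr>carrier = h ` carrier E, monoid.mult = undefined, one = undefined,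
      ring.zero = h \<zero>\<^bsub>E\<^esub>, add = (\<lambda>x y. h (g x \<oplus>\<^bsub>E\<^esub> g y)),
      module.smult = (\<lambda>c x. h (c \<odot>\<^bsub>E\<^esub> g x)), vnorm = (\<lambda>x. vnorm E (g x))\<rparr>)"

definition rename_fun :: "('u \<Rightarrow> 'v) \<Rightarrow> ('k, 'u) nspace \<Rightarrow> ('u \<Rightarrow> 'k::zero) \<Rightarrow> 'v \<Rightarrow> 'k" where
  "rename_fun h E f = zero_ext (h ` carrier E) (\<lambda>y. f (the_inv_into (carrier E) h y))"


section \<open>Homogeneous polynomials\<close>

definition tuples :: "nat \<Rightarrow> ('k, 'u) nspace \<Rightarrow> 'u list set" where
  "tuples n E = {xs. length xs = n \<and> set xs \<subseteq> carrier E}"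

definition nforms :: "nat \<Rightarrow> ('k::real_normed_field, 'u) nspace \<Rightarrow> ('u list \<Rightarrow> 'k) set" where
  "nforms n E = {A. (\<forall>xs. xs \<notin> tuples n E \<longrightarrow> A xs = 0) \<and>
     (\<forall>xs\<in>tuples n E. \<forall>k<n. \<forall>x\<in>carrier E. \<forall>y\<in>carrier E.
        A (xs[k := x \<oplus>\<^bsub>E\<^esub> y]) = A (xs[k := x]) + A (xs[k := y])) \<and>
     (\<forall>xs\<in>tuples n E. \<forall>k<n. \<forall>c. \<forall>x\<in>carrier E.
        A (xs[k := c \<odot>\<^bsub>E\<^esub> x]) = c * A (xs[k := x]))}"

definition symmetric_nforms :: "nat \<Rightarrow> ('k::real_normed_field, 'u) nspace \<Rightarrow> ('u list \<Rightarrow> 'k) set" where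
  "symmetric_nforms n E = {A \<in> nforms n E. \<forall>xs ys. mset xs = mset ys \<longrightarrow> A xs = A ys}"

definition cpoly :: "nat \<Rightarrow> ('k::real_normed_field, 'u) nspace \<Rightarrow> ('u \<Rightarrow> 'k) set" where
  "cpoly n E = {P. (\<forall>x. x \<notin> carrier E \<longrightarrow> P x = 0) \<and>
     (\<exists>A\<in>nforms n E. \<forall>x\<in>carrier E. P x = A (replicate n x)) \<and>
     continuous_map (ntopology E) euclidean P}"

definition assoc_form :: "nat \<Rightarrow> ('k::real_normed_field, 'u) nspace \<Rightarrow> ('u \<Rightarrow> 'k) \<Rightarrow> 'u list \<Rightarrow> 'k" where
  "assoc_form n E P =
     (THE A. A \<in> symmetric_nforms n E \<and> (\<forall>x\<in>carrier E. P x = A (replicate n x)))"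


section \<open>Ultrapowers and iterated extensions\<close>

definition ultrafilter :: "'i filter \<Rightarrow> bool" where
  "ultrafilter U \<longleftrightarrow> U \<noteq> bot \<and> (\<forall>P. eventually P U \<or> eventually (\<lambda>i. \<not> P i) U)"

definition bounded_families :: "('k, 'u) nspace \<Rightarrow> ('i \<Rightarrow> 'u) set" where
  "bounded_families E = {z. range z \<subseteq> carrier E \<and> (\<exists>C. \<forall>i. vnorm E (z i) \<le> C)}"

definition uclass :: "'i filter \<Rightarrow> ('k, 'u) nspace \<Rightarrow> ('i \<Rightarrow> 'u) \<Rightarrow> ('i \<Rightarrow> 'u) set" where
  "uclass U E z =
     {y \<in> bounded_families E. ((\<lambda>i. vnorm E (z i \<ominus>\<^bsub>E\<^esub> y i)) \<longlongrightarrow> 0) U}"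

definition urep :: "('i \<Rightarrow> 'u) set \<Rightarrow> 'i \<Rightarrow> 'u" where
  "urep Z = (SOME z. z \<in> Z)"

definition ultrapower :: "'i filter \<Rightarrow> ('k, 'u) nspace \<Rightarrow> ('k, ('i \<Rightarrow> 'u) set) nspace" where
  "ultrapower U E =
     \<lparr>carrier = uclass U E ` bounded_families E, monoid.mult = undefined, one = undefined,
      ring.zero = uclass U E (\<lambda>_. \<zero>\<^bsub>E\<^esub>),
      add = (\<lambda>Y Z. uclass U E (\<lambda>i. urep Y i \<oplus>\<^bsub>E\<^esub> urep Z i)),
      module.smult = (\<lambda>c Z. uclass U E (\<lambda>i. c \<odot>\<^bsub>E\<^esub> urep Z i)),
      vnorm = (\<lambda>Z. Lim U (\<lambda>i. vnorm E (urep Z i)))\<rparr>"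

text \<open>\<open>iterated_lim U n f\<close> is the limit of \<open>f [i\<^sub>1, \<dots>, i\<^sub>n]\<close> along \<open>U\<close>, with respect to \<open>i\<^sub>n\<close> first
  and \<open>i\<^sub>1\<close> last.\<close>

primrec iterated_lim :: "'i filter \<Rightarrow> nat \<Rightarrow> ('i list \<Rightarrow> 'k::t2_space) \<Rightarrow> 'k" where
  "iterated_lim U 0 f = f []"
| "iterated_lim U (Suc n) f = Lim U (\<lambda>i. iterated_lim U n (\<lambda>is. f (i # is)))"

definition iterated_extension :: "nat \<Rightarrow> 'i filter \<Rightarrow> ('k::real_normed_field, 'u) nspace \<Rightarrow>
    ('u \<Rightarrow> 'k) \<Rightarrow> ('i \<Rightarrow> 'u) set \<Rightarrow> 'k" where
  "iterated_extension n U E P = zero_ext (carrier (ultrapower U E))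
     (\<lambda>Z. iterated_lim U n (\<lambda>is. assoc_form n E P (map (urep Z) is)))"


section \<open>Symmetric tensor products and s-tensor norms\<close>

text \<open>The tensor \<open>x\<^sub>1 \<otimes> \<dots> \<otimes> x\<^sub>n\<close> is the evaluation functional \<open>A \<mapsto> A (x\<^sub>1, \<dots>, x\<^sub>n)\<close> on the space of
  all (algebraic) n-linear forms. This realizes the algebraic tensor product because these
  forms separate its points. The tensor below is the sum of the \<open>c \<cdot> (x \<otimes> \<dots> \<otimes> x)\<close> over the
  pairs \<open>(c, x)\<close> in \<open>ws\<close>.\<close>

definition stensor :: "nat \<Rightarrow> ('k::real_normed_field, 'u) nspace \<Rightarrow> ('k \<times> 'u) list \<Rightarrow>
    ('u list \<Rightarrow> 'k) \<Rightarrow> 'k" where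
  "stensor n E ws = zero_ext (nforms n E) (\<lambda>A. \<Sum>(c, x)\<leftarrow>ws. c * A (replicate n x))"

definition stensors :: "nat \<Rightarrow> ('k::real_normed_field, 'u) nspace \<Rightarrow> (('u list \<Rightarrow> 'k) \<Rightarrow> 'k) set" where
  "stensors n E = {stensor n E ws | ws. set ws \<subseteq> UNIV \<times> carrier E}"

definition stensor_map :: "nat \<Rightarrow> ('k::real_normed_field, 'u) nspace \<Rightarrow> ('k, 'v) nspace \<Rightarrow>
    ('u \<Rightarrow> 'v) \<Rightarrow> (('u list \<Rightarrow> 'k) \<Rightarrow> 'k) \<Rightarrow> ('v list \<Rightarrow> 'k) \<Rightarrow> 'k" where
  "stensor_map n E F T w =
     zero_ext (nforms n F) (\<lambda>B. w (zero_ext (tuples n E) (\<lambda>xs. B (map T xs))))"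

type_synonym ('k, 'u) tensor_norm = "('k, 'u) nspace \<Rightarrow> (('u list \<Rightarrow> 'k) \<Rightarrow> 'k) \<Rightarrow> real"

definition stensor_space :: "nat \<Rightarrow> ('k::real_normed_field, 'u) tensor_norm \<Rightarrow> ('k, 'u) nspace \<Rightarrow>
    ('k, ('u list \<Rightarrow> 'k) \<Rightarrow> 'k) nspace" where
  "stensor_space n \<alpha> E = function_space (stensors n E) (\<alpha> E)"

text \<open>The scalar field need not be a subset of \<open>'u\<close>, so the normalization is required for each
  of its copies in \<open>'u\<close>.\<close>

definition s_tensor_norm :: "nat \<Rightarrow> ('k::real_normed_field, 'u) tensor_norm \<Rightarrow> bool" where
  "s_tensor_norm n \<alpha> \<longleftrightarrow>
     (\<forall>E. normed_space E \<longrightarrow> normed_space (stensor_space n \<alpha> E)) \<and>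
     (\<forall>h :: 'k \<Rightarrow> 'u. inj h \<longrightarrow>
        \<alpha> (rename h scalar_space) (stensor n (rename h scalar_space) [(1, h 1)]) = 1) \<and>
     (\<forall>E F T. normed_space E \<longrightarrow> normed_space F \<longrightarrow> T \<in> blinear E F \<longrightarrow>
        (\<forall>w\<in>stensors n E. \<alpha> F (stensor_map n E F T w) \<le> opnorm E F T ^ n * \<alpha> E w))"

definition finitely_generated :: "nat \<Rightarrow> ('k::real_normed_field, 'u) tensor_norm \<Rightarrow> bool" where
  "finitely_generated n \<alpha> \<longleftrightarrow>
     (\<forall>E. banach_space E \<longrightarrow> (\<forall>z\<in>stensors n E.
        \<alpha> E z = Inf {\<alpha> (subspace_of E M) w | M w. M \<in> FIN E \<and> w \<in> stensors n (subspace_of E M) \<and>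
                       stensor_map n (subspace_of E M) E (\<lambda>x. x) w = z}))"

definition linearization :: "nat \<Rightarrow> ('k::real_normed_field, 'u) nspace \<Rightarrow> ('u \<Rightarrow> 'k) \<Rightarrow>
    (('u list \<Rightarrow> 'k) \<Rightarrow> 'k) \<Rightarrow> 'k" where
  "linearization n E P w =
     (THE s. \<exists>ws. set ws \<subseteq> UNIV \<times> carrier E \<and> w = stensor n E ws \<and> s = (\<Sum>(c, x)\<leftarrow>ws. c * P x))"

text \<open>The dual of the completed tensor product, as a space of polynomials. A continuous functional
  on the completion is determined by its restriction to the tensor product and has the same norm
  there.\<close>

definition tensor_dual :: "nat \<Rightarrow> ('k::real_normed_field, 'u) tensor_norm \<Rightarrow> ('k, 'u) nspace \<Rightarrow>
    ('u \<Rightarrow> 'k) set" where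
  "tensor_dual n \<alpha> E =
     {P \<in> cpoly n E. linearization n E P \<in> blinear (stensor_space n \<alpha> E) scalar_space}"

definition tensor_dual_norm :: "nat \<Rightarrow> ('k::real_normed_field, 'u) tensor_norm \<Rightarrow> ('k, 'u) nspace \<Rightarrow>
    ('u \<Rightarrow> 'k) \<Rightarrow> real" where
  "tensor_dual_norm n \<alpha> E P = opnorm (stensor_space n \<alpha> E) scalar_space (linearization n E P)"


section \<open>Polynomial ideals\<close>

definition banach_poly_ideal :: "nat \<Rightarrow> (('k::real_normed_field, 'u) nspace \<Rightarrow> ('u \<Rightarrow> 'k) set) \<Rightarrow>
    (('k, 'u) nspace \<Rightarrow> ('u \<Rightarrow> 'k) \<Rightarrow> real) \<Rightarrow> bool" where
  "banach_poly_ideal n Q N \<longleftrightarrow>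
     (\<forall>E. banach_space E \<longrightarrow> Q E \<subseteq> cpoly n E \<and> banach_space (function_space (Q E) (N E))) \<and>
     (\<forall>E1 E T P. banach_space E1 \<longrightarrow> banach_space E \<longrightarrow> T \<in> blinear E1 E \<longrightarrow> P \<in> Q E \<longrightarrow>
        zero_ext (carrier E1) (P \<circ> T) \<in> Q E1 \<and>
        N E1 (zero_ext (carrier E1) (P \<circ> T)) \<le> N E P * opnorm E1 E T ^ n) \<and>
     (\<forall>h :: 'k \<Rightarrow> 'u. inj h \<longrightarrow>
        rename_fun h scalar_space (\<lambda>z. z ^ n) \<in> Q (rename h scalar_space) \<and>
        N (rename h scalar_space) (rename_fun h scalar_space (\<lambda>z. z ^ n)) = 1)"

text \<open>Every polynomial on a finite-dimensional space lies in every ideal, so the value \<open>\<infinity>\<close> is only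
  a safeguard.\<close>

definition max_norm :: "(('k::real_normed_field, 'u) nspace \<Rightarrow> ('u \<Rightarrow> 'k) set) \<Rightarrow>
    (('k, 'u) nspace \<Rightarrow> ('u \<Rightarrow> 'k) \<Rightarrow> real) \<Rightarrow> ('k, 'u) nspace \<Rightarrow> ('u \<Rightarrow> 'k) \<Rightarrow> ennreal" where
  "max_norm Q N E P =
     (SUP M\<in>FIN E. if zero_ext M P \<in> Q (subspace_of E M)
                    then ennreal (N (subspace_of E M) (zero_ext M P)) else \<infinity>)"

definition maximal_ideal :: "nat \<Rightarrow> (('k::real_normed_field, 'u) nspace \<Rightarrow> ('u \<Rightarrow> 'k) set) \<Rightarrow>
    (('k, 'u) nspace \<Rightarrow> ('u \<Rightarrow> 'k) \<Rightarrow> real) \<Rightarrow> bool" where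
  "maximal_ideal n Q N \<longleftrightarrow> banach_poly_ideal n Q N \<and>
     (\<forall>E. banach_space E \<longrightarrow>
        Q E = {P \<in> cpoly n E. max_norm Q N E P < \<infinity>} \<and>
        (\<forall>P\<in>Q E. ennreal (N E P) = max_norm Q N E P))"

end

theory Submission
  imports Defs "HOL-Combinatorics.Multiset_Permutations" "HOL-Real_Asymp.Real_Asymp"
begin

text \<open>
  Let \<open>A\<close> be the symmetric form of \<open>P\<close> and let \<open>M\<close> be a finite-dimensional subspace of the
  ultrapower. Choosing representing families of a basis of \<open>M\<close> gives linear maps \<open>T\<^sub>i : M \<rightarrow> E\<close> with
  \<open>\<parallel>T\<^sub>i\<parallel> \<le> 1 + \<epsilon>\<close> for ultrafilter-many \<open>i\<close>, and the extension of \<open>P\<close> at \<open>x \<in> M\<close> is the iterated limit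
  of \<open>A (T\<^sub>i\<^sub>1 x, \<dots>, T\<^sub>i\<^sub>n x)\<close>. Hence there are \<open>i\<^sub>1, \<dots>, i\<^sub>m\<close> such that all values of \<open>A\<close> at increasing
  \<open>n\<close>-tuples of the vectors \<open>T\<^sub>i\<^sub>k x\<close> are close to the value of the extension at \<open>x\<close>. By symmetry, for
  large \<open>m\<close> the average \<open>S = (T\<^sub>i\<^sub>1 + \<dots> + T\<^sub>i\<^sub>m) / m\<close> satisfies \<open>\<parallel>S\<parallel> \<le> 1 + \<epsilon>\<close>, and \<open>P \<circ> S\<close> is close to the
  extension on any prescribed finite subset of \<open>M\<close>. Both \<open>\<alpha>\<close> and the maximal ideal norm are
  determined on finite-dimensional subspaces, so this bounds the norm of the extension by that of
  \<open>P\<close>. The reverse inequality holds because \<open>P\<close> is the composition of the extension with the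
  canonical isometric embedding of \<open>E\<close> into its ultrapower.
\<close>

section \<open>Normed spaces\<close>

text \<open>The obstacle is that an iterated limit is not a limit along the diagonal.
  \<open>P (T i x)\<close> puts the same index into all \<open>n\<close> slots, whereas the
  extension sends the indices to the limit one after the other. For the sum of squares on real l2
  and the family of unit vectors along a free ultrafilter the first limit is 1 and the second is 0,
  so no single \<open>T i\<close> can be used. In an average of \<open>m\<close> maps the index
  words with a repetition become a negligible fraction, and a symmetric form allows each remaining
  word to be sorted into the order in which the limits are taken.

  Approximation is available at finitely many points only. A tensor involves finitely many vectors,
  so this suffices for \<alpha>. The norm of an ideal is an abstract datum; there the gap is closed
  by the fact that on a finite-dimensional \<open>M\<close> small values at finitely many suitable
  points force a small norm.

  Tensor norms and ideals see only spaces inside one universe type. The argument is therefore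
  carried out in an arbitrary isometric model of the ultrapower, whose chosen representing families
  are linear only up to null families.\<close>

context normed_space
begin

lemma smult_in [simp, intro]: "x \<in> carrier E \<Longrightarrow> c \<odot> x \<in> carrier E"
  by (rule smult_closed) (auto simp: ring_of_type_algebra_def)

lemma smult_add_left: "x \<in> carrier E \<Longrightarrow> (c + d) \<odot> x = c \<odot> x \<oplus> d \<odot> x"
  using smult_l_distr[of c d x] by (simp add: ring_of_type_algebra_def)

lemma smult_add_right: "\<lbrakk>x \<in> carrier E; y \<in> carrier E\<rbrakk> \<Longrightarrow> c \<odot> (x \<oplus> y) = c \<odot> x \<oplus> c \<odot> y"
  using smult_r_distr[of c x y] by (simp add: ring_of_type_algebra_def)

lemma smult_smult: "x \<in> carrier E \<Longrightarrow> c \<odot> (d \<odot> x) = (c * d) \<odot> x"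
  using smult_assoc1[of c d x] by (simp add: ring_of_type_algebra_def)

lemma smult_1 [simp]: "x \<in> carrier E \<Longrightarrow> 1 \<odot> x = x"
  using smult_one[of x] by (simp add: ring_of_type_algebra_def)

lemma smult_0_left [simp]: "x \<in> carrier E \<Longrightarrow> 0 \<odot> x = \<zero>"
  using smult_l_null[of x] by (simp add: ring_of_type_algebra_def)

lemma smult_0_right [simp]: "c \<odot> \<zero> = \<zero>"
  by (rule smult_r_null) (auto simp: ring_of_type_algebra_def)

lemma smult_minus_right: "x \<in> carrier E \<Longrightarrow> c \<odot> (\<ominus> x) = \<ominus> (c \<odot> x)"
  by (rule smult_r_minus) (auto simp: ring_of_type_algebra_def)

lemma smult_minus_left: "x \<in> carrier E \<Longrightarrow> (- c) \<odot> x = \<ominus> (c \<odot> x)"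
  by (rule sym, rule M.minus_equality)
     (auto simp flip: smult_add_left)

lemma neg_eq_smult: "x \<in> carrier E \<Longrightarrow> \<ominus> x = (- 1) \<odot> x"
  by (simp add: smult_minus_left)

lemma diff_eq_smult: "\<lbrakk>x \<in> carrier E; y \<in> carrier E\<rbrakk> \<Longrightarrow> x \<ominus> y = x \<oplus> (- 1) \<odot> y"
  by (simp add: M.minus_eq neg_eq_smult)

lemma diff_in [simp, intro]: "\<lbrakk>x \<in> carrier E; y \<in> carrier E\<rbrakk> \<Longrightarrow> x \<ominus> y \<in> carrier E"
  by (simp add: M.minus_eq)

lemma smult_diff_left: "x \<in> carrier E \<Longrightarrow> (c - d) \<odot> x = c \<odot> x \<ominus> d \<odot> x"
  using smult_add_left[of x c "-d"] by (simp add: smult_minus_left M.minus_eq)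

lemma smult_diff_right: "\<lbrakk>x \<in> carrier E; y \<in> carrier E\<rbrakk> \<Longrightarrow> c \<odot> (x \<ominus> y) = c \<odot> x \<ominus> c \<odot> y"
  by (simp add: M.minus_eq smult_add_right smult_minus_right)

lemma diff_self [simp]: "x \<in> carrier E \<Longrightarrow> x \<ominus> x = \<zero>"
  by (simp add: M.minus_eq M.r_neg)

lemma diff_zero [simp]: "x \<in> carrier E \<Longrightarrow> x \<ominus> \<zero> = x"
  by (simp add: M.minus_eq)

lemma add_diff_add:
  "\<lbrakk>a \<in> carrier E; b \<in> carrier E; c \<in> carrier E; d \<in> carrier E\<rbrakk> \<Longrightarrow>
     (a \<oplus> b) \<ominus> (c \<oplus> d) = (a \<ominus> c) \<oplus> (b \<ominus> d)"
  by (simp add: M.minus_eq M.minus_add M.a_ac)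

lemma diff_add_diff:
  "\<lbrakk>a \<in> carrier E; b \<in> carrier E; c \<in> carrier E\<rbrakk> \<Longrightarrow> (a \<ominus> b) \<oplus> (b \<ominus> c) = a \<ominus> c"
  by (simp add: M.minus_eq M.a_assoc M.r_neg1)

lemma diff_add_cancel: "\<lbrakk>a \<in> carrier E; b \<in> carrier E\<rbrakk> \<Longrightarrow> (a \<ominus> b) \<oplus> b = a"
  by (simp add: M.minus_eq M.a_assoc M.l_neg)

lemma diff_eq_zero_iff: "\<lbrakk>x \<in> carrier E; y \<in> carrier E\<rbrakk> \<Longrightarrow> x \<ominus> y = \<zero> \<longleftrightarrow> x = y"
  using diff_add_cancel[of x y] by auto

lemma vnorm_zero [simp]: "vnorm E \<zero> = 0"
  by (simp add: vnorm_eq_0_iff)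

lemma vnorm_neg [simp]: "x \<in> carrier E \<Longrightarrow> vnorm E (\<ominus> x) = vnorm E x"
  by (simp add: neg_eq_smult vnorm_smult)

lemma neg_diff: "\<lbrakk>x \<in> carrier E; y \<in> carrier E\<rbrakk> \<Longrightarrow> \<ominus> (x \<ominus> y) = y \<ominus> x"
  by (simp add: M.minus_eq M.minus_add M.a_ac)

lemma vnorm_diff_commute: "\<lbrakk>x \<in> carrier E; y \<in> carrier E\<rbrakk> \<Longrightarrow> vnorm E (x \<ominus> y) = vnorm E (y \<ominus> x)"
  by (metis neg_diff vnorm_neg diff_in)

lemma vnorm_diff_le: "\<lbrakk>x \<in> carrier E; y \<in> carrier E\<rbrakk> \<Longrightarrow> vnorm E (x \<ominus> y) \<le> vnorm E x + vnorm E y"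
  using vnorm_triangle[of x "\<ominus> y"] by (simp add: M.minus_eq)

lemma vnorm_diff_triangle:
  "\<lbrakk>x \<in> carrier E; y \<in> carrier E; z \<in> carrier E\<rbrakk> \<Longrightarrow>
     vnorm E (x \<ominus> z) \<le> vnorm E (x \<ominus> y) + vnorm E (y \<ominus> z)"
  using vnorm_triangle[of "x \<ominus> y" "y \<ominus> z"] by (simp add: diff_add_diff)

lemma vnorm_le_diff_add: "\<lbrakk>x \<in> carrier E; y \<in> carrier E\<rbrakk> \<Longrightarrow> vnorm E x \<le> vnorm E (x \<ominus> y) + vnorm E y"
  using vnorm_triangle[of "x \<ominus> y" y] by (simp add: diff_add_cancel)

lemma abs_vnorm_diff_le:
  "\<lbrakk>x \<in> carrier E; y \<in> carrier E\<rbrakk> \<Longrightarrow> \<bar>vnorm E x - vnorm E y\<bar> \<le> vnorm E (x \<ominus> y)"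
  using vnorm_le_diff_add[of x y] vnorm_le_diff_add[of y x] by (simp add: vnorm_diff_commute)

lemma vnorm_finsum_le:
  assumes "finite I" "f \<in> I \<rightarrow> carrier E"
  shows "vnorm E (\<Oplus>i\<in>I. f i) \<le> (\<Sum>i\<in>I. vnorm E (f i))"
  using assms
proof (induction I rule: finite_induct)
  case (insert a I)
  then have "vnorm E (\<Oplus>i\<in>insert a I. f i) \<le> vnorm E (f a) + vnorm E (\<Oplus>i\<in>I. f i)"
    by (simp add: vnorm_triangle Pi_def)
  with insert show ?case by (simp add: Pi_def)
qed simp

lemma finsum_in [simp, intro]:
  "(\<And>i. i \<in> I \<Longrightarrow> f i \<in> carrier E) \<Longrightarrow> (\<Oplus>i\<in>I. f i) \<in> carrier E"
  by (rule M.finsum_closed) auto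

lemma finsum_smult:
  assumes "finite I" "f \<in> I \<rightarrow> carrier E"
  shows "c \<odot> (\<Oplus>i\<in>I. f i) = (\<Oplus>i\<in>I. c \<odot> f i)"
  using assms by (intro finsum_smult_ldistr) (auto simp: ring_of_type_algebra_def)

lemma finsum_add:
  assumes "f \<in> I \<rightarrow> carrier E" "g \<in> I \<rightarrow> carrier E"
  shows "(\<Oplus>i\<in>I. f i \<oplus> g i) = (\<Oplus>i\<in>I. f i) \<oplus> (\<Oplus>i\<in>I. g i)"
  using assms by (rule M.finsum_addf)

lemma finsum_diff:
  assumes "finite I" "f \<in> I \<rightarrow> carrier E" "g \<in> I \<rightarrow> carrier E"
  shows "(\<Oplus>i\<in>I. f i \<ominus> g i) = (\<Oplus>i\<in>I. f i) \<ominus> (\<Oplus>i\<in>I. g i)"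
proof -
  have "(\<Oplus>i\<in>I. f i \<ominus> g i) = (\<Oplus>i\<in>I. f i \<oplus> (- 1) \<odot> g i)"
    using assms by (intro M.finsum_cong) (auto simp: diff_eq_smult simp_implies_def Pi_iff)
  also have "\<dots> = (\<Oplus>i\<in>I. f i) \<oplus> (- 1) \<odot> (\<Oplus>i\<in>I. g i)"
    using assms by (subst finsum_add) (auto simp: finsum_smult)
  also have "\<dots> = (\<Oplus>i\<in>I. f i) \<ominus> (\<Oplus>i\<in>I. g i)"
    using assms by (subst diff_eq_smult) (auto simp: Pi_iff)
  finally show ?thesis .
qed

section \<open>Metric, topology and completeness in terms of the norm\<close>

lemma Metric: "Metric_space (carrier E) (ndist E)"
proof
  fix x y z
  show "0 \<le> ndist E x y" by (simp add: ndist_def vnorm_nonneg)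
  show "ndist E x y = ndist E y x" by (simp add: ndist_def vnorm_diff_commute)
  assume "x \<in> carrier E" "y \<in> carrier E"
  then show "(ndist E x y = 0) = (x = y)" by (simp add: ndist_def vnorm_eq_0_iff diff_eq_zero_iff)
  assume "z \<in> carrier E"
  then show "ndist E x z \<le> ndist E x y + ndist E y z"
    using \<open>x \<in> carrier E\<close> \<open>y \<in> carrier E\<close> by (simp add: ndist_def vnorm_diff_triangle)
qed

lemma topspace_ntopology [simp]: "topspace (ntopology E) = carrier E"
  unfolding ntopology_def by (rule Metric_space.topspace_mtopology[OF Metric])

lemma openin_ntopology:
  "openin (ntopology E) V \<longleftrightarrow> V \<subseteq> carrier E \<and>
     (\<forall>x\<in>V. \<exists>r>0. \<forall>y\<in>carrier E. vnorm E (x \<ominus> y) < r \<longrightarrow> y \<in> V)"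
  unfolding ntopology_def Metric_space.openin_mtopology[OF Metric]
    Metric_space.mball_def[OF Metric] ndist_def
  by (intro conj_cong refl) (smt (verit, best) mem_Collect_eq subset_iff)

lemma continuous_map_iff:
  "continuous_map (ntopology E) euclidean (f :: _ \<Rightarrow> 'c::metric_space) \<longleftrightarrow>
     (\<forall>x\<in>carrier E. \<forall>\<epsilon>>0. \<exists>r>0. \<forall>y\<in>carrier E. vnorm E (x \<ominus> y) < r \<longrightarrow> dist (f y) (f x) < \<epsilon>)"
proof
  assume *: "continuous_map (ntopology E) euclidean f"
  show "\<forall>x\<in>carrier E. \<forall>\<epsilon>>0. \<exists>r>0. \<forall>y\<in>carrier E. vnorm E (x \<ominus> y) < r \<longrightarrow> dist (f y) (f x) < \<epsilon>"
  proof (intro ballI allI impI)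
    fix x and \<epsilon> :: real assume x: "x \<in> carrier E" "\<epsilon> > 0"
    have "openin (ntopology E) {y \<in> topspace (ntopology E). f y \<in> ball (f x) \<epsilon>}"
      by (rule openin_continuous_map_preimage[OF *]) auto
    then show "\<exists>r>0. \<forall>y\<in>carrier E. vnorm E (x \<ominus> y) < r \<longrightarrow> dist (f y) (f x) < \<epsilon>"
      using x unfolding openin_ntopology by (auto simp: dist_commute)
  qed
next
  assume *: "\<forall>x\<in>carrier E. \<forall>\<epsilon>>0. \<exists>r>0. \<forall>y\<in>carrier E. vnorm E (x \<ominus> y) < r \<longrightarrow> dist (f y) (f x) < \<epsilon>"
  show "continuous_map (ntopology E) euclidean f"
    unfolding continuous_map openin_ntopology
  proof (intro conjI allI impI ballI)
    fix V x assume V: "openin euclidean V" and x: "x \<in> {x \<in> topspace (ntopology E). f x \<in> V}"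
    then obtain \<epsilon> where \<epsilon>: "\<epsilon> > 0" "\<forall>y. dist y (f x) < \<epsilon> \<longrightarrow> y \<in> V"
      by (auto simp: open_dist)
    from x have "x \<in> carrier E"
      by simp
    with * \<epsilon> obtain r where "r > 0" "\<forall>y\<in>carrier E. vnorm E (x \<ominus> y) < r \<longrightarrow> dist (f y) (f x) < \<epsilon>"
      by blast
    with \<epsilon> show "\<exists>r>0. \<forall>y\<in>carrier E. vnorm E (x \<ominus> y) < r \<longrightarrow> y \<in> {x \<in> topspace (ntopology E). f x \<in> V}"
      by auto
  qed auto
qed

lemma mcomplete_iff:
  "Metric_space.mcomplete (carrier E) (ndist E) \<longleftrightarrow>
     (\<forall>s. range s \<subseteq> carrier E \<and> (\<forall>\<epsilon>>0. \<exists>N. \<forall>p q. N \<le> p \<longrightarrow> N \<le> q \<longrightarrow> vnorm E (s p \<ominus> s q) < \<epsilon>) \<longrightarrow>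
       (\<exists>x\<in>carrier E. (\<lambda>k. vnorm E (s k \<ominus> x)) \<longlonglongrightarrow> 0))"
proof -
  have cauchy: "Metric_space.MCauchy (carrier E) (ndist E) s \<longleftrightarrow> range s \<subseteq> carrier E \<and>
      (\<forall>\<epsilon>>0. \<exists>N. \<forall>p q. N \<le> p \<longrightarrow> N \<le> q \<longrightarrow> vnorm E (s p \<ominus> s q) < \<epsilon>)" for s
    unfolding Metric_space.MCauchy_def[OF Metric] ndist_def
    by (intro conj_cong refl) (auto simp: subset_iff)
  have lim: "limitin (Metric_space.mtopology (carrier E) (ndist E)) s x sequentially \<longleftrightarrow>
      x \<in> carrier E \<and> (\<lambda>k. vnorm E (s k \<ominus> x)) \<longlonglongrightarrow> 0" if "range s \<subseteq> carrier E" for s x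
  proof (cases "x \<in> carrier E")
    case True
    then have "(\<lambda>k. ndist E (s k) x) = (\<lambda>k. vnorm E (s k \<ominus> x))"
      using that by (auto simp: ndist_def fun_eq_iff)
    with that True show ?thesis
      by (auto simp: Metric_space.limitin_metric_dist_null[OF Metric] subset_iff)
  qed (auto simp: Metric_space.limitin_metric_dist_null[OF Metric])
  show ?thesis
    unfolding Metric_space.mcomplete_def[OF Metric] cauchy
    by (intro all_cong1 imp_cong refl) (auto simp: lim)
qed

end

lemma banach_space_normed: "banach_space E \<Longrightarrow> normed_space E"
  by (simp add: banach_space_def)

text \<open>Additive inverses are asked for only in the form \<open>(- 1) \<odot> x\<close>, and
  definiteness only in one direction. The norm of zero is 0 by homogeneity, because the scalar 0
  sends the zero vector to itself.\<close>

lemma normed_spaceI: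
  fixes E :: "('k::real_normed_field, 'u) nspace" (structure)
  assumes add: "\<And>x y. \<lbrakk>x \<in> carrier E; y \<in> carrier E\<rbrakk> \<Longrightarrow> x \<oplus> y \<in> carrier E"
    and zero: "\<zero> \<in> carrier E"
    and smult: "\<And>c x. x \<in> carrier E \<Longrightarrow> c \<odot> x \<in> carrier E"
    and comm: "\<And>x y. \<lbrakk>x \<in> carrier E; y \<in> carrier E\<rbrakk> \<Longrightarrow> x \<oplus> y = y \<oplus> x"
    and assoc: "\<And>x y z. \<lbrakk>x \<in> carrier E; y \<in> carrier E; z \<in> carrier E\<rbrakk> \<Longrightarrow> (x \<oplus> y) \<oplus> z = x \<oplus> (y \<oplus> z)"
    and zero_add: "\<And>x. x \<in> carrier E \<Longrightarrow> \<zero> \<oplus> x = x"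
    and neg: "\<And>x. x \<in> carrier E \<Longrightarrow> (- 1) \<odot> x \<oplus> x = \<zero>"
    and addl: "\<And>c d x. x \<in> carrier E \<Longrightarrow> (c + d) \<odot> x = c \<odot> x \<oplus> d \<odot> x"
    and addr: "\<And>c x y. \<lbrakk>x \<in> carrier E; y \<in> carrier E\<rbrakk> \<Longrightarrow> c \<odot> (x \<oplus> y) = c \<odot> x \<oplus> c \<odot> y"
    and mult: "\<And>c d x. x \<in> carrier E \<Longrightarrow> (c * d) \<odot> x = c \<odot> (d \<odot> x)"
    and one: "\<And>x. x \<in> carrier E \<Longrightarrow> 1 \<odot> x = x"
    and nonneg: "\<And>x. x \<in> carrier E \<Longrightarrow> 0 \<le> vnorm E x"
    and eq0: "\<And>x. \<lbrakk>x \<in> carrier E; vnorm E x = 0\<rbrakk> \<Longrightarrow> x = \<zero>"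
    and vs: "\<And>c x. x \<in> carrier E \<Longrightarrow> vnorm E (c \<odot> x) = norm c * vnorm E x"
    and tri: "\<And>x y. \<lbrakk>x \<in> carrier E; y \<in> carrier E\<rbrakk> \<Longrightarrow> vnorm E (x \<oplus> y) \<le> vnorm E x + vnorm E y"
  shows "normed_space E"
proof -
  have "abelian_group E"
  proof (rule abelian_groupI)
    fix x assume "x \<in> carrier E"
    then show "\<exists>y\<in>carrier E. y \<oplus> x = \<zero>"
      using neg smult by blast
  qed (fact add zero assoc comm zero_add)+
  then have "module (ring_of_type_algebra :: 'k ring) E"
    by (intro moduleI cring_from_type_algebra)
       (simp_all add: ring_of_type_algebra_def smult addl addr mult one)
  moreover have "vnorm E \<zero> = 0"
  proof -
    have "(0::'k) \<odot> \<zero> = \<zero>"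
      using addl[OF zero, of "-1" 1] neg[OF zero] one[OF zero] by simp
    with vs[OF zero, of 0] show ?thesis by simp
  qed
  moreover have "normed_space_axioms E"
    by (rule normed_space_axioms.intro) (use nonneg eq0 vs tri \<open>vnorm E \<zero> = 0\<close> in blast)+
  ultimately show ?thesis
    by (intro normed_space.intro)
qed

section \<open>Multilinear forms and homogeneous polynomials\<close>

text \<open>No arity is recorded: an \<open>n\<close>-form vanishes on lists of every other length,
  so the estimate is trivial there.\<close>

definition bounded_form :: "('k::real_normed_field, 'u) nspace \<Rightarrow> real \<Rightarrow> ('u list \<Rightarrow> 'k) \<Rightarrow> bool" where
  "bounded_form E D A \<longleftrightarrow> 0 \<le> D \<and>
     (\<forall>xs. set xs \<subseteq> carrier E \<longrightarrow> norm (A xs) \<le> D * prod_list (map (vnorm E) xs))"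

lemma prod_list_le_power:
  fixes f :: "'a \<Rightarrow> real"
  assumes "\<And>x. x \<in> set xs \<Longrightarrow> 0 \<le> f x \<and> f x \<le> R"
  shows "0 \<le> prod_list (map f xs) \<and> prod_list (map f xs) \<le> R ^ length xs"
  using assms
proof (induction xs)
  case (Cons x xs)
  then have "0 \<le> f x" "f x \<le> R" "0 \<le> prod_list (map f xs)" "prod_list (map f xs) \<le> R ^ length xs"
    by auto
  then show ?case by (auto intro!: mult_mono)
qed auto

lemma tuples_append: "ps @ x # qs \<in> tuples n E \<longleftrightarrow>
    length ps + length qs + 1 = n \<and> set ps \<subseteq> carrier E \<and> x \<in> carrier E \<and> set qs \<subseteq> carrier E"
  by (auto simp: tuples_def)

lemma nforms_off_tuples: "\<lbrakk>A \<in> nforms n E; xs \<notin> tuples n E\<rbrakk> \<Longrightarrow> A xs = 0"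
  unfolding nforms_def by blast

lemma symmetric_nforms_nforms: "A \<in> symmetric_nforms n E \<Longrightarrow> A \<in> nforms n E"
  unfolding symmetric_nforms_def by blast

lemma symmetric_nforms_mset: "\<lbrakk>A \<in> symmetric_nforms n E; mset xs = mset ys\<rbrakk> \<Longrightarrow> A xs = A ys"
  unfolding symmetric_nforms_def by blast

context normed_space
begin

text \<open>Linearity in a slot is stated for a split list \<open>ps @ x # qs\<close> instead of a
  list update, so that inductions over the slots can treat the prefix and the suffix
  separately.\<close>

lemma nforms_add:
  assumes "A \<in> nforms n E" "length ps + length qs + 1 = n" "set ps \<subseteq> carrier E" "set qs \<subseteq> carrier E"
    "x \<in> carrier E" "y \<in> carrier E"
  shows "A (ps @ (x \<oplus> y) # qs) = A (ps @ x # qs) + A (ps @ y # qs)"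
proof -
  have "ps @ x # qs \<in> tuples n E" "length ps < n"
    using assms by (auto simp: tuples_append)
  with assms(1,5,6) have "A ((ps @ x # qs)[length ps := x \<oplus> y]) =
     A ((ps @ x # qs)[length ps := x]) + A ((ps @ x # qs)[length ps := y])"
    unfolding nforms_def by blast
  then show ?thesis by simp
qed

lemma nforms_smult:
  assumes "A \<in> nforms n E" "length ps + length qs + 1 = n" "set ps \<subseteq> carrier E" "set qs \<subseteq> carrier E"
    "x \<in> carrier E"
  shows "A (ps @ (c \<odot> x) # qs) = c * A (ps @ x # qs)"
proof -
  have "ps @ x # qs \<in> tuples n E" "length ps < n"
    using assms by (auto simp: tuples_append)
  with assms(1,5) have "A ((ps @ x # qs)[length ps := c \<odot> x]) = c * A ((ps @ x # qs)[length ps := x])"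
    unfolding nforms_def by blast
  then show ?thesis by simp
qed

lemma nformsI:
  assumes zero: "\<And>xs. xs \<notin> tuples n E \<Longrightarrow> A xs = 0"
    and add: "\<And>ps qs x y. \<lbrakk>length ps + length qs + 1 = n; set ps \<subseteq> carrier E; set qs \<subseteq> carrier E;
       x \<in> carrier E; y \<in> carrier E\<rbrakk> \<Longrightarrow> A (ps @ (x \<oplus> y) # qs) = A (ps @ x # qs) + A (ps @ y # qs)"
    and smult: "\<And>ps qs x c. \<lbrakk>length ps + length qs + 1 = n; set ps \<subseteq> carrier E; set qs \<subseteq> carrier E;
       x \<in> carrier E\<rbrakk> \<Longrightarrow> A (ps @ (c \<odot> x) # qs) = c * A (ps @ x # qs)"
  shows "A \<in> nforms n E"
proof -
  have upd: "xs[k := x] = take k xs @ x # drop (Suc k) xs" "length (take k xs) + length (drop (Suc k) xs) + 1 = n"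
    "set (take k xs) \<subseteq> carrier E" "set (drop (Suc k) xs) \<subseteq> carrier E"
    if "xs \<in> tuples n E" "k < n" for xs k x
    using that set_take_subset[of k xs] set_drop_subset[of "Suc k" xs]
    by (auto simp: tuples_def upd_conv_take_nth_drop)
  show ?thesis
    unfolding nforms_def
  proof (intro CollectI conjI allI ballI impI)
    fix xs k x y assume *: "xs \<in> tuples n E" "k < n" "x \<in> carrier E" "y \<in> carrier E"
    show "A (xs[k := x \<oplus> y]) = A (xs[k := x]) + A (xs[k := y])"
      unfolding upd(1)[OF *(1,2)] using upd(2-)[OF *(1,2)] *(3,4) by (rule add)
  next
    fix xs k c x assume *: "xs \<in> tuples n E" "k < n" "x \<in> carrier E"
    show "A (xs[k := c \<odot> x]) = c * A (xs[k := x])"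
      unfolding upd(1)[OF *(1,2)] using upd(2-)[OF *(1,2)] *(3) by (rule smult)
  qed (rule zero)
qed

lemma nforms_zero:
  assumes "A \<in> nforms n E" "length ps + length qs + 1 = n" "set ps \<subseteq> carrier E" "set qs \<subseteq> carrier E"
  shows "A (ps @ \<zero> # qs) = 0"
  using nforms_smult[OF assms, of \<zero> 0] by simp

lemma nforms_diff:
  assumes "A \<in> nforms n E" "length ps + length qs + 1 = n" "set ps \<subseteq> carrier E" "set qs \<subseteq> carrier E"
    "x \<in> carrier E" "y \<in> carrier E"
  shows "A (ps @ (x \<ominus> y) # qs) = A (ps @ x # qs) - A (ps @ y # qs)"
  using assms nforms_smult[OF assms(1-4), of y "-1"]
  by (simp add: diff_eq_smult nforms_add[OF assms(1-4)])

lemma nforms_finsum: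
  assumes "A \<in> nforms n E" "length ps + length qs + 1 = n" "set ps \<subseteq> carrier E" "set qs \<subseteq> carrier E"
    "finite I" "f \<in> I \<rightarrow> carrier E"
  shows "A (ps @ (\<Oplus>i\<in>I. f i) # qs) = (\<Sum>i\<in>I. A (ps @ f i # qs))"
  using assms(5,6)
proof (induction I rule: finite_induct)
  case empty
  then show ?case using nforms_zero[OF assms(1-4)] by simp
next
  case (insert i I)
  then show ?case
    by (simp add: nforms_add[OF assms(1-4)] Pi_def)
qed

text \<open>A multinomial expansion without symmetry: every word \<open>is\<close> over
  \<open>I\<close> contributes its own term. The induction expands the first remaining slot, and
  \<open>ps\<close> holds the slots that are already expanded.\<close>

lemma nforms_expand:
  assumes A: "A \<in> nforms n E" and I: "finite I" "f \<in> I \<rightarrow> carrier E"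
  shows "\<lbrakk>length ps + m = n; set ps \<subseteq> carrier E\<rbrakk> \<Longrightarrow>
    A (ps @ replicate m (\<Oplus>i\<in>I. f i)) = (\<Sum>is | set is \<subseteq> I \<and> length is = m. A (ps @ map f is))"
proof (induction m arbitrary: ps)
  case (Suc m)
  have in_E: "(\<Oplus>i\<in>I. f i) \<in> carrier E" using I by (auto intro: finsum_in)
  have "A (ps @ replicate (Suc m) (\<Oplus>i\<in>I. f i)) = (\<Sum>i\<in>I. A ((ps @ [f i]) @ replicate m (\<Oplus>i\<in>I. f i)))"
    using nforms_finsum[OF A _ _ _ I, of ps "replicate m (\<Oplus>i\<in>I. f i)"] Suc.prems in_E
    by (auto simp: set_replicate_conv_if)
  also have "\<dots> = (\<Sum>i\<in>I. \<Sum>is | set is \<subseteq> I \<and> length is = m. A (ps @ map f (i # is)))"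
  proof (rule sum.cong)
    fix i assume i: "i \<in> I"
    have "A ((ps @ [f i]) @ replicate m (\<Oplus>i\<in>I. f i)) =
      (\<Sum>is | set is \<subseteq> I \<and> length is = m. A ((ps @ [f i]) @ map f is))"
      using Suc.prems i I by (intro Suc.IH) (auto simp: Pi_iff)
    then show "A ((ps @ [f i]) @ replicate m (\<Oplus>i\<in>I. f i)) =
      (\<Sum>is | set is \<subseteq> I \<and> length is = m. A (ps @ map f (i # is)))" by simp
  qed simp
  also have "\<dots> = (\<Sum>(i, is)\<in>I \<times> {is. set is \<subseteq> I \<and> length is = m}. A (ps @ map f (i # is)))"
    by (simp add: sum.cartesian_product)
  also have "\<dots> = (\<Sum>is | set is \<subseteq> I \<and> length is = Suc m. A (ps @ map f is))"
    by (rule sum.reindex_bij_witness[of _ "\<lambda>is. (hd is, tl is)" "\<lambda>(i, is). i # is"])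
       (auto simp: length_Suc_conv)
  finally show ?case .
qed (simp cong: conj_cong)

lemma nforms_scale:
  assumes A: "A \<in> nforms n E"
  shows "\<lbrakk>length ps + length xs = n; set ps \<subseteq> carrier E; f ` set xs \<subseteq> carrier E\<rbrakk> \<Longrightarrow>
    A (ps @ map (\<lambda>x. c x \<odot> f x) xs) = prod_list (map c xs) * A (ps @ map f xs)"
proof (induction xs arbitrary: ps)
  case (Cons x xs)
  have "A (ps @ map (\<lambda>x. c x \<odot> f x) (x # xs)) = c x * A ((ps @ [f x]) @ map (\<lambda>x. c x \<odot> f x) xs)"
    using Cons.prems by (simp, subst nforms_smult[OF A]) auto
  also have "\<dots> = c x * (prod_list (map c xs) * A ((ps @ [f x]) @ map f xs))"
    using Cons.prems by (subst Cons.IH) auto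
  finally show ?case by simp
qed simp

lemma nforms_replicate_smult:
  assumes "A \<in> nforms n E" "x \<in> carrier E"
  shows "A (replicate n (c \<odot> x)) = c ^ n * A (replicate n x)"
proof -
  have "A ([] @ map (\<lambda>x. c \<odot> x) (replicate n x)) = prod_list (map (\<lambda>_. c) (replicate n x)) * A ([] @ map (\<lambda>x. x) (replicate n x))"
    by (rule nforms_scale[OF assms(1)]) (use assms in auto)
  then show ?thesis by simp
qed

end

text \<open>The sign kernel of inclusion-exclusion: between \<open>T\<close> and a strictly larger
  \<open>I\<close> there are as many sets of even as of odd cardinality.\<close>

lemma sum_supersets_sign:
  assumes "finite I" "T \<subseteq> I"
  shows "(\<Sum>S | T \<subseteq> S \<and> S \<subseteq> I. (- 1) ^ (card I - card S)) = (if T = I then 1 else (0::'k::comm_ring_1))"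
proof (cases "T = I")
  case True
  have eq: "{S. I \<subseteq> S \<and> S \<subseteq> I} = {I}" by auto
  show ?thesis unfolding True eq by simp
next
  case False
  have fin: "finite {S. T \<subseteq> S \<and> S \<subseteq> I}"
    using assms by (simp add: finite_subset[of _ "Pow I"] Collect_mono_iff Pow_def)
  have "(\<Sum>S | T \<subseteq> S \<and> S \<subseteq> I. (- 1) ^ (card I - card S)) =
      (- 1) ^ card I * (\<Sum>S | T \<subseteq> S \<and> S \<subseteq> I. (- 1) ^ card S :: 'k)"
    unfolding sum_distrib_left
  proof (rule sum.cong)
    fix S assume "S \<in> {S. T \<subseteq> S \<and> S \<subseteq> I}"
    then have "card S \<le> card I" using assms by (auto intro: card_mono)
    then show "(- 1) ^ (card I - card S) = (- 1) ^ card I * ((- 1) ^ card S :: 'k)"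
      by (simp add: minus_one_power_iff)
  qed simp
  also have "(\<Sum>S | T \<subseteq> S \<and> S \<subseteq> I. (- 1) ^ card S :: 'k) = 0"
    using sum_alternating_cancels[OF fin, of card] card_subsupersets_even_odd[OF assms(1), of T] False assms
    by (simp add: psubset_eq conj_ac)
  finally show ?thesis using False by simp
qed

lemma mset_map_nth: "\<lbrakk>set is = {..<n}; length is = n; length xs = n\<rbrakk> \<Longrightarrow> mset (map ((!) xs) is) = mset xs"
proof -
  assume *: "set is = {..<n}" "length is = n" "length xs = n"
  then have "distinct is" by (simp add: card_distinct)
  have "set is = set [0..<n]" using *(1) by (simp add: atLeast0LessThan)
  then have "mset is = mset [0..<n]"
    by (rule set_eq_iff_mset_eq_distinct[OF \<open>distinct is\<close> distinct_upt, THEN iffD1])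
  then have "mset (map ((!) xs) is) = mset (map ((!) xs) [0..<n])"
    by (simp only: mset_map)
  also have "map ((!) xs) [0..<n] = xs" using map_nth[of xs] *(3) by simp
  finally show ?thesis .
qed

section \<open>Polarization and symmetrization\<close>

context normed_space
begin

text \<open>Expanding each diagonal value over the words in \<open>S\<close> and exchanging the sums
  gives a word the total sign of all sets that contain its letters. This is 0 unless all
  \<open>n\<close> indices occur. A word of length \<open>n\<close> in which all of them occur is a
  permutation, symmetry gives it the value \<open>A xs\<close>, and there are \<open>fact n\<close>
  such words.\<close>

lemma polarization:
  assumes A: "A \<in> symmetric_nforms n E" and xs: "xs \<in> tuples n E"
  shows "fact n * A xs = (\<Sum>S\<in>Pow {..<n}. (- 1) ^ (n - card S) * A (replicate n (\<Oplus>i\<in>S. xs ! i)))"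
proof -
  have A': "A \<in> nforms n E" using A by (rule symmetric_nforms_nforms)
  have len: "length xs = n" and nth: "\<And>i. i < n \<Longrightarrow> xs ! i \<in> carrier E"
    using xs by (auto simp: tuples_def)
  define L where "L = {is. set is \<subseteq> {..<n} \<and> length is = n}"
  have finL: "finite L" unfolding L_def by (rule finite_lists_length_eq) simp
  have "(\<Sum>S\<in>Pow {..<n}. (- 1) ^ (n - card S) * A (replicate n (\<Oplus>i\<in>S. xs ! i))) =
      (\<Sum>S\<in>Pow {..<n}. \<Sum>is | is \<in> L \<and> set is \<subseteq> S. (- 1) ^ (n - card S) * A (map ((!) xs) is))"
  proof (rule sum.cong)
    fix S assume S: "S \<in> Pow {..<n}"
    then have "finite S" "(!) xs \<in> S \<rightarrow> carrier E" using nth by (auto intro: finite_subset)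
    with nforms_expand[OF A' this, of "[]" n] S
    have "A (replicate n (\<Oplus>i\<in>S. xs ! i)) = (\<Sum>is | is \<in> L \<and> set is \<subseteq> S. A (map ((!) xs) is))"
      unfolding L_def by (auto intro!: sum.cong)
    then show "(- 1) ^ (n - card S) * A (replicate n (\<Oplus>i\<in>S. xs ! i)) =
      (\<Sum>is | is \<in> L \<and> set is \<subseteq> S. (- 1) ^ (n - card S) * A (map ((!) xs) is))"
      by (simp add: sum_distrib_left)
  qed simp
  also have "\<dots> = (\<Sum>is\<in>L. \<Sum>S | S \<in> Pow {..<n} \<and> set is \<subseteq> S. (- 1) ^ (n - card S) * A (map ((!) xs) is))"
    using finL by (rule sum.swap_restrict[OF finite_Pow_iff[THEN iffD2], OF finite_lessThan])
  also have "\<dots> = (\<Sum>is\<in>L. if set is = {..<n} then A xs else 0)"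
  proof (rule sum.cong)
    fix "is" assume "is": "is \<in> L"
    have "(\<Sum>S | S \<in> Pow {..<n} \<and> set is \<subseteq> S. (- 1) ^ (n - card S) * A (map ((!) xs) is)) =
      (\<Sum>S | set is \<subseteq> S \<and> S \<subseteq> {..<n}. (- 1) ^ (card {..<n} - card S)) * A (map ((!) xs) is)"
      by (auto simp: sum_distrib_right intro!: sum.cong)
    also have "\<dots> = (if set is = {..<n} then 1 else 0) * A (map ((!) xs) is)"
      using "is" by (subst sum_supersets_sign) (auto simp: L_def)
    also have "\<dots> = (if set is = {..<n} then A xs else 0)"
      using symmetric_nforms_mset[OF A mset_map_nth[of "is" n xs]] "is" len by (auto simp: L_def)
    finally show "(\<Sum>S | S \<in> Pow {..<n} \<and> set is \<subseteq> S. (- 1) ^ (n - card S) * A (map ((!) xs) is)) =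
      (if set is = {..<n} then A xs else 0)" .
  qed simp
  also have "\<dots> = of_nat (card {is \<in> L. set is = {..<n}}) * A xs"
    using finL by (simp add: sum.If_cases Int_def)
  also have "{is \<in> L. set is = {..<n}} = permutations_of_set {..<n}"
  proof (intro Set.set_eqI iffI)
    fix "is" assume "is \<in> {is \<in> L. set is = {..<n}}"
    then have "set is = {..<n}" "card (set is) = length is" by (simp_all add: L_def)
    then show "is \<in> permutations_of_set {..<n}"
      by (intro permutations_of_setI card_distinct)
  next
    fix "is" assume "is \<in> permutations_of_set {..<n}"
    then show "is \<in> {is \<in> L. set is = {..<n}}"
      using permutations_of_setD(1)[of "is"] length_finite_permutations_of_set[of "is"]
      by (simp add: L_def)
  qed
  finally show ?thesis by (simp add: card_permutations_of_set)
qed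

text \<open>By polarization the diagonal determines a symmetric form. This is what makes the
  definite description in \<open>assoc_form\<close> meaningful.\<close>

lemma symmetric_nforms_eqI:
  assumes "A \<in> symmetric_nforms n E" "B \<in> symmetric_nforms n E"
    and "\<And>x. x \<in> carrier E \<Longrightarrow> A (replicate n x) = B (replicate n x)"
  shows "A = B"
proof
  fix xs
  show "A xs = B xs"
  proof (cases "xs \<in> tuples n E")
    case True
    have "(\<Oplus>i\<in>S. xs ! i) \<in> carrier E" if "S \<subseteq> {..<n}" for S
      using True that by (intro finsum_in) (auto simp: tuples_def subset_iff)
    then have "fact n * A xs = fact n * B xs"
      unfolding polarization[OF assms(1) True] polarization[OF assms(2) True]
      by (intro sum.cong) (auto simp: assms(3))
    then show ?thesis by simp
  next
    case False
    then show ?thesis using assms(1,2)[THEN symmetric_nforms_nforms] by (simp add: nforms_off_tuples)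
  qed
qed

text \<open>The form is averaged over all permutations of its slots. A permutation is encoded as the
  list \<open>is\<close> of its values, and \<open>map ((!) xs) is\<close> is the permuted
  argument.\<close>

lemma symmetrization:
  assumes A: "A \<in> nforms n E"
  obtains B where "B \<in> symmetric_nforms n E" "\<And>x. x \<in> carrier E \<Longrightarrow> B (replicate n x) = A (replicate n x)"
proof -
  define L where "L = permutations_of_set {..<n}"
  define B where "B = (\<lambda>xs. if xs \<in> tuples n E then (\<Sum>is\<in>L. A (map ((!) xs) is)) / fact n else 0)"
  have L: "set is = {..<n} \<and> distinct is \<and> length is = n" if "is \<in> L" for "is"
    using permutations_of_setD[of "is"] length_finite_permutations_of_set[of "is"] that unfolding L_def by simp
  have split: "\<exists>as bs. is = as @ k # bs \<and> k \<notin> set as \<and> k \<notin> set bs \<and> length as + length bs + 1 = n \<and>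
      set as \<subseteq> {..<n} \<and> set bs \<subseteq> {..<n}"
    if "is \<in> L" "k < n" for "is" k
  proof -
    from that L[OF that(1)] have "k \<in> set is" by auto
    then obtain as bs where "is = as @ k # bs" by (meson split_list)
    with L[OF that(1)] show ?thesis by (intro exI[of _ as] exI[of _ bs]) auto
  qed
  \<comment> \<open>The index \<open>length ps\<close> occurs exactly once in \<open>is\<close>, so
    changing the vector in that slot changes one entry of the permuted argument; the other entries
    can be read off with any \<open>y\<close> in its place.\<close>
  have map_upd: "map ((!) (ps @ x # qs)) (as @ length ps # bs) =
      map ((!) (ps @ y # qs)) as @ x # map ((!) (ps @ y # qs)) bs"
    if "length ps \<notin> set as" "length ps \<notin> set bs" for ps qs x y and as bs :: "nat list"
    using that by (auto simp: nth_append nth_Cons' intro!: map_cong)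
  have in_E: "set (map ((!) xs) as) \<subseteq> carrier E" if "xs \<in> tuples n E" "set as \<subseteq> {..<n}" for xs as
    using that by (auto simp: tuples_def subset_iff)
  have "B \<in> nforms n E"
  proof (rule nformsI)
    fix ps qs x y
    assume *: "length ps + length qs + 1 = n" "set ps \<subseteq> carrier E" "set qs \<subseteq> carrier E"
       "x \<in> carrier E" "y \<in> carrier E"
    then have tup: "ps @ z # qs \<in> tuples n E" if "z \<in> carrier E" for z
      using that by (simp add: tuples_append)
    have "A (map ((!) (ps @ (x \<oplus> y) # qs)) is) = A (map ((!) (ps @ x # qs)) is) + A (map ((!) (ps @ y # qs)) is)"
      if isL: "is \<in> L" for "is"
    proof -
      obtain as bs where s: "is = as @ length ps # bs" "length ps \<notin> set as" "length ps \<notin> set bs"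
        "length as + length bs + 1 = n" "set as \<subseteq> {..<n}" "set bs \<subseteq> {..<n}"
        using split[OF isL, of "length ps"] *(1) by auto
      show ?thesis
        unfolding s(1) map_upd[OF s(2,3), of _ qs x] using s * in_E[OF tup[OF *(4)]]
        by (intro nforms_add[OF A]) auto
    qed
    then show "B (ps @ (x \<oplus> y) # qs) = B (ps @ x # qs) + B (ps @ y # qs)"
      using * by (simp add: B_def tup sum.distrib add_divide_distrib)
  next
    fix ps qs x c
    assume *: "length ps + length qs + 1 = n" "set ps \<subseteq> carrier E" "set qs \<subseteq> carrier E" "x \<in> carrier E"
    then have tup: "ps @ z # qs \<in> tuples n E" if "z \<in> carrier E" for z
      using that by (simp add: tuples_append)
    have "A (map ((!) (ps @ (c \<odot> x) # qs)) is) = c * A (map ((!) (ps @ x # qs)) is)" if isL: "is \<in> L" for "is"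
    proof -
      obtain as bs where s: "is = as @ length ps # bs" "length ps \<notin> set as" "length ps \<notin> set bs"
        "length as + length bs + 1 = n" "set as \<subseteq> {..<n}" "set bs \<subseteq> {..<n}"
        using split[OF isL, of "length ps"] *(1) by auto
      show ?thesis
        unfolding s(1) map_upd[OF s(2,3), of _ qs x] using s * in_E[OF tup[OF *(4)]]
        by (intro nforms_smult[OF A]) auto
    qed
    then show "B (ps @ (c \<odot> x) # qs) = c * B (ps @ x # qs)"
      using * by (simp add: B_def tup sum_distrib_left)
  qed (simp add: B_def)
  moreover have "B xs = B ys" if eq: "mset xs = mset ys" for xs ys
  proof (cases "ys \<in> tuples n E")
    case True
    then have len: "length ys = n" "length xs = n" using mset_eq_length[OF eq] by (auto simp: tuples_def)
    obtain p where p: "p permutes {..<n}" "permute_list p ys = xs"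
      by (rule mset_eq_permutation[OF eq]) (simp add: len)
    have xs: "xs \<in> tuples n E" using True mset_eq_setD[OF eq] len by (auto simp: tuples_def)
    \<comment> \<open>Rearranging the argument by \<open>p\<close> only permutes the summands,
      because composition with \<open>p\<close> is a bijection of the set of permutations.\<close>
    have "(\<Sum>is\<in>L. A (map ((!) xs) is)) = (\<Sum>is\<in>L. A (map ((!) ys) is))"
    proof (rule sum.reindex_bij_witness[of _ "map (inv_into UNIV p)" "map p"])
      fix "is" assume "is \<in> L"
      then have "set is = {..<n}" "distinct is" using L by auto
      show "map (inv_into UNIV p) (map p is) = is" "map p (map (inv_into UNIV p) is) = is"
        using permutes_inverses[OF p(1)] by (simp_all add: map_idI)
      show "map (inv_into UNIV p) is \<in> L" "map p is \<in> L"
        using \<open>set is = _\<close> \<open>distinct is\<close> permutes_image[OF p(1)] permutes_image[OF permutes_inv[OF p(1)]]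
          permutes_inj_on[OF p(1)] permutes_inj_on[OF permutes_inv[OF p(1)]]
        by (auto simp: L_def permutations_of_set_def distinct_map)
      have "xs ! i = ys ! p i" if "i < n" for i
        using permute_list_nth[of p ys i] p len that by simp
      then show "A (map ((!) ys) (map p is)) = A (map ((!) xs) is)"
        using \<open>set is = _\<close> by (intro arg_cong[of _ _ A]) auto
    qed
    with True xs show ?thesis by (simp add: B_def)
  next
    case False
    then have "xs \<notin> tuples n E" using mset_eq_setD[OF eq] mset_eq_length[OF eq] by (auto simp: tuples_def)
    with False show ?thesis by (simp add: B_def)
  qed
  ultimately have "B \<in> symmetric_nforms n E" unfolding symmetric_nforms_def by blast
  moreover have "B (replicate n x) = A (replicate n x)" if "x \<in> carrier E" for x
  proof -
    have "map ((!) (replicate n x)) is = replicate n x" if "is \<in> L" for "is"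
    proof -
      have "map ((!) (replicate n x)) is = map (\<lambda>_. x) is"
        using L[OF that] by (intro map_cong) auto
      with L[OF that] show ?thesis by (simp add: map_replicate_const)
    qed
    then have "(\<Sum>is\<in>L. A (map ((!) (replicate n x)) is)) = (\<Sum>is\<in>L. A (replicate n x))"
      by (intro sum.cong refl arg_cong[of _ _ A])
    also have "\<dots> = fact n * A (replicate n x)"
      by (simp add: L_def card_permutations_of_set)
    finally have "(\<Sum>is\<in>L. A (map ((!) (replicate n x)) is)) = fact n * A (replicate n x)" .
    moreover have "replicate n x \<in> tuples n E" using that by (auto simp: tuples_def)
    ultimately show ?thesis by (simp add: B_def)
  qed
  ultimately show ?thesis by (rule that)
qed

section \<open>Bounded forms and continuity of polynomials\<close>

lemma bounded_formI:
  assumes A: "A \<in> nforms n E" and D: "0 \<le> D"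
    and le: "\<And>xs. \<lbrakk>xs \<in> tuples n E; \<forall>x\<in>set xs. vnorm E x \<le> 1\<rbrakk> \<Longrightarrow> norm (A xs) \<le> D"
  shows "bounded_form E D A"
  unfolding bounded_form_def
proof (intro conjI allI impI D)
  fix xs assume xs: "set xs \<subseteq> carrier E"
  have nonneg: "0 \<le> prod_list (map (vnorm E) xs)"
    using xs by (intro prod_list_nonneg) (auto simp: vnorm_nonneg)
  \<comment> \<open>A zero entry cannot be normalized, but the form vanishes there. All other tuples
    are rescaled to vectors of norm 1, and the factors are recovered by homogeneity.\<close>
  show "norm (A xs) \<le> D * prod_list (map (vnorm E) xs)"
  proof (cases "xs \<in> tuples n E \<and> \<zero> \<notin> set xs")
    case False
    have "A xs = 0"
    proof (cases "xs \<in> tuples n E")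
      case True
      with False have "\<zero> \<in> set xs" by simp
      then obtain ps qs where "xs = ps @ \<zero> # qs" by (meson split_list)
      with True show ?thesis using nforms_zero[OF A, of ps qs] by (simp add: tuples_append)
    qed (use A in \<open>simp add: nforms_off_tuples\<close>)
    with D nonneg show ?thesis by simp
  next
    case True
    define c :: "'u \<Rightarrow> 'k" where "c x = of_real (vnorm E x)" for x
    define f where "f x = (of_real (1 / vnorm E x) :: 'k) \<odot> x" for x
    have pos: "vnorm E x > 0" if "x \<in> set xs" for x
    proof -
      have "x \<in> carrier E" "x \<noteq> \<zero>" using True xs that by auto
      with vnorm_nonneg[of x] vnorm_eq_0_iff[of x] show ?thesis by auto
    qed
    have f: "f x \<in> carrier E" "vnorm E (f x) = 1" "c x \<odot> f x = x" if "x \<in> set xs" for x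
      using pos[OF that] that xs
      by (auto simp: f_def c_def vnorm_smult smult_smult norm_divide subset_iff simp flip: of_real_mult)
    have "A xs = A ([] @ map (\<lambda>x. c x \<odot> f x) xs)"
      by (simp add: f(3) cong: map_cong)
    also have "\<dots> = prod_list (map c xs) * A ([] @ map f xs)"
      using True f by (intro nforms_scale[OF A]) (auto simp: tuples_def)
    finally have "norm (A xs) = norm (prod_list (map c xs)) * norm (A (map f xs))"
      by (simp add: norm_mult)
    also have "norm (prod_list (map c xs)) = prod_list (map (vnorm E) xs)"
      using xs by (induction xs) (auto simp: c_def norm_mult vnorm_nonneg)
    also have "prod_list (map (vnorm E) xs) * norm (A (map f xs)) \<le> prod_list (map (vnorm E) xs) * D"
      using True f by (intro mult_left_mono le nonneg) (auto simp: tuples_def)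
    finally show ?thesis by (simp add: mult.commute)
  qed
qed

lemma bounded_form_le:
  assumes "bounded_form E D A" "set ps \<subseteq> carrier E" "set qs \<subseteq> carrier E" "x \<in> carrier E"
    and R: "\<And>y. y \<in> set ps \<union> set qs \<Longrightarrow> vnorm E y \<le> R"
  shows "norm (A (ps @ x # qs)) \<le> D * R ^ (length ps + length qs) * vnorm E x"
proof -
  have D: "0 \<le> D" using assms(1) by (simp add: bounded_form_def)
  have 1: "0 \<le> prod_list (map (vnorm E) (ps @ qs)) \<and>
      prod_list (map (vnorm E) (ps @ qs)) \<le> R ^ length (ps @ qs)"
    using assms by (intro prod_list_le_power) (auto simp: vnorm_nonneg subset_iff)
  have "norm (A (ps @ x # qs)) \<le> D * prod_list (map (vnorm E) (ps @ x # qs))"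
    using assms(1-4) unfolding bounded_form_def by (simp del: prod_list.Cons map_append)
  also have "\<dots> = D * prod_list (map (vnorm E) (ps @ qs)) * vnorm E x" by simp
  also have "\<dots> \<le> D * R ^ (length ps + length qs) * vnorm E x"
    using 1 D assms(4) by (intro mult_right_mono mult_left_mono) (auto simp: vnorm_nonneg)
  finally show ?thesis .
qed

text \<open>Telescoping over the slots: each of the \<open>m\<close> differences has one slot
  \<open>x \<ominus> y\<close> and \<open>n - 1\<close> slots filled with vectors of norm at most
  \<open>R\<close>.\<close>

lemma bounded_form_replicate_diff:
  assumes A: "A \<in> nforms n E" and D: "bounded_form E D A"
    and x: "x \<in> carrier E" "vnorm E x \<le> R" and y: "y \<in> carrier E" "vnorm E y \<le> R"
  shows "\<lbrakk>length ps + m = n; set ps \<subseteq> carrier E; \<And>z. z \<in> set ps \<Longrightarrow> vnorm E z \<le> R\<rbrakk> \<Longrightarrow>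
    norm (A (ps @ replicate m x) - A (ps @ replicate m y)) \<le> real m * (D * R ^ (n - 1) * vnorm E (x \<ominus> y))"
proof (induction m arbitrary: ps)
  case (Suc m)
  have "A (ps @ replicate (Suc m) x) - A (ps @ replicate (Suc m) y) =
     (A ((ps @ [x]) @ replicate m x) - A ((ps @ [x]) @ replicate m y)) + A (ps @ (x \<ominus> y) # replicate m y)"
    using Suc.prems x y by (subst nforms_diff[OF A]) (auto simp: set_replicate_conv_if)
  also have "norm \<dots> \<le> real m * (D * R ^ (n - 1) * vnorm E (x \<ominus> y)) + D * R ^ (length ps + length (replicate m y)) * vnorm E (x \<ominus> y)"
    using Suc.prems x y
    by (intro norm_triangle_le add_mono Suc.IH bounded_form_le[OF D]) (auto simp: set_replicate_conv_if split: if_splits)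
  also have "length ps + length (replicate m y) = n - 1" using Suc.prems by simp
  finally show ?case by (simp add: algebra_simps)
qed simp

lemma cpolyI:
  assumes A: "A \<in> nforms n E" and D: "bounded_form E D A"
    and P: "\<And>x. x \<in> carrier E \<Longrightarrow> P x = A (replicate n x)" "\<And>x. x \<notin> carrier E \<Longrightarrow> P x = 0"
  shows "P \<in> cpoly n E"
proof -
  have "continuous_map (ntopology E) euclidean P"
    unfolding continuous_map_iff
  proof (intro ballI allI impI)
    fix x and \<epsilon> :: real assume x: "x \<in> carrier E" and \<epsilon>: "\<epsilon> > 0"
    \<comment> \<open>A Lipschitz constant at \<open>x\<close> on the ball of radius
      \<open>vnorm E x + 1\<close>, which contains all points at distance less than 1 from
      \<open>x\<close>. The summand 1 in \<open>C + 1\<close> below prevents a division by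
      0.\<close>
    define C where "C = real n * (D * (vnorm E x + 1) ^ (n - 1))"
    have C: "C \<ge> 0" using D x by (auto simp: C_def bounded_form_def vnorm_nonneg)
    have "dist (P y) (P x) < \<epsilon>" if y: "y \<in> carrier E" "vnorm E (x \<ominus> y) < min 1 (\<epsilon> / (C + 1))" for y
    proof -
      have "vnorm E y \<le> vnorm E x + 1"
        using vnorm_le_diff_add[of y x] y x by (simp add: vnorm_diff_commute)
      with bounded_form_replicate_diff[OF A D x _ y(1), of "vnorm E x + 1" "[]" n]
      have "norm (P x - P y) \<le> C * vnorm E (x \<ominus> y)"
        using x y by (simp add: P C_def mult.assoc)
      also have "\<dots> \<le> C * (\<epsilon> / (C + 1))"
        using C y by (intro mult_left_mono) auto
      also have "\<dots> < \<epsilon>"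
        using C \<epsilon> by (simp add: field_simps)
      finally show ?thesis by (simp add: dist_norm norm_minus_commute)
    qed
    moreover have "min 1 (\<epsilon> / (C + 1)) > 0" using C \<epsilon> by simp
    ultimately show "\<exists>r>0. \<forall>y\<in>carrier E. vnorm E (x \<ominus> y) < r \<longrightarrow> dist (P y) (P x) < \<epsilon>" by blast
  qed
  with assms show ?thesis by (auto simp: cpoly_def)
qed

lemma cpoly_bounded:
  assumes P: "P \<in> cpoly n E" and R: "R > 0"
  obtains D where "0 \<le> D" "\<And>x. \<lbrakk>x \<in> carrier E; vnorm E x \<le> R\<rbrakk> \<Longrightarrow> norm (P x) \<le> D"
proof -
  obtain A where A: "A \<in> nforms n E" "\<And>x. x \<in> carrier E \<Longrightarrow> P x = A (replicate n x)"
    using P by (auto simp: cpoly_def)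
  have "continuous_map (ntopology E) euclidean P" using P by (simp add: cpoly_def)
  then obtain r where r: "r > 0" "\<And>y. \<lbrakk>y \<in> carrier E; vnorm E (\<zero> \<ominus> y) < r\<rbrakk> \<Longrightarrow> dist (P y) (P \<zero>) < 1"
    unfolding continuous_map_iff by (meson M.zero_closed zero_less_one)
  \<comment> \<open>Scaling by \<open>s\<close> sends the ball of radius \<open>R\<close> into the
    ball of radius \<open>r / 2\<close>, where continuity at zero controls \<open>P\<close>.
    Homogeneity then costs the factor \<open>1 / s ^ n\<close>.\<close>
  define s where "s = r / (2 * R)"
  have s: "s > 0" using r R by (simp add: s_def)
  show ?thesis
  proof (rule that)
    show "0 \<le> (norm (P \<zero>) + 1) / s ^ n" using s by simp
    fix x assume x: "x \<in> carrier E" "vnorm E x \<le> R"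
    define y where "y = (of_real s :: 'k) \<odot> x"
    have y: "y \<in> carrier E" using x by (simp add: y_def)
    have "vnorm E (\<zero> \<ominus> y) = s * vnorm E x"
      using x y s by (simp add: M.minus_eq) (simp add: y_def vnorm_smult)
    also have "\<dots> \<le> s * R" using x s by simp
    also have "\<dots> < r" using r R by (simp add: s_def)
    finally have "dist (P y) (P \<zero>) < 1" using r(2) y by blast
    then have "norm (P y) \<le> norm (P \<zero>) + 1"
      using norm_triangle_ineq2[of "P y" "P \<zero>"] by (simp add: dist_norm)
    moreover have "P y = of_real s ^ n * P x"
      using x y A nforms_replicate_smult[OF A(1), of x "of_real s"] by (simp add: y_def)
    ultimately have "s ^ n * norm (P x) \<le> norm (P \<zero>) + 1"
      using s by (simp add: norm_mult norm_power)
    then show "norm (P x) \<le> (norm (P \<zero>) + 1) / s ^ n"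
      using s by (simp add: field_simps)
  qed
qed

lemma assoc_form:
  assumes P: "P \<in> cpoly n E"
  shows "assoc_form n E P \<in> symmetric_nforms n E"
    and "\<And>x. x \<in> carrier E \<Longrightarrow> P x = assoc_form n E P (replicate n x)"
    and "\<exists>D. bounded_form E D (assoc_form n E P)"
proof -
  obtain A where A: "A \<in> nforms n E" "\<And>x. x \<in> carrier E \<Longrightarrow> P x = A (replicate n x)"
    using P by (auto simp: cpoly_def)
  obtain B where B: "B \<in> symmetric_nforms n E" "\<And>x. x \<in> carrier E \<Longrightarrow> B (replicate n x) = A (replicate n x)"
    using symmetrization[OF A(1)] by metis
  have eq: "assoc_form n E P = B"
    unfolding assoc_form_def
  proof (rule the_equality)
    fix C assume "C \<in> symmetric_nforms n E \<and> (\<forall>x\<in>carrier E. P x = C (replicate n x))"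
    then show "C = B" using A(2) B by (intro symmetric_nforms_eqI) auto
  qed (use A B in auto)
  show "assoc_form n E P \<in> symmetric_nforms n E" and PB: "\<And>x. x \<in> carrier E \<Longrightarrow> P x = assoc_form n E P (replicate n x)"
    using eq A B by auto
  \<comment> \<open>At vectors of norm at most 1 the polarization formula evaluates \<open>P\<close>
    at sums of at most \<open>n\<close> of them. The summand 1 keeps the radius positive when
    \<open>n = 0\<close>.\<close>
  obtain D where D: "0 \<le> D" "\<And>x. \<lbrakk>x \<in> carrier E; vnorm E x \<le> real n + 1\<rbrakk> \<Longrightarrow> norm (P x) \<le> D"
    using cpoly_bounded[OF P, of "real n + 1"] by auto
  have "bounded_form E (2 ^ n * D) B"
  proof (rule bounded_formI)
    fix xs assume xs: "xs \<in> tuples n E" "\<forall>x\<in>set xs. vnorm E x \<le> 1"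
    have "norm (fact n * B xs) \<le> (\<Sum>S\<in>Pow {..<n}. D)"
      unfolding polarization[OF B(1) xs(1)]
    proof (intro sum_norm_le)
      fix S assume S: "S \<in> Pow {..<n}"
      then have fin: "finite S" and nth: "\<And>i. i \<in> S \<Longrightarrow> xs ! i \<in> carrier E \<and> vnorm E (xs ! i) \<le> 1"
        using xs by (auto simp: tuples_def subset_iff intro: finite_subset[of _ "{..<n}"])
      have "vnorm E (\<Oplus>i\<in>S. xs ! i) \<le> (\<Sum>i\<in>S. 1)"
        using nth by (intro order.trans[OF vnorm_finsum_le[OF fin]] sum_mono) auto
      also have "\<dots> \<le> real n + 1"
        using S card_mono[of "{..<n}" S] by auto
      finally have "norm (P (\<Oplus>i\<in>S. xs ! i)) \<le> D" using nth by (intro D finsum_in) auto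
      then show "norm ((- 1) ^ (n - card S) * B (replicate n (\<Oplus>i\<in>S. xs ! i))) \<le> D"
        using PB eq nth by (simp add: norm_mult norm_power finsum_in)
    qed
    then have "fact n * norm (B xs) \<le> 2 ^ n * D"
      by (simp add: norm_mult card_Pow)
    moreover have "1 * norm (B xs) \<le> fact n * norm (B xs)"
      by (intro mult_right_mono) (auto simp: fact_ge_1)
    ultimately show "norm (B xs) \<le> 2 ^ n * D" by linarith
  qed (use symmetric_nforms_nforms[OF B(1)] D in auto)
  then show "\<exists>D. bounded_form E D (assoc_form n E P)" using eq by auto
qed

end

section \<open>Limits along an ultrafilter\<close>

lemma ultrafilter_not_bot: "ultrafilter U \<Longrightarrow> U \<noteq> bot"
  by (simp add: ultrafilter_def)

lemma ultrafilter_not_eventually: "\<lbrakk>ultrafilter U; \<not> eventually P U\<rbrakk> \<Longrightarrow> eventually (\<lambda>i. \<not> P i) U"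
  unfolding ultrafilter_def by blast

text \<open>Eventually the values lie in a closed ball, which is compact, so the image filter has a
  cluster point. Along an ultrafilter a cluster point is a limit: a neighbourhood that is not
  eventually entered is eventually avoided.\<close>

lemma ultrafilter_convergent:
  fixes f :: "'i \<Rightarrow> 'k::{real_normed_vector, heine_borel}"
  assumes U: "ultrafilter U" and bd: "eventually (\<lambda>i. norm (f i) \<le> C) U"
  shows "(f \<longlongrightarrow> Lim U f) U"
proof -
  have "filtermap f U \<noteq> bot"
    using U by (simp add: ultrafilter_def filtermap_bot_iff)
  moreover have "eventually (\<lambda>x. x \<in> cball 0 C) (filtermap f U)"
    using bd by (simp add: eventually_filtermap)
  ultimately obtain l where l: "inf (nhds l) (filtermap f U) \<noteq> bot"
    using compact_cball[of 0 C] unfolding compact_filter by blast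
  have "(f \<longlongrightarrow> l) U"
  proof (rule topological_tendstoI, rule ccontr)
    fix S assume "open S" "l \<in> S" "\<not> eventually (\<lambda>i. f i \<in> S) U"
    then have "eventually (\<lambda>x. x \<in> S) (nhds l)" "eventually (\<lambda>x. x \<notin> S) (filtermap f U)"
      using ultrafilter_not_eventually[OF U] by (auto simp: eventually_filtermap eventually_nhds)
    then have "eventually (\<lambda>_. False) (inf (nhds l) (filtermap f U))"
      unfolding eventually_inf by (intro exI conjI) auto
    with l show False by (simp add: eventually_False)
  qed
  then show ?thesis
    using tendsto_Lim[OF ultrafilter_not_bot[OF U]] by metis
qed

lemma ultrafilter_Lim: "\<lbrakk>ultrafilter U; (f \<longlongrightarrow> l) U\<rbrakk> \<Longrightarrow> Lim U f = l"
  by (simp add: tendsto_Lim ultrafilter_not_bot)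

section \<open>Iterated limits and iterated quantifiers\<close>

context
  fixes U :: "'i filter"
  assumes U: "ultrafilter U"
begin

lemma iterated_lim_le:
  fixes f :: "'i list \<Rightarrow> 'k::{real_normed_vector, heine_borel}"
  shows "(\<And>is. length is = n \<Longrightarrow> norm (f is) \<le> C) \<Longrightarrow> norm (iterated_lim U n f) \<le> C"
proof (induction n arbitrary: f)
  case (Suc n)
  have bd: "norm (iterated_lim U n (\<lambda>is. f (i # is))) \<le> C" for i
    by (rule Suc.IH) (simp add: Suc.prems)
  then have "((\<lambda>i. iterated_lim U n (\<lambda>is. f (i # is))) \<longlongrightarrow> iterated_lim U (Suc n) f) U"
    using ultrafilter_convergent[OF U, of "\<lambda>i. iterated_lim U n (\<lambda>is. f (i # is))" C] by simp
  then show ?case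
    by (rule Lim_norm_ubound[OF ultrafilter_not_bot[OF U]]) (simp add: bd)
qed simp

text \<open>\<open>Lim\<close> carries information only if the limit exists. The uniform bound
  passes to all inner limits and thereby guarantees that the outer one exists as well.\<close>

lemma iterated_lim_Suc:
  fixes f :: "'i list \<Rightarrow> 'k::{real_normed_vector, heine_borel}"
  assumes "\<And>is. length is = Suc n \<Longrightarrow> norm (f is) \<le> C"
  shows "((\<lambda>i. iterated_lim U n (\<lambda>is. f (i # is))) \<longlongrightarrow> iterated_lim U (Suc n) f) U"
proof -
  have "norm (iterated_lim U n (\<lambda>is. f (i # is))) \<le> C" for i
    by (rule iterated_lim_le) (simp add: assms)
  then show ?thesis
    using ultrafilter_convergent[OF U, of "\<lambda>i. iterated_lim U n (\<lambda>is. f (i # is))" C] by simp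
qed

lemma iterated_lim_add:
  fixes f g :: "'i list \<Rightarrow> 'k::{real_normed_vector, heine_borel}"
  shows "\<lbrakk>\<And>is. length is = n \<Longrightarrow> norm (f is) \<le> C; \<And>is. length is = n \<Longrightarrow> norm (g is) \<le> D\<rbrakk> \<Longrightarrow>
    iterated_lim U n (\<lambda>is. f is + g is) = iterated_lim U n f + iterated_lim U n g"
proof (induction n arbitrary: f g)
  case (Suc n)
  have "iterated_lim U n (\<lambda>is. f (i # is) + g (i # is)) =
      iterated_lim U n (\<lambda>is. f (i # is)) + iterated_lim U n (\<lambda>is. g (i # is))" for i
    by (rule Suc.IH) (auto simp: Suc.prems)
  moreover have "((\<lambda>i. iterated_lim U n (\<lambda>is. f (i # is)) + iterated_lim U n (\<lambda>is. g (i # is))) \<longlongrightarrow>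
      iterated_lim U (Suc n) f + iterated_lim U (Suc n) g) U"
    by (intro tendsto_add iterated_lim_Suc) (use Suc.prems in blast)+
  ultimately show ?case
    using ultrafilter_Lim[OF U] by simp
qed simp

lemma iterated_lim_cmult:
  fixes f :: "'i list \<Rightarrow> 'k::{real_normed_field, heine_borel}"
  shows "(\<And>is. length is = n \<Longrightarrow> norm (f is) \<le> C) \<Longrightarrow>
    iterated_lim U n (\<lambda>is. c * f is) = c * iterated_lim U n f"
proof (induction n arbitrary: f)
  case (Suc n)
  have "iterated_lim U n (\<lambda>is. c * f (i # is)) = c * iterated_lim U n (\<lambda>is. f (i # is))" for i
    by (rule Suc.IH) (auto simp: Suc.prems)
  moreover have "((\<lambda>i. c * iterated_lim U n (\<lambda>is. f (i # is))) \<longlongrightarrow> c * iterated_lim U (Suc n) f) U"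
    by (intro tendsto_mult tendsto_const iterated_lim_Suc) (use Suc.prems in blast)
  ultimately show ?case
    using ultrafilter_Lim[OF U] by simp
qed simp

text \<open>The bound depends on the indices. Once the outermost index is fixed, its factor is
  absorbed into the constant, so the induction has to vary \<open>D\<close>.\<close>

lemma iterated_lim_prod_bound:
  fixes f :: "'i list \<Rightarrow> 'k::{real_normed_vector, heine_borel}" and xs :: "'x list"
  assumes conv: "\<And>x. x \<in> set xs \<Longrightarrow> (g x \<longlongrightarrow> r x) U"
    and "\<And>x i. x \<in> set xs \<Longrightarrow> 0 \<le> g x i"
    and "\<And>is. length is = length xs \<Longrightarrow> norm (f is) \<le> D * prod_list (map2 g xs is)" and "0 \<le> D"
  shows "norm (iterated_lim U (length xs) f) \<le> D * prod_list (map r xs)"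
  using assms
proof (induction xs arbitrary: f D)
  case (Cons x xs)
  have le: "norm (iterated_lim U (length xs) (\<lambda>is. f (i # is))) \<le> D * g x i * prod_list (map r xs)" for i
    using Cons.prems(3)[of "i # _"] Cons.prems(1,2,4)
    by (intro Cons.IH) (auto simp: mult.assoc)
  have lim: "((\<lambda>i. D * g x i * prod_list (map r xs)) \<longlongrightarrow> D * r x * prod_list (map r xs)) U"
    by (intro tendsto_intros Cons.prems) simp
  \<comment> \<open>\<open>g x\<close> is only known to converge. Convergence makes \<open>B\<close>
    an eventual bound for the inner limits, which is enough for the outer limit to exist.\<close>
  define B where "B = D * r x * prod_list (map r xs) + 1"
  have "eventually (\<lambda>i. D * g x i * prod_list (map r xs) < B) U"
    by (rule order_tendstoD(2)[OF lim]) (simp add: B_def)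
  then have "eventually (\<lambda>i. norm (iterated_lim U (length xs) (\<lambda>is. f (i # is))) \<le> B) U"
    by eventually_elim (use le order.trans less_imp_le in blast)
  then have "((\<lambda>i. iterated_lim U (length xs) (\<lambda>is. f (i # is))) \<longlongrightarrow> iterated_lim U (length (x # xs)) f) U"
    using ultrafilter_convergent[OF U] by auto
  then have "norm (iterated_lim U (length (x # xs)) f) \<le> D * r x * prod_list (map r xs)"
    by (rule tendsto_le[OF ultrafilter_not_bot[OF U] lim tendsto_norm]) (intro always_eventually allI le)
  then show ?case by (simp add: mult.assoc)
qed simp

text \<open>The \<open>n\<close>-fold quantifier over almost all indices, that is, membership in the
  iterated product of \<open>U\<close> with itself, nested in the same order as
  \<open>iterated_lim\<close>. It turns approximation of an iterated limit into a condition on index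
  tuples.\<close>

primrec iterated_ev :: "nat \<Rightarrow> ('i list \<Rightarrow> bool) \<Rightarrow> bool" where
  "iterated_ev 0 Q = Q []"
| "iterated_ev (Suc n) Q = eventually (\<lambda>i. iterated_ev n (\<lambda>is. Q (i # is))) U"

lemma iterated_ev_mono:
  "\<lbrakk>iterated_ev n Q; \<And>is. \<lbrakk>length is = n; Q is\<rbrakk> \<Longrightarrow> R is\<rbrakk> \<Longrightarrow> iterated_ev n R"
proof (induction n arbitrary: Q R)
  case (Suc n)
  from Suc.prems(1) have "eventually (\<lambda>i. iterated_ev n (\<lambda>is. Q (i # is))) U" by simp
  then have "eventually (\<lambda>i. iterated_ev n (\<lambda>is. R (i # is))) U"
  proof eventually_elim
    case (elim i)
    then show ?case by (rule Suc.IH) (simp add: Suc.prems(2))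
  qed
  then show ?case by simp
qed simp

lemma iterated_ev_conj:
  "\<lbrakk>iterated_ev n Q; iterated_ev n R\<rbrakk> \<Longrightarrow> iterated_ev n (\<lambda>is. Q is \<and> R is)"
proof (induction n arbitrary: Q R)
  case (Suc n)
  then have "eventually (\<lambda>i. iterated_ev n (\<lambda>is. Q (i # is))) U"
    "eventually (\<lambda>i. iterated_ev n (\<lambda>is. R (i # is))) U" by simp_all
  then have "eventually (\<lambda>i. iterated_ev n (\<lambda>is. Q (i # is) \<and> R (i # is))) U"
    by eventually_elim (rule Suc.IH)
  then show ?case by simp
qed simp

lemma iterated_ev_True: "(\<And>is. length is = n \<Longrightarrow> Q is) \<Longrightarrow> iterated_ev n Q"
  by (induction n arbitrary: Q) (auto intro!: always_eventually)

lemma iterated_ev_Ball: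
  "\<lbrakk>finite F; \<And>x. x \<in> F \<Longrightarrow> iterated_ev n (Q x)\<rbrakk> \<Longrightarrow> iterated_ev n (\<lambda>is. \<forall>x\<in>F. Q x is)"
proof (induction F rule: finite_induct)
  case (insert x F)
  then have "iterated_ev n (\<lambda>is. Q x is \<and> (\<forall>x\<in>F. Q x is))"
    by (intro iterated_ev_conj) auto
  then show ?case by (rule iterated_ev_mono) simp
qed (simp add: iterated_ev_True)

lemma iterated_ev_set: "eventually G U \<Longrightarrow> iterated_ev n (\<lambda>is. \<forall>i\<in>set is. G i)"
proof (induction n)
  case (Suc n)
  have "eventually (\<lambda>i. iterated_ev n (\<lambda>is. \<forall>j\<in>set (i # is). G j)) U"
    using Suc.prems by eventually_elim (rule iterated_ev_mono[OF Suc.IH[OF Suc.prems]], simp)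
  then show ?case by simp
qed simp

lemma iterated_ev_ex: "iterated_ev n Q \<Longrightarrow> \<exists>is. length is = n \<and> Q is"
proof (induction n arbitrary: Q)
  case (Suc n)
  then obtain i where "iterated_ev n (\<lambda>is. Q (i # is))"
    using eventually_happens'[OF ultrafilter_not_bot[OF U]] by auto
  with Suc.IH obtain "is" where "length is = n" "Q (i # is)" by blast
  then show ?case by (intro exI[of _ "i # is"]) simp
qed simp

text \<open>Positions outside \<open>K\<close> are quantified without any condition, and
  \<open>nths\<close> preserves the order, so the other quantifiers stay nested as before. In this
  way one long tuple can serve all of its increasing subtuples.\<close>

lemma iterated_ev_nths:
  "\<lbrakk>iterated_ev n Q; K \<subseteq> {..<m}; card K = n\<rbrakk> \<Longrightarrow> iterated_ev m (\<lambda>is. Q (nths is K))"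
proof (induction m arbitrary: n Q K)
  case (Suc m)
  \<comment> \<open>The positions of \<open>K\<close> in the tail, shifted down by one.\<close>
  define K' where "K' = {j. Suc j \<in> K}"
  have fin: "finite K" using Suc.prems(2) finite_subset by blast
  have K': "K' \<subseteq> {..<m}" "finite K'" using Suc.prems(2) finite_subset[of K' "{..<m}"] by (auto simp: K'_def)
  have nths_Cons: "nths (i # is) K = (if 0 \<in> K then [i] else []) @ nths is K'" for i "is"
    by (simp add: nths_Cons K'_def)
  show ?case
  proof (cases "0 \<in> K")
    case True
    then have "K = insert 0 (Suc ` K')"
      by (auto simp: K'_def image_iff) (metis not0_implies_Suc)
    with K' have "card K = Suc (card K')" by (simp add: card_image)
    with Suc.prems have n: "n = Suc (card K')" by simp
    with Suc.prems(1) have "eventually (\<lambda>i. iterated_ev (card K') (\<lambda>is. Q (i # is))) U" by simp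
    then have "eventually (\<lambda>i. iterated_ev m (\<lambda>is. Q (nths (i # is) K))) U"
    proof eventually_elim
      case (elim i)
      from Suc.IH[OF this K'(1) refl] show ?case using True by (simp add: nths_Cons)
    qed
    then show ?thesis by simp
  next
    case False
    then have "K = Suc ` K'"
      by (auto simp: K'_def image_iff) (metis not0_implies_Suc)
    with K' have "card K' = n" using Suc.prems(3) by (simp add: card_image)
    from Suc.IH[OF Suc.prems(1) K'(1) this] False show ?thesis
      by (simp add: nths_Cons)
  qed
qed simp

text \<open>The error is split evenly between the outermost limit and the inner iterated limit.
  Finitely many such approximations hold at a common tuple, by \<open>iterated_ev_Ball\<close> and
  \<open>iterated_ev_ex\<close>.\<close>

lemma iterated_ev_near:
  fixes f :: "'i list \<Rightarrow> 'k::{real_normed_vector, heine_borel}"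
  shows "\<lbrakk>\<And>is. length is = n \<Longrightarrow> norm (f is) \<le> C; 0 < \<epsilon>\<rbrakk> \<Longrightarrow>
    iterated_ev n (\<lambda>is. norm (f is - iterated_lim U n f) < \<epsilon>)"
proof (induction n arbitrary: f \<epsilon>)
  case (Suc n)
  have "((\<lambda>i. iterated_lim U n (\<lambda>is. f (i # is))) \<longlongrightarrow> iterated_lim U (Suc n) f) U"
    by (rule iterated_lim_Suc) (rule Suc.prems)
  then have "eventually (\<lambda>i. dist (iterated_lim U n (\<lambda>is. f (i # is))) (iterated_lim U (Suc n) f) < \<epsilon> / 2) U"
    by (rule tendstoD) (use Suc.prems in simp)
  then have "eventually (\<lambda>i. iterated_ev n (\<lambda>is. norm (f (i # is) - iterated_lim U (Suc n) f) < \<epsilon>)) U"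
  proof eventually_elim
    case (elim i)
    have "iterated_ev n (\<lambda>is. norm (f (i # is) - iterated_lim U n (\<lambda>is. f (i # is))) < \<epsilon> / 2)"
      using Suc.prems by (intro Suc.IH) auto
    then show ?case
    proof (rule iterated_ev_mono)
      fix "is" assume "norm (f (i # is) - iterated_lim U n (\<lambda>is. f (i # is))) < \<epsilon> / 2"
      with elim show "norm (f (i # is) - iterated_lim U (Suc n) f) < \<epsilon>"
        using dist_triangle_half_l[of "f (i # is)" "iterated_lim U n (\<lambda>is. f (i # is))" \<epsilon> "iterated_lim U (Suc n) f"]
        by (simp add: dist_norm norm_minus_commute)
    qed
  qed
  then show ?case by (simp only: iterated_ev.simps)
qed simp

end

section \<open>Finite-dimensional subspaces\<close>

definition lspan :: "('k, 'u) nspace \<Rightarrow> 'u set \<Rightarrow> 'u set" where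
  "lspan E B = {\<Oplus>\<^bsub>E\<^esub>b\<in>B. c b \<odot>\<^bsub>E\<^esub> b | c. True}"

lemma lspanI: "(\<Oplus>\<^bsub>E\<^esub>b\<in>B. c b \<odot>\<^bsub>E\<^esub> b) \<in> lspan E B"
  unfolding lspan_def by blast

lemma lspanE:
  assumes "x \<in> lspan E B"
  obtains c where "x = (\<Oplus>\<^bsub>E\<^esub>b\<in>B. c b \<odot>\<^bsub>E\<^esub> b)"
  using assms unfolding lspan_def by blast

context normed_space
begin

lemma lincomb_in: "B \<subseteq> carrier E \<Longrightarrow> (\<Oplus>b\<in>B. c b \<odot> b) \<in> carrier E"
  by (intro finsum_in) auto

lemma lincomb_add:
  assumes "finite B" "B \<subseteq> carrier E"
  shows "(\<Oplus>b\<in>B. c b \<odot> b) \<oplus> (\<Oplus>b\<in>B. d b \<odot> b) = (\<Oplus>b\<in>B. (c b + d b) \<odot> b)"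
proof -
  have "(\<Oplus>b\<in>B. (c b + d b) \<odot> b) = (\<Oplus>b\<in>B. c b \<odot> b \<oplus> d b \<odot> b)"
    using assms by (intro M.finsum_cong') (auto simp: smult_add_left subset_iff)
  also have "\<dots> = (\<Oplus>b\<in>B. c b \<odot> b) \<oplus> (\<Oplus>b\<in>B. d b \<odot> b)"
    using assms by (intro finsum_add) auto
  finally show ?thesis by (rule sym)
qed

lemma lincomb_diff:
  "\<lbrakk>finite B; B \<subseteq> carrier E\<rbrakk> \<Longrightarrow>
    (\<Oplus>b\<in>B. c b \<odot> b) \<ominus> (\<Oplus>b\<in>B. d b \<odot> b) = (\<Oplus>b\<in>B. (c b - d b) \<odot> b)"
  by (subst finsum_diff[symmetric]) (auto simp: smult_diff_left subset_iff intro!: M.finsum_cong')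

lemma lincomb_smult:
  "\<lbrakk>finite B; B \<subseteq> carrier E\<rbrakk> \<Longrightarrow> a \<odot> (\<Oplus>b\<in>B. c b \<odot> b) = (\<Oplus>b\<in>B. (a * c b) \<odot> b)"
  by (subst finsum_smult) (auto simp: smult_smult subset_iff intro!: M.finsum_cong')

lemma lincomb_insert:
  "\<lbrakk>finite B; insert a B \<subseteq> carrier E; a \<notin> B\<rbrakk> \<Longrightarrow>
    (\<Oplus>b\<in>insert a B. c b \<odot> b) = c a \<odot> a \<oplus> (\<Oplus>b\<in>B. c b \<odot> b)"
  by (subst M.finsum_insert) auto

lemma lincomb_norm_le:
  "\<lbrakk>finite B; B \<subseteq> carrier E\<rbrakk> \<Longrightarrow> vnorm E (\<Oplus>b\<in>B. c b \<odot> b) \<le> (\<Sum>b\<in>B. norm (c b) * vnorm E b)"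
  by (rule order.trans[OF vnorm_finsum_le]) (auto simp: vnorm_smult subset_iff intro!: sum_mono)

lemma lincomb_diff_le:
  "\<lbrakk>finite B; B \<subseteq> carrier E\<rbrakk> \<Longrightarrow>
    vnorm E ((\<Oplus>b\<in>B. c b \<odot> b) \<ominus> (\<Oplus>b\<in>B. d b \<odot> b)) \<le> (\<Sum>b\<in>B. norm (c b - d b) * vnorm E b)"
  by (simp add: lincomb_diff lincomb_norm_le)

lemma lspan_subset: "B \<subseteq> carrier E \<Longrightarrow> lspan E B \<subseteq> carrier E"
  by (auto elim!: lspanE intro: lincomb_in)

lemma lspan_add: "\<lbrakk>finite B; B \<subseteq> carrier E; x \<in> lspan E B; y \<in> lspan E B\<rbrakk> \<Longrightarrow> x \<oplus> y \<in> lspan E B"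
  by (auto elim!: lspanE simp: lincomb_add intro: lspanI)

lemma lspan_smult: "\<lbrakk>finite B; B \<subseteq> carrier E; x \<in> lspan E B\<rbrakk> \<Longrightarrow> a \<odot> x \<in> lspan E B"
  by (auto elim!: lspanE simp: lincomb_smult intro: lspanI)

lemma lspan_base:
  assumes "finite B" "B \<subseteq> carrier E" "a \<in> B"
  shows "a \<in> lspan E B"
proof -
  have "(\<Oplus>b\<in>B. (if b = a then 1 else 0) \<odot> b) = (\<Oplus>b\<in>B. if a = b then b else \<zero>)"
    using assms by (intro M.finsum_cong') auto
  also have "\<dots> = a"
    using assms by (intro M.add.finprod_singleton) auto
  finally show ?thesis using lspanI[of E "\<lambda>b. if b = a then 1 else 0" B] by simp
qed

lemma lspan_zero: "\<lbrakk>finite B; B \<subseteq> carrier E\<rbrakk> \<Longrightarrow> \<zero> \<in> lspan E B"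
  using lspan_smult[OF _ _ lspanI[of E "\<lambda>_. 0" B], of 0] lincomb_in[of B "\<lambda>_. 0"] by simp

lemma submodule_iff:
  "submodule M (ring_of_type_algebra :: 'k ring) E \<longleftrightarrow> M \<subseteq> carrier E \<and> \<zero> \<in> M \<and>
     (\<forall>x\<in>M. \<forall>y\<in>M. x \<oplus> y \<in> M) \<and> (\<forall>c. \<forall>x\<in>M. c \<odot> x \<in> M)" (is "?L \<longleftrightarrow> ?R")
proof
  assume L: ?L
  have c: "c \<odot> x \<in> M" if "x \<in> M" for c x
    by (rule submoduleE(4)[OF L]) (use that in \<open>auto simp: ring_of_type_algebra_def\<close>)
  obtain x where x: "x \<in> M" using submoduleE(2)[OF L] by blast
  have M: "M \<subseteq> carrier E" by (rule submoduleE(1)[OF L])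
  have "0 \<odot> x = \<zero>" using x M by auto
  with c[OF x, of 0] M c submoduleE(5)[OF L] show ?R by auto
next
  assume R: ?R
  show ?L
  proof (rule submoduleI)
    fix a assume a: "a \<in> M"
    with R have "\<ominus> a = (- 1) \<odot> a" by (auto simp: neg_eq_smult)
    with R a show "\<ominus> a \<in> M" by auto
  qed (use R in auto)
qed

lemma lspan_FIN: "\<lbrakk>finite B; B \<subseteq> carrier E\<rbrakk> \<Longrightarrow> lspan E B \<in> FIN E"
  unfolding FIN_def submodule_iff
  by (intro CollectI conjI ballI allI exI[of _ B] lspan_subset lspan_zero lspan_add lspan_smult)
     (auto intro: lspan_base elim: lspanE)

lemma subspace_normed:
  assumes "submodule M (ring_of_type_algebra :: 'k ring) E"
  shows "normed_space (subspace_of E M)"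
proof -
  have M: "x \<in> carrier E" if "x \<in> M" for x
    using assms that unfolding submodule_iff by blast
  have "module (ring_of_type_algebra :: 'k ring) (subspace_of E M)"
    unfolding subspace_of_def by (rule submodule.submodule_is_module[OF assms]) (rule module_axioms)
  moreover have "normed_space_axioms (subspace_of E M)"
    by (rule normed_space_axioms.intro)
       (auto simp: subspace_of_def vnorm_nonneg vnorm_smult vnorm_triangle vnorm_eq_0_iff dest!: M)
  ultimately show ?thesis by (rule normed_space.intro)
qed

lemma subspace_diff:
  assumes "submodule M (ring_of_type_algebra :: 'k ring) E" "x \<in> M" "y \<in> M"
  shows "x \<ominus>\<^bsub>subspace_of E M\<^esub> y = x \<ominus> y"
proof -
  interpret S: normed_space "subspace_of E M" by (rule subspace_normed[OF assms(1)])
  have "x \<in> carrier E" "y \<in> carrier E" using assms unfolding submodule_iff by auto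
  with S.diff_eq_smult[of x y] assms(2,3) show ?thesis
    by (simp add: subspace_of_def diff_eq_smult)
qed

end

text \<open>The same axioms over scalars whose closed balls are compact, so that scalar Cauchy
  sequences converge and bounded scalar families converge along an ultrafilter.\<close>

locale hb_space = normed_space E for E :: "('k::{real_normed_field, heine_borel}, 'u) nspace" (structure)
begin

text \<open>Points of the span that approach \<open>a\<close> have Cauchy coordinates, so \<open>a\<close> would be in the span.\<close>

lemma positive_distance:
  assumes B: "finite B" "B \<subseteq> carrier E" and a: "a \<in> carrier E" "a \<notin> lspan E B"
    and C: "0 \<le> C" "\<And>c b. b \<in> B \<Longrightarrow> norm (c b) \<le> C * vnorm E (\<Oplus>b\<in>B. c b \<odot> b)"
  obtains \<delta> where "0 < \<delta>" "\<And>c. \<delta> \<le> vnorm E (a \<ominus> (\<Oplus>b\<in>B. c b \<odot> b))"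
proof (rule ccontr)
  note in_E = lincomb_in[OF B(2)]
  assume "\<not> thesis"
  then have "\<forall>k. \<exists>c. vnorm E (a \<ominus> (\<Oplus>b\<in>B. c b \<odot> b)) < inverse (real (Suc k))"
    using that by (metis inverse_positive_iff_positive not_le of_nat_0_less_iff zero_less_Suc)
  then obtain c where c: "\<And>k. vnorm E (a \<ominus> (\<Oplus>b\<in>B. c k b \<odot> b)) < inverse (real (Suc k))" by metis
  have "convergent (\<lambda>k. c k b)" if b: "b \<in> B" for b
  proof (rule Cauchy_convergent, rule CauchyI)
    fix \<epsilon> :: real assume \<epsilon>: "0 < \<epsilon>"
    obtain N where N: "inverse (real (Suc N)) < \<epsilon> / (C + 1) / 2"
      using reals_Archimedean[of "\<epsilon> / (C + 1) / 2"] \<epsilon> C by auto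
    have "norm (c p b - c q b) < \<epsilon>" if "p \<ge> N" "q \<ge> N" for p q
    proof -
      have small: "vnorm E (a \<ominus> (\<Oplus>b\<in>B. c p b \<odot> b)) < \<epsilon> / (C + 1) / 2" if "p \<ge> N" for p
        using c[of p] N that by (smt (verit) le_imp_inverse_le of_nat_0_less_iff of_nat_mono zero_less_Suc Suc_le_mono)
      have "norm (c p b - c q b) \<le> C * vnorm E (\<Oplus>b\<in>B. (c p b - c q b) \<odot> b)"
        by (rule C(2)[OF b])
      also have "(\<Oplus>b\<in>B. (c p b - c q b) \<odot> b) = (\<Oplus>b\<in>B. c p b \<odot> b) \<ominus> (\<Oplus>b\<in>B. c q b \<odot> b)"
        by (simp add: lincomb_diff B)
      also have "vnorm E \<dots> \<le> vnorm E (a \<ominus> (\<Oplus>b\<in>B. c p b \<odot> b)) + vnorm E (a \<ominus> (\<Oplus>b\<in>B. c q b \<odot> b))"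
        using vnorm_diff_triangle[OF in_E a(1) in_E, of "c p" "c q"] vnorm_diff_commute[OF a(1) in_E] by simp
      also have "\<dots> \<le> \<epsilon> / (C + 1)"
        using small[OF that(1)] small[OF that(2)] by linarith
      finally have "norm (c p b - c q b) \<le> C * (\<epsilon> / (C + 1))"
        using C(1) by (simp add: mult_left_mono)
      also have "\<dots> < \<epsilon>" using C(1) \<epsilon> by (simp add: field_simps)
      finally show ?thesis .
    qed
    then show "\<exists>M. \<forall>m\<ge>M. \<forall>n\<ge>M. norm (c m b - c n b) < \<epsilon>" by blast
  qed
  then have lim: "(\<lambda>k. c k b) \<longlonglongrightarrow> lim (\<lambda>k. c k b)" if "b \<in> B" for b
    using that by (simp add: convergent_LIMSEQ_iff)
  define g where "g b = lim (\<lambda>k. c k b)" for b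
  have "vnorm E (a \<ominus> (\<Oplus>b\<in>B. g b \<odot> b)) \<le> 0"
  proof (rule LIMSEQ_le_const)
    have "(\<lambda>k. \<Sum>b\<in>B. norm (c k b - g b) * vnorm E b) \<longlonglongrightarrow> 0"
      using lim unfolding g_def
      by (auto intro!: tendsto_null_sum tendsto_mult_left_zero tendsto_norm_zero LIM_zero)
    from tendsto_add[OF LIMSEQ_inverse_real_of_nat this]
    show "(\<lambda>k. inverse (real (Suc k)) + (\<Sum>b\<in>B. norm (c k b - g b) * vnorm E b)) \<longlonglongrightarrow> 0"
      by simp
    have "vnorm E (a \<ominus> (\<Oplus>b\<in>B. g b \<odot> b)) \<le> inverse (real (Suc k)) + (\<Sum>b\<in>B. norm (c k b - g b) * vnorm E b)" for k
      using vnorm_diff_triangle[OF a(1) in_E in_E, of g "c k"] lincomb_diff_le[OF B, of "c k" g] c[of k] by linarith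
    then show "\<exists>N. \<forall>k\<ge>N. vnorm E (a \<ominus> (\<Oplus>b\<in>B. g b \<odot> b)) \<le>
      inverse (real (Suc k)) + (\<Sum>b\<in>B. norm (c k b - g b) * vnorm E b)" by blast
  qed
  then have "a \<ominus> (\<Oplus>b\<in>B. g b \<odot> b) = \<zero>"
    using vnorm_nonneg[of "a \<ominus> (\<Oplus>b\<in>B. g b \<odot> b)"] a in_E by (simp add: vnorm_eq_0_iff)
  then have "a = (\<Oplus>b\<in>B. g b \<odot> b)"
    using a in_E by (simp add: diff_eq_zero_iff)
  with a(2) lspanI[of E g B] show False by simp
qed

text \<open>A basis is extracted together with the equivalence of norms. Independence is contained
  in the coordinate bound: a combination equal to zero has all coefficients 0. A new vector in the
  current span is dropped; otherwise its positive distance from that span bounds its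
  coefficient.\<close>

lemma bounded_coordinates:
  assumes "finite B" "B \<subseteq> carrier E"
  shows "\<exists>B0\<subseteq>B. lspan E B \<subseteq> lspan E B0 \<and>
    (\<exists>C\<ge>0. \<forall>c. \<forall>b\<in>B0. norm (c b) \<le> C * vnorm E (\<Oplus>b\<in>B0. c b \<odot> b))"
  using assms
proof (induction B rule: finite_induct)
  case empty
  show ?case by (intro exI[of _ "{}"] conjI exI[of _ 0]) auto
next
  case (insert a B)
  then obtain B0 C where B0: "B0 \<subseteq> B" "lspan E B \<subseteq> lspan E B0" and C0: "0 \<le> C"
    and C: "\<And>c b. b \<in> B0 \<Longrightarrow> norm (c b) \<le> C * vnorm E (\<Oplus>b\<in>B0. c b \<odot> b)"
    by auto
  have fin: "finite B0" using B0 insert.hyps finite_subset by blast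
  have in_E: "B0 \<subseteq> carrier E" "a \<in> carrier E" "B \<subseteq> carrier E" and nin: "a \<notin> B0"
    using B0 insert by auto
  show ?case
  proof (cases "a \<in> lspan E B0")
    case True
    have "lspan E (insert a B) \<subseteq> lspan E B0"
    proof
      fix x assume "x \<in> lspan E (insert a B)"
      then obtain c where "x = (\<Oplus>b\<in>insert a B. c b \<odot> b)" by (rule lspanE)
      then have "x = c a \<odot> a \<oplus> (\<Oplus>b\<in>B. c b \<odot> b)"
        using insert by (simp add: lincomb_insert)
      moreover have "(\<Oplus>b\<in>B. c b \<odot> b) \<in> lspan E B0" using B0(2) lspanI by blast
      ultimately show "x \<in> lspan E B0"
        using True by (simp add: lspan_add lspan_smult fin in_E)
    qed
    then show ?thesis using B0 C0 C by (intro exI[of _ B0]) auto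
  next
    case False
    obtain \<delta> where \<delta>: "0 < \<delta>" "\<And>c. \<delta> \<le> vnorm E (a \<ominus> (\<Oplus>b\<in>B0. c b \<odot> b))"
      using positive_distance[OF fin in_E(1,2) False C0 C] by metis
    \<comment> \<open>\<open>1 / \<delta>\<close> bounds the coefficient of \<open>a\<close>.
      Removing the part along \<open>a\<close> from a vector increases the norm by a factor of at
      most \<open>1 + vnorm E a / \<delta>\<close>, and \<open>C\<close> bounds the remaining
      coefficients.\<close>
    define C' where "C' = 1 / \<delta> + C * (1 + vnorm E a / \<delta>)"
    have bound: "norm (c b) \<le> C' * vnorm E (\<Oplus>b\<in>insert a B0. c b \<odot> b)" if b: "b \<in> insert a B0" for c b
    proof -
      define y where "y = (\<Oplus>b\<in>B0. c b \<odot> b)"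
      define x where "x = (\<Oplus>b\<in>insert a B0. c b \<odot> b)"
      have y: "y \<in> carrier E" unfolding y_def by (rule lincomb_in[OF in_E(1)])
      have x: "x = c a \<odot> a \<oplus> y" "x \<in> carrier E"
        unfolding x_def y_def using in_E nin fin by (simp_all add: lincomb_insert lincomb_in)
      have nn: "0 \<le> vnorm E x" "0 \<le> vnorm E a" using x in_E by (simp_all add: vnorm_nonneg)
      have ca: "norm (c a) * \<delta> \<le> vnorm E x"
      proof (cases "c a = 0")
        case False
        \<comment> \<open>Divided by its coefficient \<open>c a\<close>, the vector \<open>x\<close>
          is the difference of \<open>a\<close> and a point of the span, so the distance
          \<open>\<delta>\<close> applies to it.\<close>
        have "(\<Oplus>b\<in>B0. (- (1 / c a) * c b) \<odot> b) = \<ominus> ((1 / c a) \<odot> y)"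
          unfolding lincomb_smult[OF fin in_E(1), symmetric] y_def[symmetric] by (rule smult_minus_left[OF y])
        then have "c a \<odot> (a \<ominus> (\<Oplus>b\<in>B0. (- (1 / c a) * c b) \<odot> b)) = c a \<odot> (a \<oplus> (1 / c a) \<odot> y)"
          using y in_E(2) by (simp only: M.minus_eq M.minus_minus smult_in)
        also have "\<dots> = x"
          using False y in_E by (simp add: x smult_add_right smult_smult)
        finally have eq: "c a \<odot> (a \<ominus> (\<Oplus>b\<in>B0. (- (1 / c a) * c b) \<odot> b)) = x" .
        have "vnorm E x = norm (c a) * vnorm E (a \<ominus> (\<Oplus>b\<in>B0. (- (1 / c a) * c b) \<odot> b))"
          unfolding eq[symmetric] by (intro vnorm_smult diff_in lincomb_in in_E)
        then show ?thesis using \<delta>(2)[of "\<lambda>b. - (1 / c a) * c b"] by (simp add: mult_left_mono)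
      qed (use nn in simp)
      then have ca': "norm (c a) \<le> vnorm E x / \<delta>" using \<delta>(1) by (simp add: field_simps)
      have "y = x \<ominus> c a \<odot> a"
        using y in_E by (simp add: x M.minus_eq M.a_ac M.r_neg1 M.r_neg)
      then have "vnorm E y \<le> vnorm E x + norm (c a) * vnorm E a"
        using vnorm_diff_le[of x "c a \<odot> a"] x in_E by (simp add: vnorm_smult)
      also have "\<dots> \<le> vnorm E x + vnorm E x / \<delta> * vnorm E a"
        using ca' nn by (intro add_left_mono mult_right_mono)
      finally have "vnorm E y \<le> (1 + vnorm E a / \<delta>) * vnorm E x"
        by (simp add: algebra_simps)
      from mult_left_mono[OF this C0]
      have yle: "C * vnorm E y \<le> C * (1 + vnorm E a / \<delta>) * vnorm E x"
        by (simp only: mult.assoc)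
      have sum: "C' * vnorm E x = vnorm E x / \<delta> + C * (1 + vnorm E a / \<delta>) * vnorm E x"
        unfolding C'_def by (simp only: distrib_right times_divide_eq_left mult_1)
      have n1: "0 \<le> vnorm E x / \<delta>" "0 \<le> C * (1 + vnorm E a / \<delta>) * vnorm E x"
        using nn \<delta>(1) C0 by (simp_all add: add_nonneg_nonneg)
      have "norm (c b) \<le> C' * vnorm E x"
      proof (cases "b = a")
        case True
        with ca' sum n1 show ?thesis by simp
      next
        case False
        with b C[of b c] yle sum n1 show ?thesis by (simp add: y_def)
      qed
      then show ?thesis by (simp add: x_def)
    qed
    have "lspan E (insert a B) \<subseteq> lspan E (insert a B0)"
    proof
      fix x assume "x \<in> lspan E (insert a B)"
      then obtain c where "x = (\<Oplus>b\<in>insert a B. c b \<odot> b)" by (rule lspanE)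
      then have x: "x = c a \<odot> a \<oplus> (\<Oplus>b\<in>B. c b \<odot> b)"
        using insert by (simp add: lincomb_insert)
      have "(\<Oplus>b\<in>B. c b \<odot> b) \<in> lspan E B0" using B0(2) lspanI by blast
      then obtain d where d: "(\<Oplus>b\<in>B. c b \<odot> b) = (\<Oplus>b\<in>B0. d b \<odot> b)" by (rule lspanE)
      have "(\<Oplus>b\<in>insert a B0. (d(a := c a)) b \<odot> b) = c a \<odot> a \<oplus> (\<Oplus>b\<in>B0. (d(a := c a)) b \<odot> b)"
        using nin fin in_E by (simp add: lincomb_insert)
      also have "(\<Oplus>b\<in>B0. (d(a := c a)) b \<odot> b) = (\<Oplus>b\<in>B0. d b \<odot> b)"
        using nin in_E by (intro M.finsum_cong') auto
      finally have "x = (\<Oplus>b\<in>insert a B0. (d(a := c a)) b \<odot> b)" using x d by simp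
      then show "x \<in> lspan E (insert a B0)" using lspanI by simp
    qed
    moreover have "0 \<le> C'" using \<delta>(1) C0 in_E by (simp add: C'_def vnorm_nonneg)
    ultimately show ?thesis using bound B0 by (intro exI[of _ "insert a B0"]) blast
  qed
qed

text \<open>\<open>f x\<close> lists the coordinates of \<open>x\<close> in the extracted basis. The
  coordinate bound, applied to the difference of two representations, gives uniqueness, and
  uniqueness gives linearity of the coordinates.\<close>

lemma FIN_coordinates:
  assumes "M \<in> FIN E"
  obtains B f C where "finite B" "B \<subseteq> M" "0 \<le> C"
    "\<And>x. x \<in> M \<Longrightarrow> x = (\<Oplus>b\<in>B. f x b \<odot> b)"
    "\<And>x b. \<lbrakk>x \<in> M; b \<in> B\<rbrakk> \<Longrightarrow> norm (f x b) \<le> C * vnorm E x"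
    "\<And>x y b. \<lbrakk>x \<in> M; y \<in> M; b \<in> B\<rbrakk> \<Longrightarrow> f (x \<oplus> y) b = f x b + f y b"
    "\<And>a x b. \<lbrakk>x \<in> M; b \<in> B\<rbrakk> \<Longrightarrow> f (a \<odot> x) b = a * f x b"
proof -
  from assms have sub: "submodule M (ring_of_type_algebra :: 'k ring) E" by (simp add: FIN_def)
  then have M: "M \<subseteq> carrier E" "\<And>x y. \<lbrakk>x \<in> M; y \<in> M\<rbrakk> \<Longrightarrow> x \<oplus> y \<in> M" "\<And>a x. x \<in> M \<Longrightarrow> a \<odot> x \<in> M"
    unfolding submodule_iff by blast+
  from assms obtain B1 where B1: "finite B1" "B1 \<subseteq> M"
    "\<forall>x\<in>M. \<exists>c. x = (\<Oplus>b\<in>B1. c b \<odot> b)"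
    unfolding FIN_def by auto
  have B1E: "B1 \<subseteq> carrier E" using B1(2) M(1) by (rule order.trans)
  obtain B C where B: "B \<subseteq> B1" "lspan E B1 \<subseteq> lspan E B" and C0: "0 \<le> C"
    and C: "\<And>c b. b \<in> B \<Longrightarrow> norm (c b) \<le> C * vnorm E (\<Oplus>b\<in>B. c b \<odot> b)"
    using bounded_coordinates[OF B1(1) B1E] by auto
  have fin: "finite B" and BM: "B \<subseteq> M" and BE: "B \<subseteq> carrier E"
    using B B1 M finite_subset by auto
  have "\<exists>c. x = (\<Oplus>b\<in>B. c b \<odot> b)" if "x \<in> M" for x
  proof -
    have "x \<in> lspan E B1" using B1(3) that by (auto intro: lspanI)
    with B(2) have "x \<in> lspan E B" by blast
    then show ?thesis by (auto elim: lspanE)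
  qed
  then obtain f where f: "\<And>x. x \<in> M \<Longrightarrow> x = (\<Oplus>b\<in>B. f x b \<odot> b)" by metis
  have unique: "c b = d b" if "(\<Oplus>b\<in>B. c b \<odot> b) = (\<Oplus>b\<in>B. d b \<odot> b)" "b \<in> B" for c d b
  proof -
    have "(\<Oplus>b\<in>B. (c b - d b) \<odot> b) = \<zero>"
      using that(1) lincomb_in[OF BE] by (simp flip: lincomb_diff[OF fin BE])
    with C[of b "\<lambda>b. c b - d b"] that(2) show ?thesis by simp
  qed
  show ?thesis
  proof (rule that[OF fin BM C0 f])
    fix x b assume "x \<in> M" "b \<in> B"
    then show "norm (f x b) \<le> C * vnorm E x" using C[of b "f x"] by (simp flip: f)
  next
    fix x y b assume *: "x \<in> M" "y \<in> M" "b \<in> B"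
    have "(\<Oplus>b\<in>B. f (x \<oplus> y) b \<odot> b) = x \<oplus> y"
      by (rule f[OF M(2)[OF *(1,2)], symmetric])
    also have "\<dots> = (\<Oplus>b\<in>B. f x b \<odot> b) \<oplus> (\<Oplus>b\<in>B. f y b \<odot> b)"
      by (rule arg_cong2[of _ _ _ _ "(\<oplus>)", OF f[OF *(1)] f[OF *(2)]])
    also have "\<dots> = (\<Oplus>b\<in>B. (f x b + f y b) \<odot> b)"
      by (rule lincomb_add[OF fin BE])
    finally show "f (x \<oplus> y) b = f x b + f y b" by (rule unique) (rule *)
  next
    fix a x b assume *: "x \<in> M" "b \<in> B"
    have "(\<Oplus>b\<in>B. f (a \<odot> x) b \<odot> b) = a \<odot> x"
      by (rule f[OF M(3)[OF *(1)], symmetric])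
    also have "\<dots> = a \<odot> (\<Oplus>b\<in>B. f x b \<odot> b)"
      by (rule arg_cong[OF f[OF *(1)]])
    also have "\<dots> = (\<Oplus>b\<in>B. (a * f x b) \<odot> b)"
      by (rule lincomb_smult[OF fin BE])
    finally show "f (a \<odot> x) b = a * f x b" by (rule unique) (rule *)
  qed
qed

text \<open>A Cauchy sequence has Cauchy coordinates, and their limits recombine to a point of
  \<open>M\<close>. Completeness is wanted because the axioms of an ideal speak about Banach spaces,
  and they are applied to \<open>M\<close>.\<close>

lemma FIN_banach:
  assumes "M \<in> FIN E"
  shows "banach_space (subspace_of E M)"
proof -
  have sub: "submodule M (ring_of_type_algebra :: 'k ring) E" using assms by (simp add: FIN_def)
  then have M: "M \<subseteq> carrier E" "\<And>x y. \<lbrakk>x \<in> M; y \<in> M\<rbrakk> \<Longrightarrow> x \<oplus> y \<in> M" "\<And>a x. x \<in> M \<Longrightarrow> a \<odot> x \<in> M"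
    "\<zero> \<in> M"
    unfolding submodule_iff by blast+
  interpret S: normed_space "subspace_of E M" by (rule subspace_normed[OF sub])
  obtain B f C where B: "finite B" "B \<subseteq> M" and C: "0 \<le> C"
    and f: "\<And>x. x \<in> M \<Longrightarrow> x = (\<Oplus>b\<in>B. f x b \<odot> b)"
    "\<And>x b. \<lbrakk>x \<in> M; b \<in> B\<rbrakk> \<Longrightarrow> norm (f x b) \<le> C * vnorm E x"
    "\<And>x y b. \<lbrakk>x \<in> M; y \<in> M; b \<in> B\<rbrakk> \<Longrightarrow> f (x \<oplus> y) b = f x b + f y b"
    "\<And>a x b. \<lbrakk>x \<in> M; b \<in> B\<rbrakk> \<Longrightarrow> f (a \<odot> x) b = a * f x b"
    by (rule FIN_coordinates[OF assms]) (rule that)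
  have BE: "B \<subseteq> carrier E" using B M by blast
  have diff: "x \<ominus> y \<in> M" "\<And>b. b \<in> B \<Longrightarrow> f (x \<ominus> y) b = f x b - f y b" if "x \<in> M" "y \<in> M" for x y
  proof -
    have eq: "x \<ominus> y = x \<oplus> (- 1) \<odot> y" by (intro diff_eq_smult subsetD[OF M(1)] that)
    show "x \<ominus> y \<in> M" unfolding eq using that by (intro M)
    fix b assume "b \<in> B"
    then show "f (x \<ominus> y) b = f x b - f y b"
      unfolding eq using that f(3)[of x "(-1) \<odot> y" b] f(4)[of y b "-1"] M(3)[of y "-1"] by simp
  qed
  have car: "carrier (subspace_of E M) = M" "vnorm (subspace_of E M) = vnorm E" by (simp_all add: subspace_of_def)
  have lin: "(\<Oplus>b\<in>B'. g b \<odot> b) \<in> M" if "B' \<subseteq> B" for g B'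
    using finite_subset[OF that B(1)] that
  proof (induction B' rule: finite_induct)
    case (insert b B')
    then show ?case using M B BE by (subst lincomb_insert) auto
  qed (use M in simp)
  have "\<exists>x\<in>M. (\<lambda>k. vnorm E (s k \<ominus>\<^bsub>subspace_of E M\<^esub> x)) \<longlonglongrightarrow> 0"
    if s: "range s \<subseteq> M" and cauchy: "\<forall>\<epsilon>>0. \<exists>N. \<forall>p q. N \<le> p \<longrightarrow> N \<le> q \<longrightarrow> vnorm E (s p \<ominus>\<^bsub>subspace_of E M\<^esub> s q) < \<epsilon>" for s
  proof -
    have sM: "s k \<in> M" for k using s by blast
    have "convergent (\<lambda>k. f (s k) b)" if b: "b \<in> B" for b
    proof (rule Cauchy_convergent, rule CauchyI)
      fix \<epsilon> :: real assume \<epsilon>: "0 < \<epsilon>"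
      then obtain N where N: "\<And>p q. \<lbrakk>N \<le> p; N \<le> q\<rbrakk> \<Longrightarrow> vnorm E (s p \<ominus>\<^bsub>subspace_of E M\<^esub> s q) < \<epsilon> / (C + 1)"
        using cauchy C by (metis add_nonneg_pos divide_pos_pos zero_less_one)
      have "norm (f (s p) b - f (s q) b) < \<epsilon>" if "p \<ge> N" "q \<ge> N" for p q
      proof -
        have "norm (f (s p) b - f (s q) b) \<le> C * vnorm E (s p \<ominus> s q)"
          using f(2)[OF diff(1) b] diff(2)[OF _ _ b] sM by simp
        also have "\<dots> \<le> C * (\<epsilon> / (C + 1))"
          using N[OF that] C by (intro mult_left_mono) (simp_all add: subspace_diff[OF sub sM sM])
        also have "\<dots> < \<epsilon>" using C \<epsilon> by (simp add: field_simps)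
        finally show ?thesis .
      qed
      then show "\<exists>M. \<forall>m\<ge>M. \<forall>n\<ge>M. norm (f (s m) b - f (s n) b) < \<epsilon>" by blast
    qed
    then have lim: "(\<lambda>k. f (s k) b) \<longlonglongrightarrow> lim (\<lambda>k. f (s k) b)" if "b \<in> B" for b
      using that by (simp add: convergent_LIMSEQ_iff)
    define g where "g b = lim (\<lambda>k. f (s k) b)" for b
    define x where "x = (\<Oplus>b\<in>B. g b \<odot> b)"
    have xM: "x \<in> M" unfolding x_def by (rule lin) simp
    have le: "vnorm E (s k \<ominus> x) \<le> (\<Sum>b\<in>B. norm (f (s k) b - g b) * vnorm E b)" for k
      using lincomb_diff_le[OF B(1) BE, of "f (s k)" g] f(1)[OF sM[of k]] by (simp add: x_def)
    have lim0: "(\<lambda>k. \<Sum>b\<in>B. norm (f (s k) b - g b) * vnorm E b) \<longlonglongrightarrow> 0"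
      using lim unfolding g_def
      by (auto intro!: tendsto_null_sum tendsto_mult_left_zero tendsto_norm_zero LIM_zero)
    have "(\<lambda>k. vnorm E (s k \<ominus> x)) \<longlonglongrightarrow> 0"
      by (rule tendsto_sandwich[OF _ _ tendsto_const lim0])
         (use le sM xM M in \<open>auto intro!: always_eventually vnorm_nonneg\<close>)
    then show ?thesis using xM by (auto simp: subspace_diff[OF sub sM] intro!: bexI[of _ x])
  qed
  then show ?thesis
    unfolding banach_space_def S.mcomplete_iff unfolding car
    by (intro conjI S.normed_space_axioms allI impI) (elim conjE)
qed

end

section \<open>Multilinear forms along an ultrafilter\<close>

lemma iterated_lim_cong:
  "(\<And>is. length is = n \<Longrightarrow> f is = g is) \<Longrightarrow> iterated_lim U n f = iterated_lim U n g"
proof (induction n arbitrary: f g)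
  case (Suc n)
  have "iterated_lim U n (\<lambda>is. f (i # is)) = iterated_lim U n (\<lambda>is. g (i # is))" for i
    by (rule Suc.IH) (simp add: Suc.prems)
  then show ?case by simp
qed simp

lemma iterated_lim_const:
  fixes a :: "'k::{real_normed_vector, heine_borel}"
  assumes "ultrafilter U"
  shows "iterated_lim U n (\<lambda>_. a) = a"
  by (induction n) (simp_all add: ultrafilter_Lim[OF assms])

text \<open>On bounded families this is the identification made in the ultrapower. Working with the
  relation postpones the classes to the final construction of a model.\<close>

definition close :: "'i filter \<Rightarrow> ('k, 'u) nspace \<Rightarrow> ('i \<Rightarrow> 'u) \<Rightarrow> ('i \<Rightarrow> 'u) \<Rightarrow> bool" where
  "close U E z w \<longleftrightarrow> ((\<lambda>i. vnorm E (z i \<ominus>\<^bsub>E\<^esub> w i)) \<longlongrightarrow> 0) U"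

text \<open>Each slot has a family and an index of its own, so that multilinearity can be expressed.
  Equal families give the iterated extension, see \<open>family_form_replicate\<close>.\<close>

definition family_form :: "'i filter \<Rightarrow> ('u list \<Rightarrow> 'k::t2_space) \<Rightarrow> ('i \<Rightarrow> 'u) list \<Rightarrow> 'k" where
  "family_form U A zs = iterated_lim U (length zs) (\<lambda>is. A (map2 (\<lambda>z i. z i) zs is))"

lemma family_form_replicate:
  "family_form U A (replicate n z) = iterated_lim U n (\<lambda>is. A (map z is))"
proof -
  have "map2 (\<lambda>z i. z i) (replicate n z) is = map z is" if "length is = n" for "is"
    using that by (intro nth_equalityI) auto
  then show ?thesis unfolding family_form_def by (auto intro!: iterated_lim_cong)
qed

locale ultra_space = hb_space E for E :: "('k::{real_normed_field, heine_borel}, 'u) nspace" (structure) +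
  fixes U :: "'i filter"
  assumes ultra: "ultrafilter U"
begin

lemma family_in: "z \<in> bounded_families E \<Longrightarrow> z i \<in> carrier E"
  unfolding bounded_families_def by auto

lemma family_bound:
  assumes "z \<in> bounded_families E"
  obtains C where "\<And>i. vnorm E (z i) \<le> C"
  using assms unfolding bounded_families_def by blast

lemma bounded_familyI:
  "\<lbrakk>\<And>i. z i \<in> carrier E; \<And>i. vnorm E (z i) \<le> C\<rbrakk> \<Longrightarrow> z \<in> bounded_families E"
  unfolding bounded_families_def by blast

lemma bounded_families_const: "x \<in> carrier E \<Longrightarrow> (\<lambda>_. x) \<in> bounded_families E"
  by (rule bounded_familyI) auto

lemma bounded_families_add:
  assumes "z \<in> bounded_families E" "w \<in> bounded_families E"
  shows "(\<lambda>i. z i \<oplus> w i) \<in> bounded_families E"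
proof -
  obtain C D where "\<And>i. vnorm E (z i) \<le> C" "\<And>i. vnorm E (w i) \<le> D"
    using assms family_bound by meson
  then have "vnorm E (z i \<oplus> w i) \<le> C + D" for i
    using assms by (intro order.trans[OF vnorm_triangle] add_mono) (auto simp: family_in)
  then show ?thesis using assms by (intro bounded_familyI) (auto simp: family_in)
qed

lemma bounded_families_smult:
  assumes "z \<in> bounded_families E"
  shows "(\<lambda>i. c \<odot> z i) \<in> bounded_families E"
proof -
  obtain C where "\<And>i. vnorm E (z i) \<le> C"
    using assms family_bound by meson
  then have "vnorm E (c \<odot> z i) \<le> norm c * C" for i
    using assms by (auto simp: family_in vnorm_smult intro: mult_left_mono)
  then show ?thesis using assms by (intro bounded_familyI) (auto simp: family_in)
qed

lemma bounded_families_diff: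
  assumes "z \<in> bounded_families E" "w \<in> bounded_families E"
  shows "(\<lambda>i. z i \<ominus> w i) \<in> bounded_families E"
proof -
  have "(\<lambda>i. z i \<ominus> w i) = (\<lambda>i. z i \<oplus> (- 1) \<odot> w i)"
    using assms by (auto simp: family_in diff_eq_smult)
  then show ?thesis using assms by (simp add: bounded_families_add bounded_families_smult)
qed

lemma bounded_families_finsum:
  assumes "finite B" "\<And>b. b \<in> B \<Longrightarrow> z b \<in> bounded_families E"
  shows "(\<lambda>i. \<Oplus>b\<in>B. z b i) \<in> bounded_families E"
  using assms
proof (induction B rule: finite_induct)
  case empty
  then show ?case by (simp add: bounded_families_const)
next
  case (insert b B)
  then have "(\<lambda>i. \<Oplus>b\<in>insert b B. z b i) = (\<lambda>i. z b i \<oplus> (\<Oplus>b\<in>B. z b i))"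
    by (auto simp: family_in Pi_def)
  then show ?case using insert by (simp add: bounded_families_add)
qed

lemma family_norm_convergent:
  assumes "z \<in> bounded_families E"
  shows "((\<lambda>i. vnorm E (z i)) \<longlongrightarrow> Lim U (\<lambda>i. vnorm E (z i))) U"
proof -
  obtain C where "\<And>i. vnorm E (z i) \<le> C"
    using assms family_bound by meson
  then show ?thesis
    using assms by (intro ultrafilter_convergent[OF ultra, of _ C] always_eventually) (auto simp: family_in vnorm_nonneg)
qed

lemma closeI:
  assumes "(f \<longlongrightarrow> 0) U" "z \<in> bounded_families E" "w \<in> bounded_families E"
    "\<And>i. vnorm E (z i \<ominus> w i) \<le> f i"
  shows "close U E z w"
  unfolding close_def
  by (rule tendsto_sandwich[OF _ _ tendsto_const assms(1)])
     (use assms in \<open>auto intro!: always_eventually vnorm_nonneg simp: family_in\<close>)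

lemma close_refl: "z \<in> bounded_families E \<Longrightarrow> close U E z z"
  by (simp add: close_def family_in)

lemma close_sym: "\<lbrakk>close U E z w; z \<in> bounded_families E; w \<in> bounded_families E\<rbrakk> \<Longrightarrow> close U E w z"
  unfolding close_def by (simp add: family_in vnorm_diff_commute)

lemma close_trans:
  assumes "close U E z w" "close U E w v"
    "z \<in> bounded_families E" "w \<in> bounded_families E" "v \<in> bounded_families E"
  shows "close U E z v"
  using tendsto_add[OF assms(1,2)[unfolded close_def]] assms(3-)
  by (intro closeI[where f = "\<lambda>i. vnorm E (z i \<ominus> w i) + vnorm E (w i \<ominus> v i)"])
     (auto simp: family_in intro: vnorm_diff_triangle)

lemma close_add:
  assumes "close U E z w" "close U E z' w'" "z \<in> bounded_families E" "w \<in> bounded_families E"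
    "z' \<in> bounded_families E" "w' \<in> bounded_families E"
  shows "close U E (\<lambda>i. z i \<oplus> z' i) (\<lambda>i. w i \<oplus> w' i)"
  using tendsto_add[OF assms(1,2)[unfolded close_def]] assms(3-)
  by (intro closeI[where f = "\<lambda>i. vnorm E (z i \<ominus> w i) + vnorm E (z' i \<ominus> w' i)"] bounded_families_add)
     (auto simp: family_in add_diff_add intro: vnorm_triangle)

lemma close_smult:
  assumes "close U E z w" "z \<in> bounded_families E" "w \<in> bounded_families E"
  shows "close U E (\<lambda>i. c \<odot> z i) (\<lambda>i. c \<odot> w i)"
  using tendsto_mult_right_zero[OF assms(1)[unfolded close_def], of "norm c"] assms(2-)
  by (intro closeI[where f = "\<lambda>i. norm c * vnorm E (z i \<ominus> w i)"] bounded_families_smult)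
     (auto simp: family_in vnorm_smult simp flip: smult_diff_right)

lemma close_norm:
  assumes "close U E z w" "z \<in> bounded_families E" "w \<in> bounded_families E"
    "((\<lambda>i. vnorm E (w i)) \<longlongrightarrow> r) U"
  shows "((\<lambda>i. vnorm E (z i)) \<longlongrightarrow> r) U"
proof -
  have "((\<lambda>i. vnorm E (z i) - vnorm E (w i)) \<longlongrightarrow> 0) U"
    by (rule Lim_null_comparison[OF _ assms(1)[unfolded close_def]])
       (use assms in \<open>auto intro!: always_eventually abs_vnorm_diff_le simp: family_in\<close>)
  from tendsto_add[OF this assms(4)] show ?thesis by simp
qed

lemma map2_in_carrier:
  "set zs \<subseteq> bounded_families E \<Longrightarrow> set (map2 (\<lambda>z i. z i) zs is) \<subseteq> carrier E"
  by (auto simp: family_in subset_iff dest!: set_zip_leftD)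

lemma family_form_pointwise_bound:
  assumes "bounded_form E D A" "set zs \<subseteq> bounded_families E" "length is = length zs"
  shows "norm (A (map2 (\<lambda>z i. z i) zs is)) \<le> D * prod_list (map2 (\<lambda>z i. vnorm E (z i)) zs is)"
proof -
  have "set (map2 (\<lambda>z i. z i) zs is) \<subseteq> carrier E"
    using assms(2) by (auto simp: family_in subset_iff dest!: set_zip_leftD)
  then have "norm (A (map2 (\<lambda>z i. z i) zs is)) \<le> D * prod_list (map (vnorm E) (map2 (\<lambda>z i. z i) zs is))"
    using assms(1) unfolding bounded_form_def by blast
  then show ?thesis by (simp add: comp_def case_prod_unfold)
qed

text \<open>Supplies the uniform bound under which the iterated limits exist and are linear.\<close>

lemma family_form_bounded:
  fixes zs :: "('i \<Rightarrow> 'u) list"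
  assumes "bounded_form E D A" "set zs \<subseteq> bounded_families E"
  obtains C where "\<And>is. length is = length zs \<Longrightarrow> norm (A (map2 (\<lambda>z i. z i) zs is)) \<le> C"
proof -
  have "\<exists>R\<ge>0. \<forall>z\<in>set zs. \<forall>i. vnorm E (z i) \<le> R"
    using assms(2)
  proof (induction zs)
    case (Cons z zs)
    then obtain R where R: "R \<ge> 0" "\<forall>z\<in>set zs. \<forall>i. vnorm E (z i) \<le> R" by auto
    obtain C where C: "\<And>i. vnorm E (z i) \<le> C" using Cons.prems family_bound[of z] by auto
    show ?case
      using R C by (intro exI[of _ "max R C"]) (auto simp: le_max_iff_disj)
  qed auto
  then obtain R where R: "R \<ge> 0" "\<And>z i. z \<in> set zs \<Longrightarrow> vnorm E (z i) \<le> R" by blast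
  show ?thesis
  proof (rule that)
    fix "is" :: "'i list" assume len: "length is = length zs"
    have "prod_list (map (\<lambda>(z, i). vnorm E (z i)) (zip zs is)) \<le> R ^ length (zip zs is)"
      using R assms(2)
      by (intro prod_list_le_power[THEN conjunct2])
         (auto simp: vnorm_nonneg family_in subset_iff dest!: set_zip_leftD)
    then have "D * prod_list (map2 (\<lambda>z i. vnorm E (z i)) zs is) \<le> D * R ^ length zs"
      using assms(1) len by (intro mult_left_mono) (auto simp: bounded_form_def)
    then show "norm (A (map2 (\<lambda>z i. z i) zs is)) \<le> D * R ^ length zs"
      using family_form_pointwise_bound[OF assms len] by linarith
  qed
qed

text \<open>The bound contains the limits of the norms and not their suprema, so that a null family
  in a single slot makes the whole form vanish.\<close>

lemma family_form_norm_le: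
  assumes D: "bounded_form E D A" and z: "\<And>x. x \<in> set xs \<Longrightarrow> z x \<in> bounded_families E"
    and r: "\<And>x. x \<in> set xs \<Longrightarrow> ((\<lambda>i. vnorm E (z x i)) \<longlongrightarrow> r x) U"
  shows "norm (family_form U A (map z xs)) \<le> D * prod_list (map r xs)"
proof -
  have "norm (iterated_lim U (length xs) (\<lambda>is. A (map2 (\<lambda>z i. z i) (map z xs) is))) \<le> D * prod_list (map r xs)"
  proof (rule iterated_lim_prod_bound[OF ultra, where g = "\<lambda>x i. vnorm E (z x i)"])
    fix "is" :: "'i list" assume "length is = length xs"
    then have "norm (A (map2 (\<lambda>z i. z i) (map z xs) is)) \<le>
        D * prod_list (map2 (\<lambda>z i. vnorm E (z i)) (map z xs) is)"
      using z by (intro family_form_pointwise_bound[OF D]) auto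
    then show "norm (A (map2 (\<lambda>z i. z i) (map z xs) is)) \<le> D * prod_list (map2 (\<lambda>x i. vnorm E (z x i)) xs is)"
      by (simp add: zip_map1 case_prod_unfold comp_def)
  qed (use r z D in \<open>auto simp: vnorm_nonneg family_in bounded_form_def\<close>)
  then show ?thesis by (simp add: family_form_def)
qed

text \<open>The slot is located in the index list simultaneously for all \<open>z\<close>, so that
  arguments which differ only in this slot can be compared.\<close>

lemma map2_split:
  assumes "length is = length ps + length qs + 1"
  obtains is1 i is2 where "is = is1 @ i # is2" "length is1 = length ps" "length is2 = length qs"
    "\<And>z. map2 (\<lambda>z i. z i) (ps @ z # qs) is = map2 (\<lambda>z i. z i) ps is1 @ z i # map2 (\<lambda>z i. z i) qs is2"
proof -
  have "length ps < length is" using assms by simp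
  then have 1: "is = take (length ps) is @ is ! length ps # drop (Suc (length ps)) is"
    by (simp add: id_take_nth_drop)
  have 2: "length (take (length ps) is) = length ps" "length (drop (Suc (length ps)) is) = length qs"
    using assms by auto
  have "map2 (\<lambda>z i. z i) (ps @ z # qs) (take (length ps) is @ is ! length ps # drop (Suc (length ps)) is) =
    map2 (\<lambda>z i. z i) ps (take (length ps) is) @ z (is ! length ps) # map2 (\<lambda>z i. z i) qs (drop (Suc (length ps)) is)" for z
    using 2 by (subst zip_append) auto
  then show ?thesis using that[OF 1 2] 1 by simp
qed

lemma family_form_add:
  assumes A: "A \<in> nforms n E" and D: "bounded_form E D A" and n: "length ps + length qs + 1 = n"
    and z: "set ps \<subseteq> bounded_families E" "set qs \<subseteq> bounded_families E" "z \<in> bounded_families E" "w \<in> bounded_families E"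
  shows "family_form U A (ps @ (\<lambda>i. z i \<oplus> w i) # qs) = family_form U A (ps @ z # qs) + family_form U A (ps @ w # qs)"
proof -
  have zw: "set (ps @ z # qs) \<subseteq> bounded_families E" "set (ps @ w # qs) \<subseteq> bounded_families E"
    using z by auto
  obtain C1 where C1: "\<And>is. length is = length (ps @ z # qs) \<Longrightarrow> norm (A (map2 (\<lambda>z i. z i) (ps @ z # qs) is)) \<le> C1"
    by (rule family_form_bounded[OF D zw(1)]) (rule that)
  obtain C2 where C2: "\<And>is. length is = length (ps @ w # qs) \<Longrightarrow> norm (A (map2 (\<lambda>z i. z i) (ps @ w # qs) is)) \<le> C2"
    by (rule family_form_bounded[OF D zw(2)]) (rule that)
  have pt: "A (map2 (\<lambda>z i. z i) (ps @ (\<lambda>i. z i \<oplus> w i) # qs) is) =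
      A (map2 (\<lambda>z i. z i) (ps @ z # qs) is) + A (map2 (\<lambda>z i. z i) (ps @ w # qs) is)"
    if len: "length is = n" for "is"
  proof -
    have len': "length is = length ps + length qs + 1" using len n by simp
    obtain is1 i is2 where "is = is1 @ i # is2" and s: "length is1 = length ps" "length is2 = length qs"
      "\<And>z. map2 (\<lambda>z i. z i) (ps @ z # qs) is = map2 (\<lambda>z i. z i) ps is1 @ z i # map2 (\<lambda>z i. z i) qs is2"
      by (rule map2_split[OF len']) (rule that)
    show ?thesis
      unfolding s(3) using s(1,2) n z
      by (intro nforms_add[OF A] family_in map2_in_carrier) simp_all
  qed
  have len_eq: "length (ps @ v # qs) = n" for v :: "'i \<Rightarrow> 'u" using n by simp
  have "family_form U A (ps @ (\<lambda>i. z i \<oplus> w i) # qs) =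
    iterated_lim U n (\<lambda>is. A (map2 (\<lambda>z i. z i) (ps @ z # qs) is) + A (map2 (\<lambda>z i. z i) (ps @ w # qs) is))"
    unfolding family_form_def len_eq by (rule iterated_lim_cong[OF pt])
  also have "\<dots> = iterated_lim U n (\<lambda>is. A (map2 (\<lambda>z i. z i) (ps @ z # qs) is)) +
      iterated_lim U n (\<lambda>is. A (map2 (\<lambda>z i. z i) (ps @ w # qs) is))"
    by (rule iterated_lim_add[OF ultra C1 C2]) (use n in simp_all)
  finally show ?thesis unfolding family_form_def len_eq .
qed

lemma family_form_smult:
  assumes A: "A \<in> nforms n E" and D: "bounded_form E D A" and n: "length ps + length qs + 1 = n"
    and z: "set ps \<subseteq> bounded_families E" "set qs \<subseteq> bounded_families E" "z \<in> bounded_families E"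
  shows "family_form U A (ps @ (\<lambda>i. c \<odot> z i) # qs) = c * family_form U A (ps @ z # qs)"
proof -
  have "set (ps @ z # qs) \<subseteq> bounded_families E" using z by auto
  then obtain C where
    C: "\<And>is. length is = length (ps @ z # qs) \<Longrightarrow> norm (A (map2 (\<lambda>z i. z i) (ps @ z # qs) is)) \<le> C"
    by (rule family_form_bounded[OF D]) (rule that)
  have pt: "A (map2 (\<lambda>z i. z i) (ps @ (\<lambda>i. c \<odot> z i) # qs) is) = c * A (map2 (\<lambda>z i. z i) (ps @ z # qs) is)"
    if len: "length is = n" for "is"
  proof -
    have len': "length is = length ps + length qs + 1" using len n by simp
    obtain is1 i is2 where "is = is1 @ i # is2" and s: "length is1 = length ps" "length is2 = length qs"
      "\<And>z. map2 (\<lambda>z i. z i) (ps @ z # qs) is = map2 (\<lambda>z i. z i) ps is1 @ z i # map2 (\<lambda>z i. z i) qs is2"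
      by (rule map2_split[OF len']) (rule that)
    show ?thesis
      unfolding s(3) using s(1,2) n z
      by (intro nforms_smult[OF A] family_in map2_in_carrier) simp_all
  qed
  have len_eq: "length (ps @ v # qs) = n" for v :: "'i \<Rightarrow> 'u" using n by simp
  have "family_form U A (ps @ (\<lambda>i. c \<odot> z i) # qs) =
    iterated_lim U n (\<lambda>is. c * A (map2 (\<lambda>z i. z i) (ps @ z # qs) is))"
    unfolding family_form_def len_eq by (rule iterated_lim_cong[OF pt])
  also have "\<dots> = c * iterated_lim U n (\<lambda>is. A (map2 (\<lambda>z i. z i) (ps @ z # qs) is))"
    by (rule iterated_lim_cmult[OF ultra C]) (use n in simp)
  finally show ?thesis unfolding family_form_def len_eq .
qed

lemma family_form_null:
  assumes D: "bounded_form E D A" and z: "set zs \<subseteq> bounded_families E"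
    and "w \<in> set zs" "((\<lambda>i. vnorm E (w i)) \<longlongrightarrow> 0) U"
  shows "family_form U A zs = 0"
proof -
  have "norm (family_form U A (map (\<lambda>z. z) zs)) \<le> D * prod_list (map (\<lambda>z. Lim U (\<lambda>i. vnorm E (z i))) zs)"
    using z by (intro family_form_norm_le[OF D] family_norm_convergent) auto
  moreover have "Lim U (\<lambda>i. vnorm E (w i)) = 0" by (rule ultrafilter_Lim[OF ultra assms(4)])
  then have "0 \<in> set (map (\<lambda>z. Lim U (\<lambda>i. vnorm E (z i))) zs)" using assms(3) by force
  then have "prod_list (map (\<lambda>z. Lim U (\<lambda>i. vnorm E (z i))) zs) = 0" by (simp add: prod_list_zero_iff)
  ultimately show ?thesis by simp
qed

text \<open>Families are exchanged one slot at a time. Each exchange splits off a term that has a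
  null family in one slot and hence vanishes; \<open>ps\<close> keeps the slots already
  exchanged.\<close>

lemma family_form_close:
  assumes A: "A \<in> nforms n E" and D: "bounded_form E D A"
  shows "\<lbrakk>list_all2 (close U E) zs ws; length ps + length zs = n; set ps \<subseteq> bounded_families E;
    set zs \<subseteq> bounded_families E; set ws \<subseteq> bounded_families E\<rbrakk> \<Longrightarrow>
    family_form U A (ps @ zs) = family_form U A (ps @ ws)"
proof (induction zs ws arbitrary: ps rule: list_all2_induct)
  case (Cons z zs w ws)
  have in_b: "z \<in> bounded_families E" "w \<in> bounded_families E" using Cons.prems by auto
  have "z = (\<lambda>i. (z i \<ominus> w i) \<oplus> w i)"
    using in_b by (auto simp: family_in diff_add_cancel)
  then have "family_form U A (ps @ z # zs) = family_form U A (ps @ (\<lambda>i. (z i \<ominus> w i) \<oplus> w i) # zs)"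
    by simp
  also have "\<dots> = family_form U A (ps @ (\<lambda>i. z i \<ominus> w i) # zs) + family_form U A (ps @ w # zs)"
    using Cons.prems in_b by (intro family_form_add[OF A D]) (auto simp: bounded_families_diff)
  also have "family_form U A (ps @ (\<lambda>i. z i \<ominus> w i) # zs) = 0"
    using Cons.prems in_b Cons.hyps(1)
    by (intro family_form_null[OF D, of _ "\<lambda>i. z i \<ominus> w i"]) (auto simp: bounded_families_diff close_def)
  also have "family_form U A (ps @ w # zs) = family_form U A ((ps @ [w]) @ zs)" by simp
  also have "\<dots> = family_form U A ((ps @ [w]) @ ws)"
    using Cons.prems by (intro Cons.IH) auto
  finally show ?case by simp
qed simp

lemma family_form_close_replicate:
  assumes "A \<in> nforms n E" "bounded_form E D A" "close U E z w" "z \<in> bounded_families E" "w \<in> bounded_families E"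
  shows "family_form U A (replicate n z) = family_form U A (replicate n w)"
proof -
  have "list_all2 (close U E) (replicate n z) (replicate n w)"
    by (simp add: list_all2_conv_all_nth assms(3))
  from family_form_close[OF assms(1,2) this, of "[]"] show ?thesis
    using assms(4,5) by (simp add: set_replicate_conv_if)
qed

end

section \<open>Spaces of classes of bounded families\<close>

text \<open>An isometric copy \<open>F\<close> of the ultrapower, where \<open>\<rho> x\<close> is a representing family of \<open>x\<close>.\<close>

locale ultra_model = ultra_space E U + F: hb_space F
  for E :: "('k::{real_normed_field, heine_borel}, 'u) nspace" (structure)
    and U :: "'i filter" and F :: "('k, 'v) nspace" +
  fixes \<rho> :: "'v \<Rightarrow> 'i \<Rightarrow> 'u"
  assumes rep_bounded: "x \<in> carrier F \<Longrightarrow> \<rho> x \<in> bounded_families E"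
    and rep_norm: "x \<in> carrier F \<Longrightarrow> ((\<lambda>i. vnorm E (\<rho> x i)) \<longlongrightarrow> vnorm F x) U"
    and rep_add: "\<lbrakk>x \<in> carrier F; y \<in> carrier F\<rbrakk> \<Longrightarrow> close U E (\<rho> (x \<oplus>\<^bsub>F\<^esub> y)) (\<lambda>i. \<rho> x i \<oplus> \<rho> y i)"
    and rep_smult: "x \<in> carrier F \<Longrightarrow> close U E (\<rho> (c \<odot>\<^bsub>F\<^esub> x)) (\<lambda>i. c \<odot> \<rho> x i)"
    and rep_surj: "z \<in> bounded_families E \<Longrightarrow> \<exists>x\<in>carrier F. close U E (\<rho> x) z"
begin

definition extension :: "nat \<Rightarrow> ('u list \<Rightarrow> 'k) \<Rightarrow> 'v \<Rightarrow> 'k" where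
  "extension n A = zero_ext (carrier F) (\<lambda>x. family_form U A (replicate n (\<rho> x)))"

definition extension_form :: "nat \<Rightarrow> ('u list \<Rightarrow> 'k) \<Rightarrow> 'v list \<Rightarrow> 'k" where
  "extension_form n A = zero_ext (tuples n F) (\<lambda>xs. family_form U A (map \<rho> xs))"

lemma rep_diff:
  assumes "x \<in> carrier F" "y \<in> carrier F"
  shows "close U E (\<rho> (x \<ominus>\<^bsub>F\<^esub> y)) (\<lambda>i. \<rho> x i \<ominus> \<rho> y i)"
proof -
  have eq: "x \<ominus>\<^bsub>F\<^esub> y = x \<oplus>\<^bsub>F\<^esub> (- 1) \<odot>\<^bsub>F\<^esub> y" using assms by (rule F.diff_eq_smult)
  have eq': "(\<lambda>i. \<rho> x i \<ominus> \<rho> y i) = (\<lambda>i. \<rho> x i \<oplus> (- 1) \<odot> \<rho> y i)"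
    using assms[THEN rep_bounded] by (intro ext diff_eq_smult family_in)
  have my: "(- 1) \<odot>\<^bsub>F\<^esub> y \<in> carrier F" using assms(2) by (rule F.smult_in)
  have b: "\<rho> x \<in> bounded_families E" "\<rho> ((- 1) \<odot>\<^bsub>F\<^esub> y) \<in> bounded_families E"
    "(\<lambda>i. (- 1) \<odot> \<rho> y i) \<in> bounded_families E" "\<rho> (x \<oplus>\<^bsub>F\<^esub> (- 1) \<odot>\<^bsub>F\<^esub> y) \<in> bounded_families E"
    by (simp_all add: rep_bounded bounded_families_smult assms my)
  show ?thesis
    unfolding eq eq'
    by (rule close_trans[OF rep_add[OF assms(1) my] close_add[OF close_refl[OF b(1)] rep_smult[OF assms(2)]]])
       (use b in \<open>simp_all add: bounded_families_add\<close>)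
qed

lemma rep_norm_diff:
  assumes "x \<in> carrier F" "y \<in> carrier F"
  shows "((\<lambda>i. vnorm E (\<rho> x i \<ominus> \<rho> y i)) \<longlongrightarrow> vnorm F (x \<ominus>\<^bsub>F\<^esub> y)) U"
proof (rule close_norm)
  show "close U E (\<lambda>i. \<rho> x i \<ominus> \<rho> y i) (\<rho> (x \<ominus>\<^bsub>F\<^esub> y))"
    by (rule close_sym[OF rep_diff]) (simp_all add: assms bounded_families_diff rep_bounded)
qed (simp_all add: assms bounded_families_diff rep_bounded rep_norm)

lemma close_rep_norm:
  assumes "close U E (\<rho> x) z" "x \<in> carrier F" "z \<in> bounded_families E"
  shows "((\<lambda>i. vnorm E (z i)) \<longlongrightarrow> vnorm F x) U"
  by (rule close_norm[OF close_sym[OF assms(1)] _ _ rep_norm[OF assms(2)]])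
     (simp_all add: assms rep_bounded)

lemma rep_eqI:
  assumes "x \<in> carrier F" "y \<in> carrier F" "close U E (\<rho> x) (\<rho> y)"
  shows "x = y"
proof -
  have "vnorm F (x \<ominus>\<^bsub>F\<^esub> y) = 0"
    using tendsto_unique[OF ultrafilter_not_bot[OF ultra] rep_norm_diff[OF assms(1,2)]] assms(3)
    by (simp add: close_def)
  with assms(1,2) show ?thesis by (simp add: F.vnorm_eq_0_iff F.diff_eq_zero_iff)
qed

lemma rep_finsum:
  assumes "finite B" "B \<subseteq> carrier F"
  shows "close U E (\<rho> (\<Oplus>\<^bsub>F\<^esub>b\<in>B. c b \<odot>\<^bsub>F\<^esub> b)) (\<lambda>i. \<Oplus>b\<in>B. c b \<odot> \<rho> b i)"
  using assms
proof (induction B rule: finite_induct)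
  case empty
  have "close U E (\<rho> (0 \<odot>\<^bsub>F\<^esub> \<zero>\<^bsub>F\<^esub>)) (\<lambda>i. 0 \<odot> \<rho> \<zero>\<^bsub>F\<^esub> i)"
    by (rule rep_smult) simp
  then show ?case using rep_bounded[of "\<zero>\<^bsub>F\<^esub>"] by (simp add: family_in)
next
  case (insert b B)
  then have bX: "b \<in> carrier F" "B \<subseteq> carrier F" by auto
  have s: "(\<Oplus>\<^bsub>F\<^esub>b\<in>B. c b \<odot>\<^bsub>F\<^esub> b) \<in> carrier F" "c b \<odot>\<^bsub>F\<^esub> b \<in> carrier F"
    using bX by (auto intro: F.lincomb_in)
  have f: "(\<lambda>i. \<Oplus>b\<in>B. c b \<odot> \<rho> b i) \<in> bounded_families E" "(\<lambda>i. c b \<odot> \<rho> b i) \<in> bounded_families E"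
    using insert.hyps bX by (auto intro!: bounded_families_finsum bounded_families_smult rep_bounded)
  have "close U E (\<rho> (c b \<odot>\<^bsub>F\<^esub> b \<oplus>\<^bsub>F\<^esub> (\<Oplus>\<^bsub>F\<^esub>b\<in>B. c b \<odot>\<^bsub>F\<^esub> b))) (\<lambda>i. c b \<odot> \<rho> b i \<oplus> (\<Oplus>b\<in>B. c b \<odot> \<rho> b i))"
    by (rule close_trans[OF rep_add[OF s(2,1)] close_add[OF rep_smult[OF bX(1)] insert.IH[OF bX(2)]]])
       (use f s in \<open>simp_all add: bounded_families_add rep_bounded\<close>)
  moreover have "(\<Oplus>b\<in>insert b B. c b \<odot> \<rho> b i) = c b \<odot> \<rho> b i \<oplus> (\<Oplus>b\<in>B. c b \<odot> \<rho> b i)" for i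
    using insert.hyps bX by (subst M.finsum_insert) (auto simp: family_in rep_bounded subset_iff)
  ultimately show ?case using insert.hyps bX by (simp add: F.lincomb_insert)
qed

text \<open>Since \<open>\<rho>\<close> is linear only up to null families, the representative of a
  sum or multiple is first exchanged for the sum or multiple of the representatives, which does not
  change the iterated limit. Then \<open>family_form\<close> is linear in that slot.\<close>

lemma extension_form:
  assumes A: "A \<in> nforms n E" and D: "bounded_form E D A"
  shows "extension_form n A \<in> nforms n F" "bounded_form F D (extension_form n A)"
proof -
  have reps: "set (map \<rho> xs) \<subseteq> bounded_families E" if "set xs \<subseteq> carrier F" for xs
    using that by (auto simp: rep_bounded subset_iff)
  have replace: "family_form U A (map \<rho> ps @ \<rho> x # map \<rho> qs) = family_form U A (map \<rho> ps @ z # map \<rho> qs)"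
    if "length ps + length qs + 1 = n" "set ps \<subseteq> carrier F" "set qs \<subseteq> carrier F" "x \<in> carrier F"
      "z \<in> bounded_families E" "close U E (\<rho> x) z" for ps qs x z
  proof -
    have "list_all2 (close U E) (map \<rho> qs) (map \<rho> qs)"
      using reps[OF that(3)] by (auto simp: list_all2_conv_all_nth intro!: close_refl)
    then have "list_all2 (close U E) (\<rho> x # map \<rho> qs) (z # map \<rho> qs)"
      using that by simp
    then show ?thesis
      by (rule family_form_close[OF A D]) (use that reps[of ps] reps[of qs] rep_bounded in auto)
  qed
  show "extension_form n A \<in> nforms n F"
  proof (rule F.nformsI)
    fix ps qs x y
    assume *: "length ps + length qs + 1 = n" "set ps \<subseteq> carrier F" "set qs \<subseteq> carrier F"
       "x \<in> carrier F" "y \<in> carrier F"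
    then have tup: "ps @ v # qs \<in> tuples n F" if "v \<in> carrier F" for v
      using that by (simp add: tuples_append)
    have "family_form U A (map \<rho> ps @ \<rho> (x \<oplus>\<^bsub>F\<^esub> y) # map \<rho> qs) =
        family_form U A (map \<rho> ps @ (\<lambda>i. \<rho> x i \<oplus> \<rho> y i) # map \<rho> qs)"
      using * by (intro replace rep_add bounded_families_add rep_bounded) auto
    also have "\<dots> = family_form U A (map \<rho> ps @ \<rho> x # map \<rho> qs) + family_form U A (map \<rho> ps @ \<rho> y # map \<rho> qs)"
      using * by (intro family_form_add[OF A D] reps rep_bounded) auto
    finally show "extension_form n A (ps @ (x \<oplus>\<^bsub>F\<^esub> y) # qs) =
        extension_form n A (ps @ x # qs) + extension_form n A (ps @ y # qs)"
      using * by (simp add: extension_form_def zero_ext_def tup)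
  next
    fix ps qs x c
    assume *: "length ps + length qs + 1 = n" "set ps \<subseteq> carrier F" "set qs \<subseteq> carrier F" "x \<in> carrier F"
    then have tup: "ps @ v # qs \<in> tuples n F" if "v \<in> carrier F" for v
      using that by (simp add: tuples_append)
    have "family_form U A (map \<rho> ps @ \<rho> (c \<odot>\<^bsub>F\<^esub> x) # map \<rho> qs) =
        family_form U A (map \<rho> ps @ (\<lambda>i. c \<odot> \<rho> x i) # map \<rho> qs)"
      using * by (intro replace rep_smult bounded_families_smult rep_bounded) auto
    also have "\<dots> = c * family_form U A (map \<rho> ps @ \<rho> x # map \<rho> qs)"
      using * by (intro family_form_smult[OF A D] reps rep_bounded) auto
    finally show "extension_form n A (ps @ (c \<odot>\<^bsub>F\<^esub> x) # qs) = c * extension_form n A (ps @ x # qs)"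
      using * by (simp add: extension_form_def zero_ext_def tup)
  qed (simp add: extension_form_def zero_ext_def)
  have D0: "0 \<le> D" using D by (simp add: bounded_form_def)
  show "bounded_form F D (extension_form n A)"
    unfolding bounded_form_def
  proof (intro conjI allI impI D0)
    fix xs assume xs: "set xs \<subseteq> carrier F"
    have "0 \<le> prod_list (map (vnorm F) xs)"
      using xs by (intro prod_list_nonneg) (auto simp: F.vnorm_nonneg)
    moreover have "norm (family_form U A (map \<rho> xs)) \<le> D * prod_list (map (vnorm F) xs)"
      using xs by (intro family_form_norm_le[OF D] rep_bounded rep_norm) auto
    ultimately show "norm (extension_form n A xs) \<le> D * prod_list (map (vnorm F) xs)"
      using D0 by (simp add: extension_form_def zero_ext_def)
  qed
qed

lemma extension_diag: "x \<in> carrier F \<Longrightarrow> extension n A x = extension_form n A (replicate n x)"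
  by (simp add: extension_def extension_form_def zero_ext_def tuples_def set_replicate_conv_if)

lemma extension_cpoly:
  assumes "A \<in> nforms n E" "bounded_form E D A"
  shows "extension n A \<in> cpoly n F"
  using extension_form[OF assms]
  by (rule F.cpolyI) (simp_all add: extension_diag, simp add: extension_def zero_ext_def)

text \<open>The canonical embedding of \<open>E\<close>, given by constant families. A model
  provides some point for such a family, and by \<open>close_rep_eqI\<close> there is only
  one.\<close>

definition diag :: "'u \<Rightarrow> 'v" where
  "diag a = (SOME x. x \<in> carrier F \<and> close U E (\<rho> x) (\<lambda>_. a))"

lemma diag:
  assumes "a \<in> carrier E"
  shows "diag a \<in> carrier F" "close U E (\<rho> (diag a)) (\<lambda>_. a)"
  using someI_ex[of "\<lambda>x. x \<in> carrier F \<and> close U E (\<rho> x) (\<lambda>_. a)"]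
    rep_surj[OF bounded_families_const[OF assms]]
  unfolding diag_def by blast+

lemma diag_norm: "a \<in> carrier E \<Longrightarrow> vnorm F (diag a) = vnorm E a"
  using close_rep_norm[OF diag(2,1) bounded_families_const, of a]
  by (simp add: tendsto_const_iff ultrafilter_not_bot[OF ultra])

lemma close_rep_eqI:
  assumes "x \<in> carrier F" "y \<in> carrier F" "close U E (\<rho> x) z" "close U E (\<rho> y) z" "z \<in> bounded_families E"
  shows "x = y"
proof (rule rep_eqI[OF assms(1,2)])
  show "close U E (\<rho> x) (\<rho> y)"
    by (rule close_trans[OF assms(3) close_sym[OF assms(4)]]) (use assms rep_bounded in blast)+
qed

lemma diag_add:
  assumes "a \<in> carrier E" "b \<in> carrier E"
  shows "diag (a \<oplus> b) = diag a \<oplus>\<^bsub>F\<^esub> diag b"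
proof (rule close_rep_eqI)
  show "close U E (\<rho> (diag a \<oplus>\<^bsub>F\<^esub> diag b)) (\<lambda>_. a \<oplus> b)"
    by (rule close_trans[OF rep_add close_add[OF diag(2) diag(2)]])
       (use assms diag in \<open>auto intro!: bounded_families_add bounded_families_const rep_bounded\<close>)
qed (use assms diag in \<open>auto intro!: bounded_families_const\<close>)

lemma diag_smult:
  assumes "a \<in> carrier E"
  shows "diag (c \<odot> a) = c \<odot>\<^bsub>F\<^esub> diag a"
proof (rule close_rep_eqI)
  show "close U E (\<rho> (c \<odot>\<^bsub>F\<^esub> diag a)) (\<lambda>_. c \<odot> a)"
    by (rule close_trans[OF rep_smult close_smult[OF diag(2)]])
       (use assms diag in \<open>auto intro!: bounded_families_smult bounded_families_const rep_bounded\<close>)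
qed (use assms diag in \<open>auto intro!: bounded_families_const\<close>)

text \<open>The constant family may replace the chosen representative, and for it every limit is
  taken of a constant.\<close>

lemma extension_diag_eq:
  assumes "A \<in> nforms n E" "bounded_form E D A" "a \<in> carrier E"
  shows "extension n A (diag a) = A (replicate n a)"
proof -
  have "extension n A (diag a) = family_form U A (replicate n (\<lambda>_. a))"
    using family_form_close_replicate[OF assms(1,2) diag(2)[OF assms(3)] rep_bounded[OF diag(1)[OF assms(3)]]
      bounded_families_const[OF assms(3)]] diag(1)[OF assms(3)]
    by (simp add: extension_def zero_ext_def)
  also have "\<dots> = iterated_lim U n (\<lambda>is. A (replicate n a))"
    unfolding family_form_replicate by (rule iterated_lim_cong) (simp add: map_replicate_const)
  also have "\<dots> = A (replicate n a)" by (rule iterated_lim_const[OF ultra])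
  finally show ?thesis .
qed

text \<open>For each index \<open>i\<close> the initial segment of the Cauchy sequence up to the last good position
  is followed; an index that is good for all positions uses completeness of \<open>E\<close>.\<close>

lemma coordinate_limit:
  assumes complete: "Metric_space.mcomplete (carrier E) (ndist E)"
    and z: "\<And>k. z k \<in> carrier E" and \<epsilon>: "\<epsilon> \<longlonglongrightarrow> (0::real)" "\<And>k. 0 \<le> \<epsilon> k"
  shows "\<exists>w\<in>carrier E. \<forall>k. (\<forall>p\<le>k. \<forall>q\<le>k. vnorm E (z p \<ominus> z q) \<le> \<epsilon> (min p q)) \<longrightarrow> vnorm E (z k \<ominus> w) \<le> \<epsilon> k"
proof (cases "\<forall>p q. vnorm E (z p \<ominus> z q) \<le> \<epsilon> (min p q)")
  case True
  have "\<exists>N. \<forall>p q. N \<le> p \<longrightarrow> N \<le> q \<longrightarrow> vnorm E (z p \<ominus> z q) < e" if e: "e > 0" for e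
  proof -
    obtain N where N: "\<And>k. N \<le> k \<Longrightarrow> \<epsilon> k < e"
      using order_tendstoD(2)[OF \<epsilon>(1) e] by (auto simp: eventually_sequentially)
    have "vnorm E (z p \<ominus> z q) < e" if "N \<le> p" "N \<le> q" for p q
    proof -
      have "vnorm E (z p \<ominus> z q) \<le> \<epsilon> (min p q)" using True by blast
      also have "\<dots> < e" by (rule N) (use that in simp)
      finally show ?thesis .
    qed
    then show ?thesis by blast
  qed
  moreover have "range z \<subseteq> carrier E" using z by auto
  ultimately have "\<exists>w\<in>carrier E. (\<lambda>k. vnorm E (z k \<ominus> w)) \<longlonglongrightarrow> 0"
    using complete[unfolded mcomplete_iff, THEN spec, of z] by simp
  then obtain w where w: "w \<in> carrier E" "(\<lambda>k. vnorm E (z k \<ominus> w)) \<longlonglongrightarrow> 0"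
    by blast
  have "vnorm E (z k \<ominus> w) \<le> \<epsilon> k" for k
  proof (rule LIMSEQ_le_const)
    show "(\<lambda>q. \<epsilon> k + vnorm E (z q \<ominus> w)) \<longlonglongrightarrow> \<epsilon> k"
      using tendsto_add[OF tendsto_const w(2), of "\<epsilon> k"] by simp
    have "vnorm E (z k \<ominus> w) \<le> \<epsilon> k + vnorm E (z q \<ominus> w)" if "q \<ge> k" for q
    proof -
      have "vnorm E (z k \<ominus> z q) \<le> \<epsilon> (min k q)" using True by blast
      then have "vnorm E (z k \<ominus> z q) \<le> \<epsilon> k" using that by (simp add: min_absorb1)
      with vnorm_diff_triangle[OF z z w(1), of k q] show ?thesis by linarith
    qed
    then show "\<exists>N. \<forall>q\<ge>N. vnorm E (z k \<ominus> w) \<le> \<epsilon> k + vnorm E (z q \<ominus> w)" by blast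
  qed
  with w show ?thesis by blast
next
  case False
  define good where "good k \<longleftrightarrow> (\<forall>p\<le>k. \<forall>q\<le>k. vnorm E (z p \<ominus> z q) \<le> \<epsilon> (min p q))" for k
  have mono: "good k" if "good l" "k \<le> l" for k l
    using that unfolding good_def by (meson order.trans)
  obtain p q where pq: "\<not> vnorm E (z p \<ominus> z q) \<le> \<epsilon> (min p q)" using False by blast
  have bad: "\<not> good (max p q)"
    using pq unfolding good_def by (meson max.cobounded1 max.cobounded2)
  have "good 0" using z \<epsilon> by (simp add: good_def)
  have bdd: "k \<le> max p q" if "good k" for k
    using mono[OF that] bad by (meson linear)
  define N where "N = (GREATEST k. good k)"
  have N: "good N" unfolding N_def by (rule GreatestI_nat[of good 0 "max p q"]) (use \<open>good 0\<close> bdd in auto)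
  have "vnorm E (z k \<ominus> z N) \<le> \<epsilon> k" if "good k" for k
  proof -
    have k: "k \<le> N" unfolding N_def by (rule Greatest_le_nat[of good k "max p q"]) (use that bdd in auto)
    with N have "vnorm E (z k \<ominus> z N) \<le> \<epsilon> (min k N)" unfolding good_def by blast
    with k show ?thesis by (simp add: min_absorb1)
  qed
  then show ?thesis using z unfolding good_def by blast
qed

text \<open>The moduli \<open>\<epsilon> k\<close> come from the tails of the Cauchy sequence
  itself, and the representing families are followed index by index. For fixed \<open>k\<close>
  almost every index is good up to \<open>k\<close>, so the class of the coordinatewise limits
  \<open>w\<close> is within \<open>\<epsilon> k\<close> of \<open>s k\<close>.\<close>

lemma complete:
  assumes "Metric_space.mcomplete (carrier E) (ndist E)"
  shows "Metric_space.mcomplete (carrier F) (ndist F)"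
  unfolding F.mcomplete_iff
proof (intro allI impI, elim conjE)
  fix s :: "nat \<Rightarrow> 'v" assume ran: "range s \<subseteq> carrier F"
    and cauchy: "\<forall>\<epsilon>>0. \<exists>N. \<forall>p q. N \<le> p \<longrightarrow> N \<le> q \<longrightarrow> vnorm F (s p \<ominus>\<^bsub>F\<^esub> s q) < \<epsilon>"
  have s: "s k \<in> carrier F" for k using ran by blast
  define \<delta> where "\<delta> p q = vnorm F (s p \<ominus>\<^bsub>F\<^esub> s q)" for p q
  have \<delta>: "0 \<le> \<delta> p q" for p q unfolding \<delta>_def using s by (intro F.vnorm_nonneg F.diff_in)
  define V where "V k = {\<delta> p q | p q. k \<le> p \<and> k \<le> q}" for k
  have V_I: "\<delta> p q \<in> V k" if "k \<le> p" "k \<le> q" for p q k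
    using that unfolding V_def by blast
  obtain N0 where N0: "\<And>p q. \<lbrakk>N0 \<le> p; N0 \<le> q\<rbrakk> \<Longrightarrow> \<delta> p q < 1"
    using cauchy unfolding \<delta>_def by (meson zero_less_one)
  \<comment> \<open>All distances to \<open>s N0\<close> are at most \<open>C\<close>: up to
    \<open>N0\<close> because of the sum, later because of the summand 1. Hence the sets
    \<open>V k\<close> are bounded and their suprema can be used.\<close>
  define C where "C = (\<Sum>p\<le>N0. \<delta> p N0) + 1"
  have to_N0: "\<delta> p N0 \<le> C" for p
  proof (cases "p \<le> N0")
    case True
    then have "\<delta> p N0 \<le> (\<Sum>p\<le>N0. \<delta> p N0)" using \<delta> by (intro member_le_sum) auto
    then show ?thesis by (simp add: C_def)
  next
    case False
    then have "\<delta> p N0 < 1" by (intro N0) auto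
    moreover have "0 \<le> (\<Sum>p\<le>N0. \<delta> p N0)" using \<delta> by (intro sum_nonneg) auto
    ultimately show ?thesis by (simp add: C_def)
  qed
  have triangle: "\<delta> p q \<le> \<delta> p N0 + \<delta> q N0" for p q
    unfolding \<delta>_def using F.vnorm_diff_triangle[OF s s s, of p q N0] F.vnorm_diff_commute[OF s s, of N0 q] by simp
  have bound: "\<delta> p q \<le> C + C" for p q
    by (rule order.trans[OF triangle add_mono[OF to_N0 to_N0]])
  have bdd: "bdd_above (V k)" for k
    by (rule bdd_aboveI[of _ "C + C"]) (use bound in \<open>fastforce simp: V_def\<close>)
  \<comment> \<open>The diameter of the tail plus a positive null sequence. The extra summand makes
    the estimate strict, and a strict bound on a limit holds for almost all indices, which a weak
    one need not do.\<close>
  define \<epsilon> where "\<epsilon> k = Sup (V k) + inverse (real (Suc k))" for k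
  have less: "\<delta> p q < \<epsilon> (min p q)" for p q
  proof -
    have "\<delta> p q \<le> Sup (V (min p q))" by (rule cSup_upper[OF V_I bdd]) simp_all
    moreover have "0 < inverse (real (Suc (min p q)))" by simp
    ultimately show ?thesis unfolding \<epsilon>_def by linarith
  qed
  have \<epsilon>0: "0 \<le> \<epsilon> k" for k
    using less[of k k] \<delta>[of k k] by simp
  have "(\<lambda>k. Sup (V k)) \<longlonglongrightarrow> 0"
  proof (rule LIMSEQ_I)
    fix r :: real assume r: "0 < r"
    then obtain N where N: "\<And>p q. \<lbrakk>N \<le> p; N \<le> q\<rbrakk> \<Longrightarrow> \<delta> p q < r / 2"
      using cauchy unfolding \<delta>_def by (meson half_gt_zero)
    have "norm (Sup (V k) - 0) < r" if "k \<ge> N" for k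
    proof -
      have "Sup (V k) \<le> r / 2"
        
      proof (rule cSup_least)
        show "V k \<noteq> {}" using V_I[of k k k] by blast
        fix v assume "v \<in> V k"
        then obtain p q where "v = \<delta> p q" "k \<le> p" "k \<le> q" unfolding V_def by blast
        with N[of p q] that show "v \<le> r / 2" by simp
      qed
      moreover have "0 \<le> Sup (V k)"
        using \<delta>[of k k] by (rule order.trans) (rule cSup_upper[OF V_I bdd], simp_all)
      ultimately show ?thesis using r by simp
    qed
    then show "\<exists>N. \<forall>k\<ge>N. norm (Sup (V k) - 0) < r" by blast
  qed
  from tendsto_add[OF this LIMSEQ_inverse_real_of_nat] have \<epsilon>: "\<epsilon> \<longlonglongrightarrow> 0"
    by (simp add: \<epsilon>_def[abs_def])
  define good where "good i k \<longleftrightarrow> (\<forall>p\<le>k. \<forall>q\<le>k. vnorm E (\<rho> (s p) i \<ominus> \<rho> (s q) i) \<le> \<epsilon> (min p q))" for i k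
  have rin: "\<rho> (s k) i \<in> carrier E" for k i by (rule family_in[OF rep_bounded[OF s]])
  have "\<exists>w\<in>carrier E. \<forall>k. good i k \<longrightarrow> vnorm E (\<rho> (s k) i \<ominus> w) \<le> \<epsilon> k" for i
    unfolding good_def by (rule coordinate_limit[OF assms rin \<epsilon> \<epsilon>0])
  then obtain w where w: "\<And>i. w i \<in> carrier E" "\<And>i k. good i k \<Longrightarrow> vnorm E (\<rho> (s k) i \<ominus> w i) \<le> \<epsilon> k"
    by metis
  \<comment> \<open>Every index is good at position 0, which bounds \<open>w\<close> by a constant
    independent of the index.\<close>
  have good0: "good i 0" for i using rin \<epsilon>0 by (simp add: good_def)
  obtain C0 where C0: "\<And>i. vnorm E (\<rho> (s 0) i) \<le> C0"
    by (rule family_bound[OF rep_bounded[OF s]]) (rule that)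
  have wb: "w \<in> bounded_families E"
  proof (rule bounded_familyI[OF w(1)])
    fix i
    show "vnorm E (w i) \<le> \<epsilon> 0 + C0"
      using vnorm_le_diff_add[OF w(1) rin, of i 0 i] vnorm_diff_commute[OF w(1) rin, of i 0 i]
        w(2)[OF good0, of i] C0[of i] by linarith
  qed
  obtain x where x: "x \<in> carrier F" "close U E (\<rho> x) w" using rep_surj[OF wb] by blast
  have le: "vnorm F (s k \<ominus>\<^bsub>F\<^esub> x) \<le> \<epsilon> k" for k
  proof -
    have "eventually (\<lambda>i. \<forall>p\<in>{..k}. \<forall>q\<in>{..k}. vnorm E (\<rho> (s p) i \<ominus> \<rho> (s q) i) \<le> \<epsilon> (min p q)) U"
    proof (intro eventually_ball_finite finite_atMost ballI)
      fix p q
      have "eventually (\<lambda>i. vnorm E (\<rho> (s p) i \<ominus> \<rho> (s q) i) < \<epsilon> (min p q)) U"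
        using order_tendstoD(2)[OF rep_norm_diff[OF s s] less[of p q, unfolded \<delta>_def]] .
      then show "eventually (\<lambda>i. vnorm E (\<rho> (s p) i \<ominus> \<rho> (s q) i) \<le> \<epsilon> (min p q)) U"
        by eventually_elim simp
    qed
    then have ev: "eventually (\<lambda>i. vnorm E (\<rho> (s k) i \<ominus> w i) \<le> \<epsilon> k) U"
    proof eventually_elim
      case (elim i)
      then have "good i k" unfolding good_def by blast
      then show ?case by (rule w(2))
    qed
    have rkb: "\<rho> (s k) \<in> bounded_families E" "\<rho> x \<in> bounded_families E"
      using s x by (auto intro: rep_bounded)
    have "close U E (\<lambda>i. \<rho> (s k) i \<oplus> (- 1) \<odot> \<rho> x i) (\<lambda>i. \<rho> (s k) i \<oplus> (- 1) \<odot> w i)"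
      using rkb wb x by (intro close_add close_refl close_smult bounded_families_smult)
    then have "close U E (\<lambda>i. \<rho> (s k) i \<ominus> \<rho> x i) (\<lambda>i. \<rho> (s k) i \<ominus> w i)"
      using rkb wb by (simp add: diff_eq_smult family_in)
    then have "((\<lambda>i. vnorm E (\<rho> (s k) i \<ominus> w i)) \<longlongrightarrow> vnorm F (s k \<ominus>\<^bsub>F\<^esub> x)) U"
      using rkb wb
      by (intro close_norm[OF close_sym _ _ rep_norm_diff[OF s x(1)]]) (simp_all add: bounded_families_diff)
    then show ?thesis
      by (rule tendsto_upperbound[OF _ ev ultrafilter_not_bot[OF ultra]])
  qed
  have "(\<lambda>k. vnorm F (s k \<ominus>\<^bsub>F\<^esub> x)) \<longlonglongrightarrow> 0"
    by (rule tendsto_sandwich[OF _ _ tendsto_const \<epsilon>])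
       (use le s x in \<open>auto intro!: always_eventually F.vnorm_nonneg\<close>)
  with x show "\<exists>x\<in>carrier F. (\<lambda>k. vnorm F (s k \<ominus>\<^bsub>F\<^esub> x)) \<longlonglongrightarrow> 0" by blast
qed

end

section \<open>Local approximation of the extension\<close>

text \<open>The number of words without repetition is a product of \<open>n\<close> factors, each at
  least \<open>m - n + 1\<close>. The ratio is therefore at least
  \<open>((m - n + 1) / m) ^ n\<close>, which tends to 1 for fixed \<open>n\<close>.\<close>

lemma distinct_lists_ratio:
  assumes "0 < \<eta>"
  shows "\<exists>m>0. 1 - real (card {ks. length ks = n \<and> distinct ks \<and> set ks \<subseteq> {..<m}}) / real m ^ n \<le> \<eta>"
proof -
  have "(\<lambda>m. (real m - real n + 1) / real m) \<longlonglongrightarrow> 1" by real_asymp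
  from tendsto_power[OF this, of n]
  have "(\<lambda>m. ((real m - real n + 1) / real m) ^ n) \<longlonglongrightarrow> 1" by simp
  then have "eventually (\<lambda>m. 1 - \<eta> < ((real m - real n + 1) / real m) ^ n) sequentially"
    by (rule order_tendstoD) (use assms in simp)
  then have "eventually (\<lambda>m. 1 - \<eta> < ((real m - real n + 1) / real m) ^ n \<and> n \<le> m \<and> 0 < m) sequentially"
    by (intro eventually_conj eventually_ge_at_top eventually_gt_at_top)
  then obtain m where m: "1 - \<eta> < ((real m - real n + 1) / real m) ^ n" "n \<le> m" "0 < m"
    by (auto simp: eventually_sequentially)
  have "card {ks. length ks = n \<and> distinct ks \<and> set ks \<subseteq> {..<m}} = \<Prod>{m - n + 1..m}"
    using card_lists_distinct_length_eq[of "{..<m}" n] m by simp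
  also have "(\<Prod>i\<in>{m - n + 1..m}. m - n + 1) \<le> \<Prod>{m - n + 1..m}"
    by (rule prod_mono) auto
  then have "(m - n + 1) ^ n \<le> \<Prod>{m - n + 1..m}" using m(2) by simp
  finally have "real ((m - n + 1) ^ n) \<le> real (card {ks. length ks = n \<and> distinct ks \<and> set ks \<subseteq> {..<m}})"
    by (simp only: of_nat_le_iff)
  moreover have "real (m - n + 1) = real m - real n + 1" using m(2) by (simp add: of_nat_diff)
  then have "real ((m - n + 1) ^ n) = (real m - real n + 1) ^ n" by (simp only: of_nat_power)
  ultimately have "((real m - real n + 1) / real m) ^ n \<le>
      real (card {ks. length ks = n \<and> distinct ks \<and> set ks \<subseteq> {..<m}}) / real m ^ n"
    using m(3) by (simp add: power_divide divide_right_mono)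
  with m(1) have "1 - real (card {ks. length ks = n \<and> distinct ks \<and> set ks \<subseteq> {..<m}}) / real m ^ n \<le> \<eta>"
    by linarith
  with m(3) show ?thesis by blast
qed

text \<open>Expanding the average gives \<open>m ^ n\<close> words. A word of pairwise distinct
  indices can be sorted by symmetry into the increasing list of its letters, where
  \<open>near\<close> applies. For the other words only the trivial estimate is available, weighted
  by their proportion.\<close>

lemma (in normed_space) symmetric_form_average:
  fixes y :: "nat \<Rightarrow> 'u"
  assumes A: "A \<in> symmetric_nforms n E" and D: "bounded_form E D A" and m: "0 < m"
    and y: "\<And>k. k < m \<Longrightarrow> y k \<in> carrier E" "\<And>k. k < m \<Longrightarrow> vnorm E (y k) \<le> R"
    and near: "\<And>K. \<lbrakk>K \<subseteq> {..<m}; card K = n\<rbrakk> \<Longrightarrow> norm (A (map y (nths [0..<m] K)) - v) \<le> \<epsilon>"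
    and \<epsilon>: "0 \<le> \<epsilon>"
  shows "norm (A (replicate n (of_real (1 / real m) \<odot> (\<Oplus>k\<in>{..<m}. y k))) - v) \<le>
    \<epsilon> + (1 - real (card {ks. length ks = n \<and> distinct ks \<and> set ks \<subseteq> {..<m}}) / real m ^ n) * (D * R ^ n + norm v)"
proof -
  note A' = symmetric_nforms_nforms[OF A]
  define L where "L = {ks. set ks \<subseteq> {..<m} \<and> length ks = n}"
  define L' where "L' = {ks. length ks = n \<and> distinct ks \<and> set ks \<subseteq> {..<m}}"
  \<comment> \<open>The trivial estimate of one term, used for words with a repeated index.\<close>
  define W where "W = D * R ^ n + norm v"
  have finL: "finite L" and cardL: "card L = m ^ n"
    unfolding L_def by (simp_all add: finite_lists_length_eq card_lists_length_eq)
  have L'L: "L' \<subseteq> L" by (auto simp: L_def L'_def)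
  have S_in: "(\<Oplus>k\<in>{..<m}. y k) \<in> carrier E" using y by (intro finsum_in) auto
  have expand: "A (replicate n (\<Oplus>k\<in>{..<m}. y k)) = (\<Sum>ks\<in>L. A (map y ks))"
    using nforms_expand[OF A', of "{..<m}" y "[]" n] y unfolding L_def by (simp add: Pi_def)
  have "A (replicate n (of_real (1 / real m) \<odot> (\<Oplus>k\<in>{..<m}. y k))) - v =
      of_real (1 / real m) ^ n * ((\<Sum>ks\<in>L. A (map y ks)) - of_nat (m ^ n) * v)"
    using m by (subst nforms_replicate_smult[OF A' S_in]) (simp add: expand right_diff_distrib power_one_over field_simps)
  also have "(\<Sum>ks\<in>L. A (map y ks)) - of_nat (m ^ n) * v = (\<Sum>ks\<in>L. A (map y ks) - v)"
    by (simp add: sum_subtractf cardL)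
  finally have "norm (A (replicate n (of_real (1 / real m) \<odot> (\<Oplus>k\<in>{..<m}. y k))) - v) =
      (1 / real m) ^ n * norm (\<Sum>ks\<in>L. A (map y ks) - v)"
    by (simp add: norm_mult norm_power norm_divide)
  also have "norm (\<Sum>ks\<in>L. A (map y ks) - v) \<le> (\<Sum>ks\<in>L. if ks \<in> L' then \<epsilon> else W)"
  proof (rule sum_norm_le)
    fix ks assume ks: "ks \<in> L"
    have y_in: "set (map y ks) \<subseteq> carrier E" using ks y by (auto simp: L_def)
    show "norm (A (map y ks) - v) \<le> (if ks \<in> L' then \<epsilon> else W)"
    proof (cases "ks \<in> L'")
      case True
      then have K: "set ks \<subseteq> {..<m}" "card (set ks) = n" "distinct ks"
        by (auto simp: L'_def distinct_card)
      have "k \<in> set (nths [0..<m] (set ks)) \<longleftrightarrow> k \<in> set ks" for k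
        using K(1) by (auto simp: set_nths intro!: exI[of _ k])
      then have "set (nths [0..<m] (set ks)) = set ks" by (rule Set.set_eqI)
      then have "mset (nths [0..<m] (set ks)) = mset ks"
        by (rule set_eq_iff_mset_eq_distinct[OF distinct_nthsI[OF distinct_upt] K(3), THEN iffD1])
      then have "mset (map y (nths [0..<m] (set ks))) = mset (map y ks)" by (simp only: mset_map)
      from symmetric_nforms_mset[OF A this] near[OF K(1,2)] True show ?thesis by simp
    next
      case False
      have "norm (A (map y ks) - v) \<le> norm (A (map y ks)) + norm v" by (rule norm_triangle_ineq4)
      also have "norm (A (map y ks)) \<le> D * prod_list (map (vnorm E) (map y ks))"
        using D y_in unfolding bounded_form_def by blast
      also have "prod_list (map (vnorm E) (map y ks)) \<le> R ^ length (map y ks)"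
        using ks y by (intro prod_list_le_power[THEN conjunct2]) (auto simp: L_def vnorm_nonneg)
      finally show ?thesis using False D ks by (simp add: W_def L_def bounded_form_def mult_left_mono)
    qed
  qed
  also have "\<dots> = real (card L') * \<epsilon> + (real m ^ n - real (card L')) * W"
  proof -
    have "L \<inter> {ks. ks \<in> L'} = L'" "L \<inter> - {ks. ks \<in> L'} = L - L'" using L'L by auto
    moreover have "real (card (L - L')) = real m ^ n - real (card L')"
      using card_Diff_subset[OF finite_subset[OF L'L finL] L'L] card_mono[OF finL L'L] cardL
      by (simp add: of_nat_diff)
    ultimately show ?thesis using finL by (simp add: sum.If_cases)
  qed
  also have "real (card L') * \<epsilon> \<le> real m ^ n * \<epsilon>"
    using card_mono[OF finL L'L] cardL \<epsilon> by (intro mult_right_mono) (simp_all flip: of_nat_power)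
  finally have "norm (A (replicate n (of_real (1 / real m) \<odot> (\<Oplus>k\<in>{..<m}. y k))) - v) \<le>
      (1 / real m) ^ n * (real m ^ n * \<epsilon> + (real m ^ n - real (card L')) * W)"
    by (simp add: mult_left_mono)
  also have "\<dots> = \<epsilon> + (1 - real (card L') / real m ^ n) * W"
    using m by (simp add: field_simps power_one_over)
  finally show ?thesis by (simp add: W_def L'_def)
qed

context ultra_space
begin

lemma finite_families_bound:
  assumes "finite B" "\<And>b. b \<in> B \<Longrightarrow> z b \<in> bounded_families E"
  shows "\<exists>R\<ge>0. \<forall>b\<in>B. \<forall>i. vnorm E (z b i) \<le> R"
  using assms
proof (induction B rule: finite_induct)
  case (insert b B)
  then obtain R where R: "R \<ge> 0" "\<forall>b\<in>B. \<forall>i. vnorm E (z b i) \<le> R" by auto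
  obtain C where C: "\<And>i. vnorm E (z b i) \<le> C"
    using insert.prems[of b] by (rule family_bound[OF _ that]) simp_all
  show ?case
    using R C by (intro exI[of _ "max R C"]) (auto simp: le_max_iff_disj)
qed auto

end

context ultra_model
begin

lemma FIN_submodule:
  assumes "M \<in> FIN F"
  shows "M \<subseteq> carrier F" "\<And>x y. \<lbrakk>x \<in> M; y \<in> M\<rbrakk> \<Longrightarrow> x \<oplus>\<^bsub>F\<^esub> y \<in> M" "\<And>c x. x \<in> M \<Longrightarrow> c \<odot>\<^bsub>F\<^esub> x \<in> M" "\<zero>\<^bsub>F\<^esub> \<in> M"
  using assms unfolding FIN_def F.submodule_iff by blast+

text \<open>If the bound failed for ultrafilter-many \<open>i\<close>, coordinates of witnesses would converge along
  \<open>U\<close> to a vector of norm at most \<open>1\<close> whose representing family has norms at least \<open>1 + \<epsilon>\<close>.\<close>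

lemma local_maps:
  assumes M: "M \<in> FIN F" and \<epsilon>: "0 < \<epsilon>"
  obtains T where
    "\<And>i x. x \<in> M \<Longrightarrow> T i x \<in> carrier E"
    "\<And>i x y. \<lbrakk>x \<in> M; y \<in> M\<rbrakk> \<Longrightarrow> T i (x \<oplus>\<^bsub>F\<^esub> y) = T i x \<oplus> T i y"
    "\<And>i c x. x \<in> M \<Longrightarrow> T i (c \<odot>\<^bsub>F\<^esub> x) = c \<odot> T i x"
    "\<And>x. x \<in> M \<Longrightarrow> (\<lambda>i. T i x) \<in> bounded_families E"
    "\<And>x. x \<in> M \<Longrightarrow> close U E (\<lambda>i. T i x) (\<rho> x)"
    "eventually (\<lambda>i. \<forall>x\<in>M. vnorm E (T i x) \<le> (1 + \<epsilon>) * vnorm F x) U"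
proof -
  note sub = FIN_submodule[OF M]
  obtain B f C where B: "finite B" "B \<subseteq> M" and C: "0 \<le> C"
    and f: "\<And>x. x \<in> M \<Longrightarrow> x = (\<Oplus>\<^bsub>F\<^esub>b\<in>B. f x b \<odot>\<^bsub>F\<^esub> b)"
    "\<And>x b. \<lbrakk>x \<in> M; b \<in> B\<rbrakk> \<Longrightarrow> norm (f x b) \<le> C * vnorm F x"
    "\<And>x y b. \<lbrakk>x \<in> M; y \<in> M; b \<in> B\<rbrakk> \<Longrightarrow> f (x \<oplus>\<^bsub>F\<^esub> y) b = f x b + f y b"
    "\<And>a x b. \<lbrakk>x \<in> M; b \<in> B\<rbrakk> \<Longrightarrow> f (a \<odot>\<^bsub>F\<^esub> x) b = a * f x b"
    by (rule F.FIN_coordinates[OF M]) (rule that)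
  have BF: "B \<subseteq> carrier F" using B(2) sub(1) by (rule order.trans)
  have \<rho>B: "\<rho> b \<in> bounded_families E" if "b \<in> B" for b using that BF by (auto intro: rep_bounded)
  have \<rho>in: "\<rho> b i \<in> carrier E" if "b \<in> B" for b i using \<rho>B[OF that] by (rule family_in)
  \<comment> \<open>The coefficients are kept and each basis vector is replaced by the
    \<open>i\<close>-th member of its representing family; inserting the coordinates of
    \<open>x\<close> gives \<open>T i x\<close>.\<close>
  define lc where "lc c i = (\<Oplus>b\<in>B. c b \<odot> \<rho> b i)" for c i
  have lc_in: "lc c i \<in> carrier E" for c i unfolding lc_def using \<rho>in by (intro finsum_in smult_in)
  have lc_bounded: "lc c \<in> bounded_families E" for c
    unfolding lc_def[abs_def] using \<rho>B by (intro bounded_families_finsum[OF B(1)] bounded_families_smult)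
  have lc_close: "close U E (\<rho> (\<Oplus>\<^bsub>F\<^esub>b\<in>B. c b \<odot>\<^bsub>F\<^esub> b)) (lc c)" for c
    unfolding lc_def[abs_def] by (rule rep_finsum[OF B(1) BF])
  have "\<exists>R\<ge>0. \<forall>b\<in>B. \<forall>i. vnorm E (\<rho> b i) \<le> R"
    by (rule finite_families_bound[OF B(1) \<rho>B])
  then obtain R where R: "0 \<le> R" "\<And>b i. b \<in> B \<Longrightarrow> vnorm E (\<rho> b i) \<le> R"
    by auto
  have lc_add: "lc (\<lambda>b. c b + d b) i = lc c i \<oplus> lc d i" for c d i
  proof -
    have "lc (\<lambda>b. c b + d b) i = (\<Oplus>b\<in>B. c b \<odot> \<rho> b i \<oplus> d b \<odot> \<rho> b i)"
      unfolding lc_def using \<rho>in by (intro M.finsum_cong') (auto simp: smult_add_left)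
    also have "\<dots> = lc c i \<oplus> lc d i"
      unfolding lc_def using \<rho>in by (intro finsum_add) auto
    finally show ?thesis .
  qed
  have lc_smult: "lc (\<lambda>b. a * c b) i = a \<odot> lc c i" for a c i
  proof -
    have "lc (\<lambda>b. a * c b) i = (\<Oplus>b\<in>B. a \<odot> (c b \<odot> \<rho> b i))"
      unfolding lc_def using \<rho>in by (intro M.finsum_cong') (auto simp: smult_smult)
    also have "\<dots> = a \<odot> lc c i"
      unfolding lc_def using \<rho>in by (intro finsum_smult[OF B(1), symmetric]) auto
    finally show ?thesis .
  qed
  have lc_norm: "vnorm E (lc c i) \<le> (\<Sum>b\<in>B. norm (c b)) * R" for c i
  proof -
    have "vnorm E (lc c i) \<le> (\<Sum>b\<in>B. vnorm E (c b \<odot> \<rho> b i))"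
      unfolding lc_def using \<rho>in by (intro vnorm_finsum_le[OF B(1)]) auto
    also have "\<dots> \<le> (\<Sum>b\<in>B. norm (c b) * R)"
      using R \<rho>in by (intro sum_mono) (simp add: vnorm_smult mult_left_mono)
    finally show ?thesis by (simp add: sum_distrib_right)
  qed
  have lc_cong: "lc c i = lc d i" if "\<And>b. b \<in> B \<Longrightarrow> c b = d b" for c d i
    unfolding lc_def using that \<rho>in by (intro M.finsum_cong') auto
  define T where "T i x = lc (f x) i" for i x
  have T_smult: "T i (a \<odot>\<^bsub>F\<^esub> x) = a \<odot> T i x" if "x \<in> M" for i a x
    unfolding T_def using lc_cong[of "f (a \<odot>\<^bsub>F\<^esub> x)" "\<lambda>b. a * f x b" i] f(4)[OF that] lc_smult by simp
  have ev: "eventually (\<lambda>i. \<forall>x\<in>M. vnorm E (T i x) \<le> (1 + \<epsilon>) * vnorm F x) U"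
  proof (rule ccontr)
    define P where "P i y \<longleftrightarrow> y \<in> M \<and> vnorm F y \<le> 1 \<and> 1 + \<epsilon> \<le> vnorm E (T i y)" for i y
    assume "\<not> ?thesis"
    then have "eventually (\<lambda>i. \<not> (\<forall>x\<in>M. vnorm E (T i x) \<le> (1 + \<epsilon>) * vnorm F x)) U"
      by (rule ultrafilter_not_eventually[OF ultra])
    then have evP: "eventually (\<lambda>i. \<exists>y. P i y) U"
    proof eventually_elim
      case (elim i)
      then obtain x where x: "x \<in> M" "(1 + \<epsilon>) * vnorm F x < vnorm E (T i x)" by force
      have xF: "x \<in> carrier F" using x sub by blast
      have pos: "0 < vnorm F x"
      proof (rule ccontr)
        assume "\<not> 0 < vnorm F x"
        then have "vnorm F x = 0" using F.vnorm_nonneg[OF xF] by simp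
        then have "norm (f x b) \<le> 0" if "b \<in> B" for b using f(2)[OF x(1) that] by simp
        then have "vnorm E (T i x) \<le> 0" using lc_norm[of "f x" i] by (simp add: T_def)
        with x(2) \<open>vnorm F x = 0\<close> show False by simp
      qed
      define y where "y = (of_real (1 / vnorm F x) :: 'k) \<odot>\<^bsub>F\<^esub> x"
      have "y \<in> M" unfolding y_def by (rule sub(3)[OF x(1)])
      moreover have "vnorm F y \<le> 1" unfolding y_def using pos xF by (simp add: F.vnorm_smult norm_divide)
      moreover have "vnorm E (T i y) = vnorm E (T i x) / vnorm F x"
        unfolding y_def T_smult[OF x(1)] using pos lc_in by (simp add: T_def vnorm_smult norm_divide)
      moreover have "1 + \<epsilon> < vnorm E (T i x) / vnorm F x" using x(2) pos by (simp add: pos_less_divide_eq)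
      ultimately have "1 + \<epsilon> \<le> vnorm E (T i y)" "y \<in> M" "vnorm F y \<le> 1" by simp_all
      then show ?case unfolding P_def by blast
    qed
    \<comment> \<open>Where no witness exists, \<open>y i\<close> is zero, which lies in
      \<open>M\<close> and has norm at most 1. The bounds on \<open>y i\<close> and on its
      coordinates thus hold for every index.\<close>
    define y where "y i = (if \<exists>y. P i y then SOME y. P i y else \<zero>\<^bsub>F\<^esub>)" for i
    have yP: "P i (y i)" if "\<exists>y. P i y" for i
      using someI_ex[OF that] that by (simp add: y_def)
    have yM: "y i \<in> M" "vnorm F (y i) \<le> 1" for i
    proof -
      have "y i \<in> M \<and> vnorm F (y i) \<le> 1"
      proof (cases "\<exists>y. P i y")
        case True
        from yP[OF this] show ?thesis unfolding P_def[of i "y i"] by simp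
      next
        case False
        then have "y i = \<zero>\<^bsub>F\<^esub>" by (simp add: y_def)
        with sub(4) show ?thesis by simp
      qed
      then show "y i \<in> M" "vnorm F (y i) \<le> 1" by simp_all
    qed
    define a where "a b = Lim U (\<lambda>i. f (y i) b)" for b
    have a: "((\<lambda>i. f (y i) b) \<longlongrightarrow> a b) U" if b: "b \<in> B" for b
      unfolding a_def
    proof (rule ultrafilter_convergent[OF ultra, of _ C], intro always_eventually allI)
      fix i
      show "norm (f (y i) b) \<le> C"
        using f(2)[OF yM(1) b, of i] mult_left_mono[OF yM(2) C, of i] by simp
    qed
    define x where "x = (\<Oplus>\<^bsub>F\<^esub>b\<in>B. a b \<odot>\<^bsub>F\<^esub> b)"
    have xF: "x \<in> carrier F" unfolding x_def by (rule F.lincomb_in[OF BF])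
    have yF: "y i \<in> carrier F" for i using yM(1) sub(1) by blast
    \<comment> \<open>The weights \<open>r\<close> are left open because the coordinate error is
      measured twice: with the norms of the basis vectors in \<open>F\<close>, and with weight 1,
      multiplied by \<open>R\<close>, for the representing families in \<open>E\<close>.\<close>
    have diff0: "((\<lambda>i. \<Sum>b\<in>B. norm (f (y i) b - a b) * r b) \<longlongrightarrow> 0) U" for r :: "'v \<Rightarrow> real"
      using a by (auto intro!: tendsto_null_sum tendsto_mult_left_zero tendsto_norm_zero LIM_zero)
    have "vnorm F x \<le> 1 + (\<Sum>b\<in>B. norm (f (y i) b - a b) * vnorm F b)" for i
    proof -
      have "vnorm F (y i \<ominus>\<^bsub>F\<^esub> x) \<le> (\<Sum>b\<in>B. norm (f (y i) b - a b) * vnorm F b)"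
        using F.lincomb_diff_le[OF B(1) BF, of "f (y i)" a] by (simp add: x_def flip: f(1)[OF yM(1)])
      with F.vnorm_le_diff_add[OF xF yF, of i] F.vnorm_diff_commute[OF xF yF, of i] yM(2)[of i]
      show ?thesis by linarith
    qed
    then have x1: "vnorm F x \<le> 1 + 0"
      by (intro tendsto_lowerbound[OF tendsto_add[OF tendsto_const diff0] _ ultrafilter_not_bot[OF ultra]]
          always_eventually allI)
    have lim: "((\<lambda>i. vnorm E (lc a i) + (\<Sum>b\<in>B. norm (f (y i) b - a b) * 1) * R) \<longlongrightarrow> vnorm F x + 0 * R) U"
      using close_rep_norm[OF lc_close xF[unfolded x_def] lc_bounded]
      by (intro tendsto_intros diff0) (simp add: x_def)
    have "eventually (\<lambda>i. 1 + \<epsilon> \<le> vnorm E (lc a i) + (\<Sum>b\<in>B. norm (f (y i) b - a b) * 1) * R) U"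
      using evP
    proof eventually_elim
      case (elim i)
      have "lc (f (y i)) i = lc (\<lambda>b. f (y i) b - a b) i \<oplus> lc a i"
        using lc_add[of "\<lambda>b. f (y i) b - a b" a i] by simp
      then have "vnorm E (T i (y i)) \<le> vnorm E (lc (\<lambda>b. f (y i) b - a b) i) + vnorm E (lc a i)"
        unfolding T_def using vnorm_triangle[OF lc_in lc_in] by simp
      with lc_norm[of "\<lambda>b. f (y i) b - a b" i] yP[OF elim] show ?case by (simp add: P_def)
    qed
    from tendsto_lowerbound[OF lim this ultrafilter_not_bot[OF ultra]] x1 \<epsilon> show False by simp
  qed
  show ?thesis
  proof (rule that[of T])
    show "eventually (\<lambda>i. \<forall>x\<in>M. vnorm E (T i x) \<le> (1 + \<epsilon>) * vnorm F x) U" by (rule ev)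
    fix x assume x: "x \<in> M"
    show "T i x \<in> carrier E" for i unfolding T_def by (rule lc_in)
    show "T i (x \<oplus>\<^bsub>F\<^esub> y) = T i x \<oplus> T i y" if "y \<in> M" for i y
      unfolding T_def using lc_cong[of "f (x \<oplus>\<^bsub>F\<^esub> y)" "\<lambda>b. f x b + f y b" i] f(3)[OF x that] lc_add by simp
    show "T i (c \<odot>\<^bsub>F\<^esub> x) = c \<odot> T i x" for i c by (rule T_smult[OF x])
    show "(\<lambda>i. T i x) \<in> bounded_families E" unfolding T_def by (rule lc_bounded)
    have "close U E (\<rho> x) (lc (f x))" using lc_close[of "f x"] by (simp flip: f(1)[OF x])
    then show "close U E (\<lambda>i. T i x) (\<rho> x)"
      unfolding T_def by (rule close_sym[OF _ rep_bounded[OF subsetD[OF sub(1) x]] lc_bounded])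
  qed
qed

text \<open>Averaging many of the maps \<open>T i\<close> makes the diagonal of the form approximate the iterated
  limit: by symmetry all terms with pairwise distinct indices are close to it, and the proportion
  of the remaining terms tends to \<open>0\<close>.\<close>

lemma local_approximation:
  assumes M: "M \<in> FIN F" and A: "A \<in> symmetric_nforms n E" and D: "bounded_form E D A"
    and G: "finite G" "G \<subseteq> M" and \<epsilon>: "0 < \<epsilon>"
  obtains S where "S \<in> blinear (subspace_of F M) E"
    "\<And>x. x \<in> M \<Longrightarrow> vnorm E (S x) \<le> (1 + \<epsilon>) * vnorm F x"
    "\<And>x. x \<in> G \<Longrightarrow> norm (A (replicate n (S x)) - extension n A x) \<le> \<epsilon>"
proof -
  note A' = symmetric_nforms_nforms[OF A]
  note sub = FIN_submodule[OF M]
  obtain T where T: "\<And>i x. x \<in> M \<Longrightarrow> T i x \<in> carrier E"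
    "\<And>i x y. \<lbrakk>x \<in> M; y \<in> M\<rbrakk> \<Longrightarrow> T i (x \<oplus>\<^bsub>F\<^esub> y) = T i x \<oplus> T i y"
    "\<And>i c x. x \<in> M \<Longrightarrow> T i (c \<odot>\<^bsub>F\<^esub> x) = c \<odot> T i x"
    "\<And>x. x \<in> M \<Longrightarrow> (\<lambda>i. T i x) \<in> bounded_families E"
    "\<And>x. x \<in> M \<Longrightarrow> close U E (\<lambda>i. T i x) (\<rho> x)"
    "eventually (\<lambda>i. \<forall>x\<in>M. vnorm E (T i x) \<le> (1 + \<epsilon>) * vnorm F x) U"
    by (rule local_maps[OF M \<epsilon>]) (rule that)
  have "\<exists>R\<ge>0. \<forall>x\<in>G. \<forall>i. vnorm E (T i x) \<le> R"
    by (rule finite_families_bound[OF G(1) T(4)[OF subsetD[OF G(2)]]])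
  then obtain R where R: "0 \<le> R" "\<And>x i. x \<in> G \<Longrightarrow> vnorm E (T i x) \<le> R" by auto
  \<comment> \<open>\<open>W\<close> dominates the trivial estimate at all points of
    \<open>G\<close> at once. The summand 1 makes it positive, so that
    \<open>\<epsilon> / (2 * W)\<close> is an admissible proportion.\<close>
  define W where "W = (\<Sum>x\<in>G. norm (extension n A x)) + D * R ^ n + 1"
  have D0: "0 \<le> D * R ^ n" using D R(1) by (simp add: bounded_form_def)
  have W: "D * R ^ n + norm (extension n A x) \<le> W" if "x \<in> G" for x
    using member_le_sum[of x G "\<lambda>x. norm (extension n A x)"] G(1) that by (simp add: W_def)
  have W0: "0 < W" using D0 sum_nonneg[of G "\<lambda>x. norm (extension n A x)"] by (simp add: W_def)
  obtain m where m: "0 < m"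
    "1 - real (card {ks. length ks = n \<and> distinct ks \<and> set ks \<subseteq> {..<m}}) / real m ^ n \<le> \<epsilon> / (2 * W)"
    using distinct_lists_ratio[of "\<epsilon> / (2 * W)" n] \<epsilon> W0 by auto
  have near: "iterated_ev U n (\<lambda>is. norm (A (map (\<lambda>i. T i x) is) - extension n A x) < \<epsilon> / 2)" if x: "x \<in> G" for x
  proof -
    have xM: "x \<in> M" "x \<in> carrier F" using x G(2) sub(1) by auto
    have "norm (A (map (\<lambda>i. T i x) is)) \<le> D * R ^ n" if len: "length is = n" for "is"
    proof -
      have "norm (A (map (\<lambda>i. T i x) is)) \<le> D * prod_list (map (vnorm E) (map (\<lambda>i. T i x) is))"
      proof -
        have "set (map (\<lambda>i. T i x) is) \<subseteq> carrier E" using T(1)[OF xM(1)] by auto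
        with D show ?thesis unfolding bounded_form_def by blast
      qed
      also have "prod_list (map (vnorm E) (map (\<lambda>i. T i x) is)) \<le> R ^ length (map (\<lambda>i. T i x) is)"
        using R(2)[OF x] T(1)[OF xM(1)]
        by (intro prod_list_le_power[THEN conjunct2]) (auto simp: vnorm_nonneg)
      finally show ?thesis using D len by (simp add: bounded_form_def mult_left_mono)
    qed
    moreover have "iterated_lim U n (\<lambda>is. A (map (\<lambda>i. T i x) is)) = extension n A x"
      using family_form_close_replicate[OF A' D T(5)[OF xM(1)] T(4)[OF xM(1)] rep_bounded[OF xM(2)]] xM(2)
      by (simp add: extension_def zero_ext_def family_form_replicate)
    ultimately show ?thesis
      using iterated_ev_near[OF ultra, of n "\<lambda>is. A (map (\<lambda>i. T i x) is)" "D * R ^ n" "\<epsilon> / 2"] \<epsilon> by simp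
  qed
  \<comment> \<open>All choices of \<open>n\<close> positions. There are finitely many, so a single
    tuple of \<open>m\<close> indices can serve all of them and satisfy the norm bound as
    well.\<close>
  define K where "K = {K. K \<subseteq> {..<m} \<and> card K = n}"
  have finK: "finite K" unfolding K_def by (rule finite_subset[of _ "Pow {..<m}"]) auto
  have "iterated_ev U n (\<lambda>is. \<forall>x\<in>G. norm (A (map (\<lambda>i. T i x) is) - extension n A x) < \<epsilon> / 2)"
    by (rule iterated_ev_Ball[OF ultra G(1) near])
  then have "iterated_ev U m (\<lambda>is. \<forall>x\<in>G. norm (A (map (\<lambda>i. T i x) (nths is k)) - extension n A x) < \<epsilon> / 2)"
    if "k \<in> K" for k
    by (rule iterated_ev_nths[OF ultra]) (use that in \<open>simp_all add: K_def\<close>)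
  then have 1: "iterated_ev U m (\<lambda>is. \<forall>k\<in>K. \<forall>x\<in>G. norm (A (map (\<lambda>i. T i x) (nths is k)) - extension n A x) < \<epsilon> / 2)"
    by (rule iterated_ev_Ball[OF ultra finK])
  have 2: "iterated_ev U m (\<lambda>is. \<forall>i\<in>set is. \<forall>x\<in>M. vnorm E (T i x) \<le> (1 + \<epsilon>) * vnorm F x)"
    by (rule iterated_ev_set[OF ultra T(6)])
  obtain "is" where len: "length is = m"
    and near_is: "\<And>k x. \<lbrakk>k \<in> K; x \<in> G\<rbrakk> \<Longrightarrow> norm (A (map (\<lambda>i. T i x) (nths is k)) - extension n A x) < \<epsilon> / 2"
    and small: "\<And>i x. \<lbrakk>i \<in> set is; x \<in> M\<rbrakk> \<Longrightarrow> vnorm E (T i x) \<le> (1 + \<epsilon>) * vnorm F x"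
    using iterated_ev_ex[OF ultra iterated_ev_conj[OF ultra 1 2]] by blast
  define S where "S x = of_real (1 / real m) \<odot> (\<Oplus>k\<in>{..<m}. T (is ! k) x)" for x
  have sum_in: "(\<Oplus>k\<in>{..<m}. T (is ! k) x) \<in> carrier E" if "x \<in> M" for x
    using that T(1) by (intro finsum_in)
  have S_le: "vnorm E (S x) \<le> (1 + \<epsilon>) * vnorm F x" if x: "x \<in> M" for x
  proof -
    have "vnorm E (\<Oplus>k\<in>{..<m}. T (is ! k) x) \<le> (\<Sum>k\<in>{..<m}. vnorm E (T (is ! k) x))"
      using T(1)[OF x] by (intro vnorm_finsum_le) auto
    also have "\<dots> \<le> (\<Sum>k\<in>{..<m}. (1 + \<epsilon>) * vnorm F x)"
      using x len by (intro sum_mono small) auto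
    finally show ?thesis
      using m(1) sum_in[OF x] by (simp add: S_def vnorm_smult norm_divide field_simps)
  qed
  show ?thesis
  proof (rule that[of S])
    show "S \<in> blinear (subspace_of F M) E"
      unfolding blinear_def subspace_of_def
    proof (intro CollectI conjI)
      show "S \<in> carrier (F\<lparr>carrier := M\<rparr>) \<rightarrow> carrier E"
        using sum_in by (auto simp: S_def)
      show "\<forall>x\<in>carrier (F\<lparr>carrier := M\<rparr>). \<forall>y\<in>carrier (F\<lparr>carrier := M\<rparr>).
          S (x \<oplus>\<^bsub>F\<lparr>carrier := M\<rparr>\<^esub> y) = S x \<oplus> S y"
      proof (intro ballI)
        fix x y assume "x \<in> carrier (F\<lparr>carrier := M\<rparr>)" "y \<in> carrier (F\<lparr>carrier := M\<rparr>)"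
        then have xy: "x \<in> M" "y \<in> M" by simp_all
        have "(\<Oplus>k\<in>{..<m}. T (is ! k) (x \<oplus>\<^bsub>F\<^esub> y)) = (\<Oplus>k\<in>{..<m}. T (is ! k) x \<oplus> T (is ! k) y)"
          using xy T(1) by (intro M.finsum_cong') (auto simp: T(2))
        also have "\<dots> = (\<Oplus>k\<in>{..<m}. T (is ! k) x) \<oplus> (\<Oplus>k\<in>{..<m}. T (is ! k) y)"
          using xy T(1) by (intro finsum_add) auto
        finally show "S (x \<oplus>\<^bsub>F\<lparr>carrier := M\<rparr>\<^esub> y) = S x \<oplus> S y"
          using xy sum_in by (simp add: S_def smult_add_right)
      qed
      show "\<forall>c. \<forall>x\<in>carrier (F\<lparr>carrier := M\<rparr>). S (c \<odot>\<^bsub>F\<lparr>carrier := M\<rparr>\<^esub> x) = c \<odot> S x"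
      proof (intro allI ballI)
        fix c x assume "x \<in> carrier (F\<lparr>carrier := M\<rparr>)"
        then have x: "x \<in> M" by simp
        have "(\<Oplus>k\<in>{..<m}. T (is ! k) (c \<odot>\<^bsub>F\<^esub> x)) = (\<Oplus>k\<in>{..<m}. c \<odot> T (is ! k) x)"
          using x T(1) by (intro M.finsum_cong') (auto simp: T(3))
        also have "\<dots> = c \<odot> (\<Oplus>k\<in>{..<m}. T (is ! k) x)"
          using x T(1) by (intro finsum_smult[symmetric]) auto
        finally show "S (c \<odot>\<^bsub>F\<lparr>carrier := M\<rparr>\<^esub> x) = c \<odot> S x"
          using x sum_in by (simp add: S_def smult_smult mult.commute)
      qed
      show "\<exists>C. \<forall>x\<in>carrier (F\<lparr>carrier := M\<rparr>). vnorm E (S x) \<le> C * vnorm (F\<lparr>carrier := M\<rparr>) x"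
        using S_le by (intro exI[of _ "1 + \<epsilon>"]) auto
    qed
    show "vnorm E (S x) \<le> (1 + \<epsilon>) * vnorm F x" if "x \<in> M" for x by (rule S_le[OF that])
    fix x assume x: "x \<in> G"
    then have xM: "x \<in> M" using G(2) by blast
    define rest where "rest = 1 - real (card {ks. length ks = n \<and> distinct ks \<and> set ks \<subseteq> {..<m}}) / real m ^ n"
    have "norm (A (replicate n (of_real (1 / real m) \<odot> (\<Oplus>k\<in>{..<m}. T (is ! k) x))) - extension n A x) \<le>
      \<epsilon> / 2 + rest * (D * R ^ n + norm (extension n A x))"
      unfolding rest_def
    proof (rule symmetric_form_average[OF A D m(1)])
      fix k assume k: "k \<subseteq> {..<m}" "card k = n"
      have "map ((!) is) [0..<m] = is" using len map_nth[of "is"] by simp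
      then have "nths is k = map ((!) is) (nths [0..<m] k)" using nths_map[of "(!) is" "[0..<m]" k] by simp
      then have "map (\<lambda>i. T i x) (nths is k) = map (\<lambda>j. T (is ! j) x) (nths [0..<m] k)" by simp
      with near_is[of k x] x k show "norm (A (map (\<lambda>j. T (is ! j) x) (nths [0..<m] k)) - extension n A x) \<le> \<epsilon> / 2"
        by (simp add: K_def)
    qed (use T(1)[OF xM] R(2)[OF x] \<epsilon> in auto)
    \<comment> \<open>One half of \<open>\<epsilon>\<close> is spent on the words with distinct
      indices, the other half on those with repetitions.\<close>
    also have "rest * (D * R ^ n + norm (extension n A x)) \<le> \<epsilon> / (2 * W) * W"
    proof (rule mult_mono)
      show "rest \<le> \<epsilon> / (2 * W)" using m(2) by (simp add: rest_def)
    qed (use W[OF x] W0 D0 \<epsilon> in auto)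
    also have "\<dots> = \<epsilon> / 2" using W0 by simp
    finally show "norm (A (replicate n (S x)) - extension n A x) \<le> \<epsilon>" by (simp add: S_def)
  qed
qed

end

section \<open>Renaming and ultrapowers\<close>

context
  fixes h :: "'u \<Rightarrow> 'v" and E :: "('k::real_normed_field, 'u) nspace"
  assumes inj: "inj_on h (carrier E)"
begin

lemma rename_inv: "x \<in> carrier E \<Longrightarrow> the_inv_into (carrier E) h (h x) = x"
  by (rule the_inv_into_f_f[OF inj])

lemma rename_carrier: "carrier (rename h E) = h ` carrier E"
  by (simp add: rename_def Let_def)

lemma rename_add: "\<lbrakk>x \<in> carrier E; y \<in> carrier E\<rbrakk> \<Longrightarrow> h x \<oplus>\<^bsub>rename h E\<^esub> h y = h (x \<oplus>\<^bsub>E\<^esub> y)"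
  by (simp add: rename_def Let_def rename_inv)

lemma rename_zero: "\<zero>\<^bsub>rename h E\<^esub> = h \<zero>\<^bsub>E\<^esub>"
  by (simp add: rename_def Let_def)

lemma rename_smult: "x \<in> carrier E \<Longrightarrow> c \<odot>\<^bsub>rename h E\<^esub> h x = h (c \<odot>\<^bsub>E\<^esub> x)"
  by (simp add: rename_def Let_def rename_inv)

lemma rename_vnorm: "x \<in> carrier E \<Longrightarrow> vnorm (rename h E) (h x) = vnorm E x"
  by (simp add: rename_def Let_def rename_inv)

lemma rename_fun_apply: "x \<in> carrier E \<Longrightarrow> rename_fun h E f (h x) = f x"
  by (simp add: rename_fun_def zero_ext_def rename_inv)

lemma rename_normed:
  assumes "normed_space E"
  shows "normed_space (rename h E)"
proof -
  interpret normed_space E by (rule assms)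
  have neg: "(- 1) \<odot>\<^bsub>E\<^esub> x \<oplus>\<^bsub>E\<^esub> x = \<zero>\<^bsub>E\<^esub>" if "x \<in> carrier E" for x
    using that smult_add_left[of x "- 1" 1] by simp
  show ?thesis
  proof (rule normed_spaceI, unfold rename_carrier)
    fix x y z c d
    assume x: "x \<in> h ` carrier E"
    then obtain a where a: "a \<in> carrier E" "x = h a" by blast
    note s = rename_add rename_zero rename_smult rename_vnorm
    show "c \<odot>\<^bsub>rename h E\<^esub> x \<in> h ` carrier E" using a by (simp add: s)
    show "\<zero>\<^bsub>rename h E\<^esub> \<oplus>\<^bsub>rename h E\<^esub> x = x" using a by (simp add: s)
    show "(- 1) \<odot>\<^bsub>rename h E\<^esub> x \<oplus>\<^bsub>rename h E\<^esub> x = \<zero>\<^bsub>rename h E\<^esub>"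
      using a neg[of a] smult_in[of a "-1"] by (simp only: s)
    show "(c + d) \<odot>\<^bsub>rename h E\<^esub> x = c \<odot>\<^bsub>rename h E\<^esub> x \<oplus>\<^bsub>rename h E\<^esub> d \<odot>\<^bsub>rename h E\<^esub> x"
      using a by (simp add: s smult_add_left)
    show "(c * d) \<odot>\<^bsub>rename h E\<^esub> x = c \<odot>\<^bsub>rename h E\<^esub> (d \<odot>\<^bsub>rename h E\<^esub> x)"
      using a by (simp add: s smult_smult)
    show "1 \<odot>\<^bsub>rename h E\<^esub> x = x" using a by (simp add: s)
    show "0 \<le> vnorm (rename h E) x" using a by (simp add: s vnorm_nonneg)
    show "x = \<zero>\<^bsub>rename h E\<^esub>" if "vnorm (rename h E) x = 0" using a that by (simp add: s vnorm_eq_0_iff)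
    show "vnorm (rename h E) (c \<odot>\<^bsub>rename h E\<^esub> x) = norm c * vnorm (rename h E) x"
      using a by (simp add: s vnorm_smult)
    assume y: "y \<in> h ` carrier E"
    then obtain b where b: "b \<in> carrier E" "y = h b" by blast
    show "x \<oplus>\<^bsub>rename h E\<^esub> y \<in> h ` carrier E" using a b by (simp add: s)
    show "x \<oplus>\<^bsub>rename h E\<^esub> y = y \<oplus>\<^bsub>rename h E\<^esub> x" using a b by (simp add: s M.a_comm)
    show "c \<odot>\<^bsub>rename h E\<^esub> (x \<oplus>\<^bsub>rename h E\<^esub> y) = c \<odot>\<^bsub>rename h E\<^esub> x \<oplus>\<^bsub>rename h E\<^esub> c \<odot>\<^bsub>rename h E\<^esub> y"
      using a b by (simp add: s smult_add_right)
    show "vnorm (rename h E) (x \<oplus>\<^bsub>rename h E\<^esub> y) \<le> vnorm (rename h E) x + vnorm (rename h E) y"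
      using a b by (simp add: s vnorm_triangle)
    assume "z \<in> h ` carrier E"
    then obtain c where "c \<in> carrier E" "z = h c" by blast
    with a b show "x \<oplus>\<^bsub>rename h E\<^esub> y \<oplus>\<^bsub>rename h E\<^esub> z = x \<oplus>\<^bsub>rename h E\<^esub> (y \<oplus>\<^bsub>rename h E\<^esub> z)"
      by (simp add: s M.a_assoc)
  next
    show "\<zero>\<^bsub>rename h E\<^esub> \<in> h ` carrier E" by (simp add: rename_zero)
  qed
qed

lemma rename_banach:
  assumes "banach_space E"
  shows "banach_space (rename h E)"
proof -
  interpret normed_space E by (rule banach_space_normed[OF assms])
  interpret R: normed_space "rename h E" by (rule rename_normed[OF normed_space_axioms])
  have diff: "vnorm (rename h E) (h x \<ominus>\<^bsub>rename h E\<^esub> h y) = vnorm E (x \<ominus>\<^bsub>E\<^esub> y)"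
    if "x \<in> carrier E" "y \<in> carrier E" for x y
  proof -
    have "h x \<ominus>\<^bsub>rename h E\<^esub> h y = h x \<oplus>\<^bsub>rename h E\<^esub> (- 1) \<odot>\<^bsub>rename h E\<^esub> h y"
      using that by (intro R.diff_eq_smult) (simp_all add: rename_carrier)
    also have "\<dots> = h (x \<oplus>\<^bsub>E\<^esub> (- 1) \<odot>\<^bsub>E\<^esub> y)" by (simp only: rename_smult rename_add smult_in that)
    also have "x \<oplus>\<^bsub>E\<^esub> (- 1) \<odot>\<^bsub>E\<^esub> y = x \<ominus>\<^bsub>E\<^esub> y" by (rule diff_eq_smult[OF that, symmetric])
    finally show ?thesis using that by (simp add: rename_vnorm)
  qed
  have "Metric_space.mcomplete (carrier (rename h E)) (ndist (rename h E))"
    unfolding R.mcomplete_iff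
  proof (intro allI impI, elim conjE)
    fix s :: "nat \<Rightarrow> 'v" assume ran: "range s \<subseteq> carrier (rename h E)"
      and cauchy: "\<forall>\<epsilon>>0. \<exists>N. \<forall>p q. N \<le> p \<longrightarrow> N \<le> q \<longrightarrow> vnorm (rename h E) (s p \<ominus>\<^bsub>rename h E\<^esub> s q) < \<epsilon>"
    have "s k \<in> h ` carrier E" for k using ran by (auto simp: rename_carrier)
    then have "\<forall>k. \<exists>a. a \<in> carrier E \<and> s k = h a" by blast
    then obtain t where t: "\<And>k. t k \<in> carrier E" "\<And>k. s k = h (t k)" by metis
    have "\<forall>\<epsilon>>0. \<exists>N. \<forall>p q. N \<le> p \<longrightarrow> N \<le> q \<longrightarrow> vnorm E (t p \<ominus>\<^bsub>E\<^esub> t q) < \<epsilon>"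
      using cauchy by (simp add: t diff)
    moreover have "range t \<subseteq> carrier E" using t(1) by auto
    ultimately have "\<exists>x\<in>carrier E. (\<lambda>k. vnorm E (t k \<ominus>\<^bsub>E\<^esub> x)) \<longlonglongrightarrow> 0"
      using assms unfolding banach_space_def mcomplete_iff by blast
    then obtain x where x: "x \<in> carrier E" "(\<lambda>k. vnorm E (t k \<ominus>\<^bsub>E\<^esub> x)) \<longlonglongrightarrow> 0" by blast
    show "\<exists>x\<in>carrier (rename h E). (\<lambda>k. vnorm (rename h E) (s k \<ominus>\<^bsub>rename h E\<^esub> x)) \<longlonglongrightarrow> 0"
      by (rule bexI[of _ "h x"]) (use x t in \<open>simp_all add: diff rename_carrier\<close>)
  qed
  then show ?thesis unfolding banach_space_def using R.normed_space_axioms by blast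
qed

end

section \<open>The ultrapower as a normed space and as a model\<close>

context ultra_space
begin

lemma uclass_def': "uclass U E z = {w \<in> bounded_families E. close U E z w}"
  by (simp add: uclass_def close_def)

lemma uclass_eqI:
  assumes "z \<in> bounded_families E" "w \<in> bounded_families E" "close U E z w"
  shows "uclass U E z = uclass U E w"
proof -
  have "close U E z v \<longleftrightarrow> close U E w v" if "v \<in> bounded_families E" for v
    using close_trans[OF close_sym[OF assms(3,1,2)] _ assms(2,1) that] close_trans[OF assms(3) _ assms(1,2) that]
    by blast
  then show ?thesis unfolding uclass_def' by blast
qed

lemma urep_uclass:
  assumes "z \<in> bounded_families E"
  shows "urep (uclass U E z) \<in> bounded_families E" "close U E (urep (uclass U E z)) z"
proof -
  have "z \<in> uclass U E z" unfolding uclass_def' using assms close_refl by blast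
  then have "urep (uclass U E z) \<in> uclass U E z" unfolding urep_def by (rule someI[of "\<lambda>w. w \<in> uclass U E z"])
  then have "urep (uclass U E z) \<in> bounded_families E \<and> close U E z (urep (uclass U E z))"
    unfolding uclass_def' by blast
  then show "urep (uclass U E z) \<in> bounded_families E" "close U E (urep (uclass U E z)) z"
    using close_sym assms by blast+
qed

lemma ultrapower_carrier: "carrier (ultrapower U E) = uclass U E ` bounded_families E"
  by (simp add: ultrapower_def)

lemma ultrapower_add:
  assumes "z \<in> bounded_families E" "w \<in> bounded_families E"
  shows "uclass U E z \<oplus>\<^bsub>ultrapower U E\<^esub> uclass U E w = uclass U E (\<lambda>i. z i \<oplus> w i)"
proof -
  have "uclass U E (\<lambda>i. urep (uclass U E z) i \<oplus> urep (uclass U E w) i) = uclass U E (\<lambda>i. z i \<oplus> w i)"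
    using assms by (intro uclass_eqI bounded_families_add close_add urep_uclass)
  then show ?thesis by (simp add: ultrapower_def)
qed

lemma ultrapower_smult:
  assumes "z \<in> bounded_families E"
  shows "c \<odot>\<^bsub>ultrapower U E\<^esub> uclass U E z = uclass U E (\<lambda>i. c \<odot> z i)"
proof -
  have "uclass U E (\<lambda>i. c \<odot> urep (uclass U E z) i) = uclass U E (\<lambda>i. c \<odot> z i)"
    using assms by (intro uclass_eqI bounded_families_smult close_smult urep_uclass)
  then show ?thesis by (simp add: ultrapower_def)
qed

lemma ultrapower_zero: "\<zero>\<^bsub>ultrapower U E\<^esub> = uclass U E (\<lambda>_. \<zero>)"
  by (simp add: ultrapower_def)

lemma ultrapower_vnorm:
  assumes "z \<in> bounded_families E"
  shows "((\<lambda>i. vnorm E (z i)) \<longlongrightarrow> vnorm (ultrapower U E) (uclass U E z)) U"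
proof -
  note c = close_norm[OF urep_uclass(2)[OF assms] urep_uclass(1)[OF assms] assms family_norm_convergent[OF assms]]
  have "vnorm (ultrapower U E) (uclass U E z) = Lim U (\<lambda>i. vnorm E (z i))"
    using ultrafilter_Lim[OF ultra c] by (simp add: ultrapower_def)
  with family_norm_convergent[OF assms] show ?thesis by simp
qed

lemma ultrapower_normed: "normed_space (ultrapower U E)"
proof (rule normed_spaceI, unfold ultrapower_carrier)
  fix x y z c d
  assume x: "x \<in> uclass U E ` bounded_families E"
  then obtain a where a: "a \<in> bounded_families E" "x = uclass U E a" by blast
  note s = ultrapower_add ultrapower_zero ultrapower_smult
    bounded_families_add bounded_families_smult bounded_families_const
  note lim = ultrapower_vnorm tendsto_unique[OF ultrafilter_not_bot[OF ultra] ultrapower_vnorm]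
  have ain: "a i \<in> carrier E" for i by (rule family_in[OF a(1)])
  have ma: "(\<lambda>i. (- 1) \<odot> a i) \<in> bounded_families E" by (rule bounded_families_smult[OF a(1)])
  show "c \<odot>\<^bsub>ultrapower U E\<^esub> x \<in> uclass U E ` bounded_families E" using a by (simp add: s)
  show "\<zero>\<^bsub>ultrapower U E\<^esub> \<oplus>\<^bsub>ultrapower U E\<^esub> x = x" using a by (simp add: s ain)
  have "(- 1) \<odot> a i \<oplus> a i = \<zero>" for i using smult_add_left[OF ain, of "- 1" 1 i] ain by simp
  then show "(- 1) \<odot>\<^bsub>ultrapower U E\<^esub> x \<oplus>\<^bsub>ultrapower U E\<^esub> x = \<zero>\<^bsub>ultrapower U E\<^esub>"
    using a ma by (simp only: s)
  show "(c + d) \<odot>\<^bsub>ultrapower U E\<^esub> x = c \<odot>\<^bsub>ultrapower U E\<^esub> x \<oplus>\<^bsub>ultrapower U E\<^esub> d \<odot>\<^bsub>ultrapower U E\<^esub> x"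
    using a by (simp add: s smult_add_left[OF ain])
  show "(c * d) \<odot>\<^bsub>ultrapower U E\<^esub> x = c \<odot>\<^bsub>ultrapower U E\<^esub> (d \<odot>\<^bsub>ultrapower U E\<^esub> x)"
    using a by (simp add: s smult_smult[OF ain])
  show "1 \<odot>\<^bsub>ultrapower U E\<^esub> x = x" using a by (simp add: s ain)
  show "0 \<le> vnorm (ultrapower U E) x"
    unfolding a(2)
    by (rule tendsto_lowerbound[OF ultrapower_vnorm[OF a(1)] _ ultrafilter_not_bot[OF ultra]])
       (simp add: vnorm_nonneg ain)
  show "x = \<zero>\<^bsub>ultrapower U E\<^esub>" if "vnorm (ultrapower U E) x = 0"
    unfolding a(2) ultrapower_zero
    by (rule uclass_eqI) (use a that ultrapower_vnorm[OF a(1)] in \<open>simp_all add: s close_def ain\<close>)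
  show "vnorm (ultrapower U E) (c \<odot>\<^bsub>ultrapower U E\<^esub> x) = norm c * vnorm (ultrapower U E) x"
  proof -
    have "((\<lambda>i. norm c * vnorm E (a i)) \<longlongrightarrow> norm c * vnorm (ultrapower U E) x) U"
      unfolding a(2) by (intro tendsto_mult tendsto_const ultrapower_vnorm a)
    then have "((\<lambda>i. vnorm E (c \<odot> a i)) \<longlongrightarrow> norm c * vnorm (ultrapower U E) x) U"
      by (simp add: vnorm_smult ain)
    with ultrapower_vnorm[OF bounded_families_smult[OF a(1), of c]] show ?thesis
      unfolding a(2) ultrapower_smult[OF a(1)] by (rule tendsto_unique[OF ultrafilter_not_bot[OF ultra]])
  qed
  assume y: "y \<in> uclass U E ` bounded_families E"
  then obtain b where b: "b \<in> bounded_families E" "y = uclass U E b" by blast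
  have bin: "b i \<in> carrier E" for i by (rule family_in[OF b(1)])
  show "x \<oplus>\<^bsub>ultrapower U E\<^esub> y \<in> uclass U E ` bounded_families E" using a b by (simp add: s)
  show "x \<oplus>\<^bsub>ultrapower U E\<^esub> y = y \<oplus>\<^bsub>ultrapower U E\<^esub> x" using a b by (simp add: s M.a_comm[OF ain bin])
  show "c \<odot>\<^bsub>ultrapower U E\<^esub> (x \<oplus>\<^bsub>ultrapower U E\<^esub> y) = c \<odot>\<^bsub>ultrapower U E\<^esub> x \<oplus>\<^bsub>ultrapower U E\<^esub> c \<odot>\<^bsub>ultrapower U E\<^esub> y"
    using a b by (simp add: s smult_add_right[OF ain bin])
  show "vnorm (ultrapower U E) (x \<oplus>\<^bsub>ultrapower U E\<^esub> y) \<le> vnorm (ultrapower U E) x + vnorm (ultrapower U E) y"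
    unfolding a(2) b(2) ultrapower_add[OF a(1) b(1)]
    by (rule tendsto_le[OF ultrafilter_not_bot[OF ultra] tendsto_add[OF ultrapower_vnorm[OF a(1)] ultrapower_vnorm[OF b(1)]]
         ultrapower_vnorm[OF bounded_families_add[OF a(1) b(1)]]])
       (simp add: vnorm_triangle ain bin)
  assume "z \<in> uclass U E ` bounded_families E"
  then obtain c where c: "c \<in> bounded_families E" "z = uclass U E c" by blast
  have cin: "c i \<in> carrier E" for i by (rule family_in[OF c(1)])
  show "x \<oplus>\<^bsub>ultrapower U E\<^esub> y \<oplus>\<^bsub>ultrapower U E\<^esub> z = x \<oplus>\<^bsub>ultrapower U E\<^esub> (y \<oplus>\<^bsub>ultrapower U E\<^esub> z)"
    using a b c by (simp add: s M.a_assoc[OF ain bin cin])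
next
  show "\<zero>\<^bsub>ultrapower U E\<^esub> \<in> uclass U E ` bounded_families E"
    by (simp add: ultrapower_zero bounded_families_const)
qed

text \<open>The representing families are those picked by \<open>urep\<close>, as in
  \<open>iterated_extension\<close>, so the extension in this model is exactly the renamed iterated
  extension. The laws hold up to null families because \<open>urep\<close> of a sum is a choice of
  its own.\<close>

lemma ultrapower_model:
  assumes inj: "inj_on j (carrier (ultrapower U E))"
  shows "ultra_model E U (rename j (ultrapower U E)) (\<lambda>x. urep (the_inv_into (carrier (ultrapower U E)) j x))"
proof -
  let ?Y = "ultrapower U E" and ?g = "the_inv_into (carrier (ultrapower U E)) j"
  interpret F: normed_space "rename j ?Y" by (rule rename_normed[OF inj ultrapower_normed])
  note s = rename_inv[OF inj] rename_add[OF inj] rename_smult[OF inj] rename_vnorm[OF inj]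
  have car: "uclass U E a \<in> carrier ?Y" if "a \<in> bounded_families E" for a
    using that by (simp add: ultrapower_carrier)
  show ?thesis
  proof (intro ultra_model.intro hb_space.intro ultra_space_axioms F.normed_space_axioms, unfold_locales)
    fix x assume "x \<in> carrier (rename j ?Y)"
    then obtain a where a: "a \<in> bounded_families E" "x = j (uclass U E a)"
      by (auto simp: rename_carrier[OF inj] ultrapower_carrier)
    have gx: "?g x = uclass U E a" using a car by (simp add: s)
    show "urep (?g x) \<in> bounded_families E" unfolding gx by (rule urep_uclass[OF a(1)])
    show "((\<lambda>i. vnorm E (urep (?g x) i)) \<longlongrightarrow> vnorm (rename j ?Y) x) U"
      unfolding gx using close_norm[OF urep_uclass(2)[OF a(1)] urep_uclass(1)[OF a(1)] a(1) ultrapower_vnorm[OF a(1)]] a car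
      by (simp add: s)
    show "close U E (urep (?g (c \<odot>\<^bsub>rename j ?Y\<^esub> x))) (\<lambda>i. c \<odot> urep (?g x) i)" for c
    proof -
      have "c \<odot>\<^bsub>rename j ?Y\<^esub> x = j (uclass U E (\<lambda>i. c \<odot> urep (uclass U E a) i))"
        using a car by (simp add: s) (simp add: ultrapower_def)
      then have "?g (c \<odot>\<^bsub>rename j ?Y\<^esub> x) = uclass U E (\<lambda>i. c \<odot> urep (uclass U E a) i)"
        using a car by (simp add: s bounded_families_smult urep_uclass)
      then show ?thesis
        unfolding gx using urep_uclass(2)[OF bounded_families_smult[OF urep_uclass(1)[OF a(1)], of c]] by simp
    qed
    fix y assume "y \<in> carrier (rename j ?Y)"
    then obtain b where b: "b \<in> bounded_families E" "y = j (uclass U E b)"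
      by (auto simp: rename_carrier[OF inj] ultrapower_carrier)
    have gy: "?g y = uclass U E b" using b car by (simp add: s)
    show "close U E (urep (?g (x \<oplus>\<^bsub>rename j ?Y\<^esub> y))) (\<lambda>i. urep (?g x) i \<oplus> urep (?g y) i)"
    proof -
      have "x \<oplus>\<^bsub>rename j ?Y\<^esub> y = j (uclass U E (\<lambda>i. urep (uclass U E a) i \<oplus> urep (uclass U E b) i))"
        using a b car by (simp add: s) (simp add: ultrapower_def)
      then have "?g (x \<oplus>\<^bsub>rename j ?Y\<^esub> y) = uclass U E (\<lambda>i. urep (uclass U E a) i \<oplus> urep (uclass U E b) i)"
        using a b car by (simp add: s bounded_families_add urep_uclass)
      then show ?thesis
        unfolding gx gy
        using urep_uclass(2)[OF bounded_families_add[OF urep_uclass(1)[OF a(1)] urep_uclass(1)[OF b(1)]]] by simp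
    qed
  next
    fix z :: "'i \<Rightarrow> 'u" assume z: "z \<in> bounded_families E"
    show "\<exists>x\<in>carrier (rename j ?Y). close U E (urep (?g x)) z"
      by (rule bexI[of _ "j (uclass U E z)"])
         (use z car urep_uclass(2)[OF z] in \<open>simp_all add: s rename_carrier[OF inj]\<close>)
  qed
qed

end

section \<open>Bounded linear maps and symmetric tensors\<close>

lemma scalar_space_normed: "normed_space (scalar_space :: ('k::real_normed_field, 'k) nspace)"
  by (rule normed_spaceI) (auto simp: scalar_space_def algebra_simps norm_mult norm_triangle_ineq)

lemma blinear_in: "\<lbrakk>T \<in> blinear E F; x \<in> carrier E\<rbrakk> \<Longrightarrow> T x \<in> carrier F"
  unfolding blinear_def by auto

lemma blinear_add: "\<lbrakk>T \<in> blinear E F; x \<in> carrier E; y \<in> carrier E\<rbrakk> \<Longrightarrow> T (x \<oplus>\<^bsub>E\<^esub> y) = T x \<oplus>\<^bsub>F\<^esub> T y"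
  unfolding blinear_def by auto

lemma blinear_smult: "\<lbrakk>T \<in> blinear E F; x \<in> carrier E\<rbrakk> \<Longrightarrow> T (c \<odot>\<^bsub>E\<^esub> x) = c \<odot>\<^bsub>F\<^esub> T x"
  unfolding blinear_def by auto

lemma blinearI:
  assumes "\<And>x. x \<in> carrier E \<Longrightarrow> T x \<in> carrier F"
    "\<And>x y. \<lbrakk>x \<in> carrier E; y \<in> carrier E\<rbrakk> \<Longrightarrow> T (x \<oplus>\<^bsub>E\<^esub> y) = T x \<oplus>\<^bsub>F\<^esub> T y"
    "\<And>c x. x \<in> carrier E \<Longrightarrow> T (c \<odot>\<^bsub>E\<^esub> x) = c \<odot>\<^bsub>F\<^esub> T x"
    "\<And>x. x \<in> carrier E \<Longrightarrow> vnorm F (T x) \<le> C * vnorm E x"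
  shows "T \<in> blinear E F"
  unfolding blinear_def using assms by blast

lemma blinear_zero:
  assumes "normed_space E" "normed_space F" "T \<in> blinear E F"
  shows "T \<zero>\<^bsub>E\<^esub> = \<zero>\<^bsub>F\<^esub>"
proof -
  interpret E: normed_space E by (rule assms)
  interpret F: normed_space F by (rule assms)
  have "T (0 \<odot>\<^bsub>E\<^esub> \<zero>\<^bsub>E\<^esub>) = 0 \<odot>\<^bsub>F\<^esub> T \<zero>\<^bsub>E\<^esub>"
    by (rule blinear_smult[OF assms(3)]) simp
  then show ?thesis using blinear_in[OF assms(3), of "\<zero>\<^bsub>E\<^esub>"] by simp
qed

lemma opnorm_le:
  assumes "normed_space E" "0 \<le> K" "\<And>x. x \<in> carrier E \<Longrightarrow> vnorm F (T x) \<le> K * vnorm E x"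
  shows "opnorm E F T \<le> K"
proof -
  interpret E: normed_space E by (rule assms)
  show ?thesis
    unfolding opnorm_def
  proof (rule cSup_least)
    have "vnorm F (T \<zero>\<^bsub>E\<^esub>) \<in> {vnorm F (T x) | x. x \<in> carrier E \<and> vnorm E x \<le> 1}"
      by (intro CollectI exI conjI) auto
    then show "{vnorm F (T x) | x. x \<in> carrier E \<and> vnorm E x \<le> 1} \<noteq> {}" by blast
    fix v assume "v \<in> {vnorm F (T x) | x. x \<in> carrier E \<and> vnorm E x \<le> 1}"
    then obtain x where x: "v = vnorm F (T x)" "x \<in> carrier E" "vnorm E x \<le> 1" by blast
    with assms(3)[OF x(2)] mult_left_mono[OF x(3) assms(2)] show "v \<le> K" by simp
  qed
qed

lemma opnorm_upper:
  assumes "normed_space E" "T \<in> blinear E F" "x \<in> carrier E" "vnorm E x \<le> 1"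
  shows "vnorm F (T x) \<le> opnorm E F T"
  unfolding opnorm_def
proof (rule cSup_upper)
  interpret E: normed_space E by (rule assms)
  obtain C where C: "\<And>x. x \<in> carrier E \<Longrightarrow> vnorm F (T x) \<le> C * vnorm E x"
    using assms(2) unfolding blinear_def by blast
  show "bdd_above {vnorm F (T x) | x. x \<in> carrier E \<and> vnorm E x \<le> 1}"
  proof (rule bdd_aboveI)
    fix v assume "v \<in> {vnorm F (T x) | x. x \<in> carrier E \<and> vnorm E x \<le> 1}"
    then obtain x where x: "v = vnorm F (T x)" "x \<in> carrier E" "vnorm E x \<le> 1" by blast
    have "v \<le> C * vnorm E x" using C x by simp
    \<comment> \<open>The constant of a bounded map may be negative if the space is trivial.\<close>
    also have "\<dots> \<le> \<bar>C\<bar> * vnorm E x" using E.vnorm_nonneg[OF x(2)] by (intro mult_right_mono) auto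
    also have "\<dots> \<le> \<bar>C\<bar> * 1" using x(3) by (intro mult_left_mono) auto
    finally show "v \<le> \<bar>C\<bar>" by simp
  qed
qed (use assms in blast)

lemma opnorm_nonneg:
  assumes "normed_space E" "normed_space F" "T \<in> blinear E F"
  shows "0 \<le> opnorm E F T"
proof -
  interpret E: normed_space E by (rule assms)
  interpret F: normed_space F by (rule assms)
  show ?thesis
    using opnorm_upper[OF assms(1,3) E.M.zero_closed] blinear_zero[OF assms] by simp
qed

lemma opnorm_bound:
  fixes E :: "('k::real_normed_field, 'u) nspace"
  assumes "normed_space E" "normed_space F" "T \<in> blinear E F" "x \<in> carrier E"
  shows "vnorm F (T x) \<le> opnorm E F T * vnorm E x"
proof -
  interpret E: normed_space E by (rule assms)
  interpret F: normed_space F by (rule assms)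
  show ?thesis
  proof (cases "vnorm E x = 0")
    case True
    then have "x = \<zero>\<^bsub>E\<^esub>" using assms(4) by (simp add: E.vnorm_eq_0_iff)
    then show ?thesis using blinear_zero[OF assms(1-3)] by simp
  next
    case False
    then have pos: "0 < vnorm E x" using E.vnorm_nonneg[OF assms(4)] by simp
    have "vnorm F (T ((of_real (1 / vnorm E x) :: 'k) \<odot>\<^bsub>E\<^esub> x)) \<le> opnorm E F T"
      using pos assms(4) by (intro opnorm_upper[OF assms(1,3)]) (simp_all add: E.vnorm_smult norm_divide)
    then have "vnorm F (T x) / vnorm E x \<le> opnorm E F T"
      using pos assms(4) blinear_in[OF assms(3,4)]
      by (simp add: blinear_smult[OF assms(3,4)] F.vnorm_smult norm_divide)
    then show ?thesis using pos by (simp add: pos_divide_le_eq)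
  qed
qed

lemma opnorm_power_le:
  assumes "normed_space E" "normed_space F" "T \<in> blinear E F" "0 \<le> K"
    "\<And>x. x \<in> carrier E \<Longrightarrow> vnorm F (T x) \<le> K * vnorm E x"
  shows "opnorm E F T ^ n \<le> K ^ n"
  by (rule power_mono[OF opnorm_le opnorm_nonneg]) (use assms in blast)+

text \<open>The value does not depend on the decomposition: \<open>P\<close> is the diagonal of some
  form \<open>A\<close>, and the sum is the value at \<open>A\<close> of the tensor, which is itself
  a functional on forms.\<close>

lemma linearization_stensor:
  assumes "P \<in> cpoly n E" "set ws \<subseteq> UNIV \<times> carrier E"
  shows "linearization n E P (stensor n E ws) = (\<Sum>(c, x)\<leftarrow>ws. c * P x)"
  unfolding linearization_def
proof (rule the_equality)
  show "\<exists>ws'. set ws' \<subseteq> UNIV \<times> carrier E \<and> stensor n E ws = stensor n E ws' \<and>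
      (\<Sum>(c, x)\<leftarrow>ws. c * P x) = (\<Sum>(c, x)\<leftarrow>ws'. c * P x)"
    using assms(2) by blast
  obtain A where A: "A \<in> nforms n E" "\<And>x. x \<in> carrier E \<Longrightarrow> P x = A (replicate n x)"
    using assms(1) unfolding cpoly_def by blast
  have eval: "(\<Sum>(c, x)\<leftarrow>vs. c * P x) = stensor n E vs A" if "set vs \<subseteq> UNIV \<times> carrier E" for vs
  proof -
    have eq: "map (\<lambda>(c, x). c * P x) vs = map (\<lambda>(c, x). c * A (replicate n x)) vs"
      using that A(2) by (intro map_cong) auto
    show ?thesis unfolding stensor_def zero_ext_def by (simp only: eq A(1) if_True)
  qed
  fix s assume "\<exists>ws'. set ws' \<subseteq> UNIV \<times> carrier E \<and> stensor n E ws = stensor n E ws' \<and>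
      s = (\<Sum>(c, x)\<leftarrow>ws'. c * P x)"
  then obtain ws' where "set ws' \<subseteq> UNIV \<times> carrier E" "stensor n E ws = stensor n E ws'"
      "s = (\<Sum>(c, x)\<leftarrow>ws'. c * P x)" by blast
  then show "s = (\<Sum>(c, x)\<leftarrow>ws. c * P x)" using eval[OF assms(2)] eval[of ws'] by simp
qed

lemma stensors_obtain:
  assumes "w \<in> stensors n E"
  obtains ws where "set ws \<subseteq> UNIV \<times> carrier E" "w = stensor n E ws"
  using assms unfolding stensors_def by blast

lemma stensors_stensor: "set ws \<subseteq> UNIV \<times> carrier E \<Longrightarrow> stensor n E ws \<in> stensors n E"
  unfolding stensors_def by blast

lemma stensor_add: "(\<lambda>A. stensor n E vs A + stensor n E ws A) = stensor n E (vs @ ws)"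
  by (auto simp: stensor_def zero_ext_def)

lemma stensor_smult:
  fixes E :: "('k::real_normed_field, 'u) nspace"
  shows "(\<lambda>A. a * stensor n E ws A) = stensor n E (map (\<lambda>(c, x). (a * c, x)) ws)"
proof -
  have "a * (\<Sum>(c, x)\<leftarrow>ws. c * A (replicate n x)) = (\<Sum>(c, x)\<leftarrow>map (\<lambda>(c, x). (a * c, x)) ws. c * A (replicate n x))"
    for A :: "'u list \<Rightarrow> 'k"
    by (induction ws) (auto simp: algebra_simps)
  then show ?thesis by (auto simp: stensor_def zero_ext_def)
qed

lemma linearization_blinear:
  assumes P: "P \<in> cpoly n E"
    and le: "\<And>ws. set ws \<subseteq> UNIV \<times> carrier E \<Longrightarrow> norm (\<Sum>(c, x)\<leftarrow>ws. c * P x) \<le> K * \<alpha> E (stensor n E ws)"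
  shows "linearization n E P \<in> blinear (stensor_space n \<alpha> E) scalar_space"
proof (rule blinearI)
  fix v w c assume "v \<in> carrier (stensor_space n \<alpha> E)"
  then obtain vs where vs: "set vs \<subseteq> UNIV \<times> carrier E" "v = stensor n E vs"
    unfolding stensor_space_def function_space_def by (auto elim: stensors_obtain)
  show "linearization n E P v \<in> carrier scalar_space" by (simp add: scalar_space_def)
  show "vnorm scalar_space (linearization n E P v) \<le> K * vnorm (stensor_space n \<alpha> E) v"
    using le[OF vs(1)] vs by (simp add: linearization_stensor[OF P] scalar_space_def stensor_space_def function_space_def)
  have vs': "set (map (\<lambda>(d, x). (c * d, x)) vs) \<subseteq> UNIV \<times> carrier E" using vs(1) by auto
  have "(\<Sum>(d, x)\<leftarrow>map (\<lambda>(d, x). (c * d, x)) vs. d * P x) = c * (\<Sum>(d, x)\<leftarrow>vs. d * P x)"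
    by (induction vs) (auto simp: algebra_simps)
  then show "linearization n E P (c \<odot>\<^bsub>stensor_space n \<alpha> E\<^esub> v) = c \<odot>\<^bsub>scalar_space\<^esub> linearization n E P v"
    using linearization_stensor[OF P vs'] linearization_stensor[OF P vs(1)]
    by (simp add: vs(2) stensor_space_def function_space_def stensor_smult scalar_space_def)
  assume "w \<in> carrier (stensor_space n \<alpha> E)"
  then obtain ws where ws: "set ws \<subseteq> UNIV \<times> carrier E" "w = stensor n E ws"
    unfolding stensor_space_def function_space_def by (auto elim: stensors_obtain)
  have "set (vs @ ws) \<subseteq> UNIV \<times> carrier E" using vs(1) ws(1) by auto
  from linearization_stensor[OF P this]
  show "linearization n E P (v \<oplus>\<^bsub>stensor_space n \<alpha> E\<^esub> w) = linearization n E P v \<oplus>\<^bsub>scalar_space\<^esub> linearization n E P w"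
    using linearization_stensor[OF P vs(1)] linearization_stensor[OF P ws(1)]
    by (simp add: vs(2) ws(2) stensor_space_def function_space_def stensor_add scalar_space_def)
qed

text \<open>The image of a tensor is evaluated at forms pulled back along \<open>T\<close>. These
  must be forms again, since tensors are 0 off \<open>nforms\<close> by convention.\<close>

lemma nforms_pullback:
  assumes "normed_space E" "normed_space F"
    and T: "\<And>x. x \<in> carrier E \<Longrightarrow> T x \<in> carrier F"
    "\<And>x y. \<lbrakk>x \<in> carrier E; y \<in> carrier E\<rbrakk> \<Longrightarrow> T (x \<oplus>\<^bsub>E\<^esub> y) = T x \<oplus>\<^bsub>F\<^esub> T y"
    "\<And>c x. x \<in> carrier E \<Longrightarrow> T (c \<odot>\<^bsub>E\<^esub> x) = c \<odot>\<^bsub>F\<^esub> T x"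
    and B: "B \<in> nforms n F"
  shows "zero_ext (tuples n E) (\<lambda>xs. B (map T xs)) \<in> nforms n E"
proof -
  interpret E: normed_space E by (rule assms)
  interpret F: normed_space F by (rule assms)
  have im: "set (map T xs) \<subseteq> carrier F" if "set xs \<subseteq> carrier E" for xs
    using that T(1) by auto
  show ?thesis
  proof (rule E.nformsI)
    fix ps qs x y
    assume *: "length ps + length qs + 1 = n" "set ps \<subseteq> carrier E" "set qs \<subseteq> carrier E"
       "x \<in> carrier E" "y \<in> carrier E"
    then have tup: "ps @ v # qs \<in> tuples n E" if "v \<in> carrier E" for v
      using that by (simp add: tuples_append)
    have "B (map T ps @ (T x \<oplus>\<^bsub>F\<^esub> T y) # map T qs) = B (map T ps @ T x # map T qs) + B (map T ps @ T y # map T qs)"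
      using * by (intro F.nforms_add[OF B] im T) auto
    then show "zero_ext (tuples n E) (\<lambda>xs. B (map T xs)) (ps @ (x \<oplus>\<^bsub>E\<^esub> y) # qs) =
      zero_ext (tuples n E) (\<lambda>xs. B (map T xs)) (ps @ x # qs) + zero_ext (tuples n E) (\<lambda>xs. B (map T xs)) (ps @ y # qs)"
      using * by (simp add: zero_ext_def tup T(2))
  next
    fix ps qs x c
    assume *: "length ps + length qs + 1 = n" "set ps \<subseteq> carrier E" "set qs \<subseteq> carrier E" "x \<in> carrier E"
    then have tup: "ps @ v # qs \<in> tuples n E" if "v \<in> carrier E" for v
      using that by (simp add: tuples_append)
    have "B (map T ps @ (c \<odot>\<^bsub>F\<^esub> T x) # map T qs) = c * B (map T ps @ T x # map T qs)"
      using * by (intro F.nforms_smult[OF B] im T) auto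
    then show "zero_ext (tuples n E) (\<lambda>xs. B (map T xs)) (ps @ (c \<odot>\<^bsub>E\<^esub> x) # qs) =
      c * zero_ext (tuples n E) (\<lambda>xs. B (map T xs)) (ps @ x # qs)"
      using * by (simp add: zero_ext_def tup T(3))
  qed (simp add: zero_ext_def)
qed

lemma stensor_map_stensor:
  assumes "normed_space E" "normed_space F" "T \<in> blinear E F" "set ws \<subseteq> UNIV \<times> carrier E"
  shows "stensor_map n E F T (stensor n E ws) = stensor n F (map (\<lambda>(c, x). (c, T x)) ws)"
proof
  fix B
  show "stensor_map n E F T (stensor n E ws) B = stensor n F (map (\<lambda>(c, x). (c, T x)) ws) B"
  proof (cases "B \<in> nforms n F")
    case True
    have pb: "zero_ext (tuples n E) (\<lambda>xs. B (map T xs)) \<in> nforms n E"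
      by (rule nforms_pullback[OF assms(1,2) blinear_in[OF assms(3)] blinear_add[OF assms(3)] blinear_smult[OF assms(3)] True])
    have eq: "map (\<lambda>(c, x). c * zero_ext (tuples n E) (\<lambda>xs. B (map T xs)) (replicate n x)) ws =
        map (\<lambda>(c, x). c * B (replicate n (T x))) ws"
    proof (rule map_cong[OF refl])
      fix p assume "p \<in> set ws"
      then have "replicate n (snd p) \<in> tuples n E" using assms(4) by (auto simp: tuples_def set_replicate_conv_if)
      then show "(\<lambda>(c, x). c * zero_ext (tuples n E) (\<lambda>xs. B (map T xs)) (replicate n x)) p =
        (\<lambda>(c, x). c * B (replicate n (T x))) p"
        by (cases p) (simp add: zero_ext_def)
    qed
    have "stensor_map n E F T (stensor n E ws) B =
        sum_list (map (\<lambda>(c, x). c * zero_ext (tuples n E) (\<lambda>xs. B (map T xs)) (replicate n x)) ws)"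
      using True pb by (simp add: stensor_map_def stensor_def zero_ext_def[of "nforms n E"] zero_ext_def[of "nforms n F"])
    also have "\<dots> = stensor n F (map (\<lambda>(c, x). (c, T x)) ws) B"
      unfolding eq using True by (simp add: stensor_def zero_ext_def case_prod_unfold comp_def)
    finally show ?thesis .
  qed (simp add: stensor_map_def stensor_def zero_ext_def)
qed

text \<open>Lets the error parameter tend to 0 from the right in an estimate of a quantity that does
  not depend on it.\<close>

lemma limit_bound:
  fixes a b :: real and \<phi> :: "real \<Rightarrow> real"
  assumes "\<And>\<epsilon>. 0 < \<epsilon> \<Longrightarrow> b \<le> \<phi> \<epsilon>" "(\<phi> \<longlongrightarrow> a) (at_right 0)"
  shows "b \<le> a"
  by (rule tendsto_lowerbound[OF assms(2)])
     (auto simp: eventually_at_filter assms(1) intro!: always_eventually)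

context normed_space
begin

lemma subspace_normed_FIN: "M \<in> FIN E \<Longrightarrow> normed_space (subspace_of E M)"
  by (rule subspace_normed) (simp add: FIN_def)

lemma subspace_inclusion: "M \<in> FIN E \<Longrightarrow> (\<lambda>x. x) \<in> blinear (subspace_of E M) E"
  by (rule blinearI[where C = 1]) (auto simp: subspace_of_def FIN_def submodule_iff)

text \<open>The infimum is approached by a tensor over \<open>M\<close> whose decomposition
  \<open>vs\<close> may be unrelated to \<open>ws\<close>; what they share is the tensor over
  \<open>E\<close>.\<close>

lemma finitely_generated_approx:
  assumes s: "s_tensor_norm n \<alpha>" and fg: "finitely_generated n \<alpha>" and E: "banach_space E"
    and ws: "set ws \<subseteq> UNIV \<times> carrier E" and \<delta>: "0 < \<delta>"
  obtains M vs where "M \<in> FIN E" "set vs \<subseteq> UNIV \<times> M"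
    "\<alpha> (subspace_of E M) (stensor n (subspace_of E M) vs) < \<alpha> E (stensor n E ws) + \<delta>"
    "stensor n E vs = stensor n E ws"
proof -
  define z where "z = stensor n E ws"
  define V where "V = {\<alpha> (subspace_of E M) w | M w. M \<in> FIN E \<and> w \<in> stensors n (subspace_of E M) \<and>
                       stensor_map n (subspace_of E M) E (\<lambda>x. x) w = z}"
  have car: "carrier (subspace_of E M) = M" for M by (simp add: subspace_of_def)
  have map_eq: "stensor_map n (subspace_of E M) E (\<lambda>x. x) (stensor n (subspace_of E M) vs) = stensor n E vs"
    if "M \<in> FIN E" "set vs \<subseteq> UNIV \<times> M" for M vs
    using stensor_map_stensor[OF subspace_normed_FIN[OF that(1)] normed_space_axioms subspace_inclusion[OF that(1)], of vs n] that(2)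
    by (simp add: car case_prod_unfold)
  have eq: "\<alpha> E z = Inf V"
    using fg E stensors_stensor[OF ws, of n] unfolding finitely_generated_def V_def z_def by blast
  \<comment> \<open>An infimum over the empty set would say nothing. The span of the vectors
    occurring in \<open>ws\<close> is one admissible subspace.\<close>
  have "V \<noteq> {}"
  proof -
    define B where "B = snd ` set ws"
    have B: "finite B" "B \<subseteq> carrier E" using ws by (auto simp: B_def)
    have M: "lspan E B \<in> FIN E" by (rule lspan_FIN[OF B])
    have ws': "set ws \<subseteq> UNIV \<times> lspan E B" using lspan_base[OF B] by (force simp: B_def)
    have "\<alpha> (subspace_of E (lspan E B)) (stensor n (subspace_of E (lspan E B)) ws) \<in> V"
      unfolding V_def using M map_eq[OF M ws'] stensors_stensor[of ws "subspace_of E (lspan E B)" n] ws'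
      by (auto simp: car z_def)
    then show ?thesis by blast
  qed
  then have "\<exists>v\<in>V. v < \<alpha> E z + \<delta>"
    by (rule cInf_lessD) (use eq \<delta> in simp)
  then obtain M w where M: "M \<in> FIN E" and w: "w \<in> stensors n (subspace_of E M)"
    "stensor_map n (subspace_of E M) E (\<lambda>x. x) w = z" "\<alpha> (subspace_of E M) w < \<alpha> E z + \<delta>"
    unfolding V_def by blast
  obtain vs where vs: "set vs \<subseteq> UNIV \<times> M" "w = stensor n (subspace_of E M) vs"
    using w(1) by (rule stensors_obtain) (simp add: car)
  show ?thesis
    by (rule that[OF M vs(1)]) (use w vs map_eq[OF M vs(1)] in \<open>simp_all add: z_def\<close>)
qed

end

section \<open>Estimates for dual norms and for images of tensors\<close>

lemma tensor_dual_bound: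
  assumes s: "s_tensor_norm n \<alpha>" and E: "normed_space E" and P: "P \<in> tensor_dual n \<alpha> E"
    and ws: "set ws \<subseteq> UNIV \<times> carrier E"
  shows "norm (\<Sum>(c, x)\<leftarrow>ws. c * P x) \<le> tensor_dual_norm n \<alpha> E P * \<alpha> E (stensor n E ws)"
proof -
  have P': "P \<in> cpoly n E" "linearization n E P \<in> blinear (stensor_space n \<alpha> E) scalar_space"
    using P by (simp_all add: tensor_dual_def)
  have N: "normed_space (stensor_space n \<alpha> E)" using s E by (simp add: s_tensor_norm_def)
  have "vnorm scalar_space (linearization n E P (stensor n E ws)) \<le>
      opnorm (stensor_space n \<alpha> E) scalar_space (linearization n E P) * vnorm (stensor_space n \<alpha> E) (stensor n E ws)"
    by (rule opnorm_bound[OF N scalar_space_normed P'(2)])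
       (simp add: stensor_space_def function_space_def stensors_stensor[OF ws])
  then show ?thesis
    by (simp add: linearization_stensor[OF P'(1) ws] tensor_dual_norm_def scalar_space_def stensor_space_def function_space_def)
qed

lemma tensor_dual_norm_nonneg:
  assumes "s_tensor_norm n \<alpha>" "normed_space E" "P \<in> tensor_dual n \<alpha> E"
  shows "0 \<le> tensor_dual_norm n \<alpha> E P"
  unfolding tensor_dual_norm_def
  using assms by (intro opnorm_nonneg scalar_space_normed) (simp_all add: s_tensor_norm_def tensor_dual_def)

lemma s_tensor_norm_nonneg:
  assumes "s_tensor_norm n \<alpha>" "normed_space E" "set ws \<subseteq> UNIV \<times> carrier E"
  shows "0 \<le> \<alpha> E (stensor n E ws)"
proof -
  interpret normed_space "stensor_space n \<alpha> E" using assms by (simp add: s_tensor_norm_def)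
  show ?thesis
    using vnorm_nonneg[of "stensor n E ws"] stensors_stensor[OF assms(3)]
    by (simp add: stensor_space_def function_space_def)
qed

lemma s_tensor_norm_map:
  assumes s: "s_tensor_norm n \<alpha>" and E: "normed_space E" and F: "normed_space F" and T: "T \<in> blinear E F"
    and K: "0 \<le> K" "\<And>x. x \<in> carrier E \<Longrightarrow> vnorm F (T x) \<le> K * vnorm E x"
    and ws: "set ws \<subseteq> UNIV \<times> carrier E"
  shows "\<alpha> F (stensor n F (map (\<lambda>(c, x). (c, T x)) ws)) \<le> K ^ n * \<alpha> E (stensor n E ws)"
proof -
  have "\<alpha> F (stensor_map n E F T (stensor n E ws)) \<le> opnorm E F T ^ n * \<alpha> E (stensor n E ws)"
    using s E F T stensors_stensor[OF ws, of n] unfolding s_tensor_norm_def by blast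
  also have "\<dots> \<le> K ^ n * \<alpha> E (stensor n E ws)"
    by (rule mult_right_mono[OF opnorm_power_le[OF E F T K] s_tensor_norm_nonneg[OF s E ws]])
  finally show ?thesis by (simp add: stensor_map_stensor[OF E F T ws])
qed

lemma tensor_dual_norm_le:
  assumes s: "s_tensor_norm n \<alpha>" and E: "normed_space E" and P: "P \<in> cpoly n E" and K: "0 \<le> K"
    and le: "\<And>ws. set ws \<subseteq> UNIV \<times> carrier E \<Longrightarrow> norm (\<Sum>(c, x)\<leftarrow>ws. c * P x) \<le> K * \<alpha> E (stensor n E ws)"
  shows "tensor_dual_norm n \<alpha> E P \<le> K"
  unfolding tensor_dual_norm_def
proof (rule opnorm_le[OF _ K])
  show "normed_space (stensor_space n \<alpha> E)" using s E by (simp add: s_tensor_norm_def)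
  fix w assume "w \<in> carrier (stensor_space n \<alpha> E)"
  then obtain ws where ws: "set ws \<subseteq> UNIV \<times> carrier E" "w = stensor n E ws"
    unfolding stensor_space_def function_space_def by (auto elim: stensors_obtain)
  show "vnorm scalar_space (linearization n E P w) \<le> K * vnorm (stensor_space n \<alpha> E) w"
    using le[OF ws(1)] by (simp add: ws(2) linearization_stensor[OF P ws(1)] scalar_space_def stensor_space_def function_space_def)
qed

lemma norm_weighted_sum_diff_le:
  fixes f g :: "'x \<Rightarrow> 'k::real_normed_field"
  assumes "\<And>c x. (c, x) \<in> set ws \<Longrightarrow> norm (f x - g x) \<le> \<epsilon>"
  shows "norm ((\<Sum>(c, x)\<leftarrow>ws. c * f x) - (\<Sum>(c, x)\<leftarrow>ws. c * g x)) \<le> \<epsilon> * (\<Sum>(c, x)\<leftarrow>ws. norm c)"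
  using assms
proof (induction ws)
  case (Cons p ws)
  obtain c x where p: "p = (c, x)" by (cases p)
  have "norm (c * f x - c * g x) \<le> norm c * \<epsilon>"
    using Cons.prems[of c x] by (simp add: p norm_mult mult_left_mono flip: right_diff_distrib)
  moreover have "norm ((\<Sum>(c, x)\<leftarrow>ws. c * f x) - (\<Sum>(c, x)\<leftarrow>ws. c * g x)) \<le> \<epsilon> * (\<Sum>(c, x)\<leftarrow>ws. norm c)"
    using Cons.prems by (intro Cons.IH) auto
  ultimately have "norm ((c * f x - c * g x) + ((\<Sum>(c, x)\<leftarrow>ws. c * f x) - (\<Sum>(c, x)\<leftarrow>ws. c * g x)))
      \<le> norm c * \<epsilon> + \<epsilon> * (\<Sum>(c, x)\<leftarrow>ws. norm c)"
    by (intro norm_triangle_le add_mono)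
  then show ?case by (simp add: p algebra_simps)
qed simp

section \<open>Finite-dimensional spaces of functions\<close>

text \<open>A finite-dimensional space of functions has a basis dual to evaluations at suitable
  points. One more generator raises the dimension by at most one. A function outside the old span is
  corrected to vanish at the old points; it is still nonzero somewhere, and such a point is the new
  one.\<close>

lemma point_dual_basis:
  fixes h :: "'i \<Rightarrow> 'x \<Rightarrow> 'k::field"
  assumes "finite B"
    and "\<And>f. f \<in> W \<Longrightarrow> \<exists>c. f = (\<lambda>z. \<Sum>b\<in>B. c b * h b z)"
    and "\<And>f g. \<lbrakk>f \<in> W; g \<in> W\<rbrakk> \<Longrightarrow> (\<lambda>z. f z + g z) \<in> W"
    and "\<And>a f. f \<in> W \<Longrightarrow> (\<lambda>z. a * f z) \<in> W" and "(\<lambda>_. 0) \<in> W"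
  shows "\<exists>Z g. finite Z \<and> (\<forall>x\<in>Z. g x \<in> W) \<and> (\<forall>x\<in>Z. \<forall>y\<in>Z. g x y = (if x = y then 1 else 0)) \<and>
    (\<forall>f\<in>W. \<forall>z. f z = (\<Sum>x\<in>Z. f x * g x z))"
  using assms
proof (induction B arbitrary: W rule: finite_induct)
  case empty
  then have "f z = 0" if "f \<in> W" for f z using that by fastforce
  then show ?case by (intro exI[of _ "{}"]) auto
next
  case (insert b B)
  \<comment> \<open>The part of \<open>W\<close> in the span of \<open>B\<close>, and not the whole
    span: the dual functions have to lie in \<open>W\<close>.\<close>
  define W0 where "W0 = {f \<in> W. \<exists>c. f = (\<lambda>z. \<Sum>b\<in>B. c b * h b z)}"
  note addW = insert.prems(2) and smultW = insert.prems(3) and zeroW = insert.prems(4)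
  have W0_span: "\<exists>c. f = (\<lambda>z. \<Sum>b\<in>B. c b * h b z)" and W0_W: "f \<in> W" if "f \<in> W0" for f
    using that by (simp_all add: W0_def)
  have W0I: "f \<in> W0" if "f \<in> W" "f = (\<lambda>z. \<Sum>b\<in>B. c b * h b z)" for f c
    unfolding W0_def by (rule CollectI, rule conjI[OF that(1)], rule exI, rule that(2))
  have W0: "\<exists>Z g. finite Z \<and> (\<forall>x\<in>Z. g x \<in> W0) \<and> (\<forall>x\<in>Z. \<forall>y\<in>Z. g x y = (if x = y then 1 else 0)) \<and>
    (\<forall>f\<in>W0. \<forall>z. f z = (\<Sum>x\<in>Z. f x * g x z))"
  proof (rule insert.IH)
    show "\<exists>c. f = (\<lambda>z. \<Sum>b\<in>B. c b * h b z)" if "f \<in> W0" for f by (rule W0_span[OF that])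
    show "(\<lambda>z. f z + g z) \<in> W0" if f: "f \<in> W0" and g: "g \<in> W0" for f g
    proof -
      obtain c where c: "f = (\<lambda>z. \<Sum>b\<in>B. c b * h b z)" using W0_span[OF f] by (rule exE)
      obtain d where d: "g = (\<lambda>z. \<Sum>b\<in>B. d b * h b z)" using W0_span[OF g] by (rule exE)
      show ?thesis
      proof (rule W0I)
        show "(\<lambda>z. f z + g z) \<in> W" by (rule insert.prems(2)[OF W0_W[OF that(1)] W0_W[OF that(2)]])
        show "(\<lambda>z. f z + g z) = (\<lambda>z. \<Sum>b\<in>B. (c b + d b) * h b z)"
          unfolding c d by (simp add: distrib_right sum.distrib)
      qed
    qed
    show "(\<lambda>z. a * f z) \<in> W0" if f: "f \<in> W0" for a f
    proof -
      obtain c where c: "f = (\<lambda>z. \<Sum>b\<in>B. c b * h b z)" using W0_span[OF f] by (rule exE)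
      show ?thesis
      proof (rule W0I)
        show "(\<lambda>z. a * f z) \<in> W" by (rule insert.prems(3)[OF W0_W[OF that]])
        show "(\<lambda>z. a * f z) = (\<lambda>z. \<Sum>b\<in>B. (a * c b) * h b z)"
          unfolding c by (simp add: sum_distrib_left mult.assoc)
      qed
    qed
    show "(\<lambda>_. 0) \<in> W0" by (rule W0I[OF insert.prems(4), of "\<lambda>_. 0"]) simp
  qed
  then obtain Z g where "finite Z \<and> (\<forall>x\<in>Z. g x \<in> W0) \<and> (\<forall>x\<in>Z. \<forall>y\<in>Z. g x y = (if x = y then 1 else 0)) \<and>
    (\<forall>f\<in>W0. \<forall>z. f z = (\<Sum>x\<in>Z. f x * g x z))"
    by (elim exE) (rule that)
  then have Z: "finite Z" and gW: "\<And>x. x \<in> Z \<Longrightarrow> g x \<in> W0"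
    and g: "\<And>x y. \<lbrakk>x \<in> Z; y \<in> Z\<rbrakk> \<Longrightarrow> g x y = (if x = y then 1 else 0)"
    and span: "\<And>f z. f \<in> W0 \<Longrightarrow> f z = (\<Sum>x\<in>Z. f x * g x z)"
    by blast+
  have diff: "(\<lambda>z. f z - a * f' z) \<in> W" if "f \<in> W" "f' \<in> W" for f f' a
    using insert.prems(2)[OF that(1) insert.prems(3)[OF that(2), of "- a"]] by simp
  show ?case
  proof (cases "W \<subseteq> W0")
    case True
    with Z W0_W[OF gW] g span show ?thesis by (intro exI[of _ Z] exI[of _ g]) (simp add: subset_iff)
  next
    case False
    then obtain f0 where f0: "f0 \<in> W" "f0 \<notin> W0" by blast
    obtain c0 where c0: "f0 = (\<lambda>z. \<Sum>b\<in>insert b B. c0 b * h b z)" using insert.prems(1)[OF f0(1)] by blast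
    have c0b: "c0 b \<noteq> 0"
    proof
      assume "c0 b = 0"
      then have "f0 = (\<lambda>z. \<Sum>b\<in>B. c0 b * h b z)" unfolding c0 using insert.hyps by simp
      with f0(2) W0I[OF f0(1)] show False by blast
    qed
    \<comment> \<open>\<open>W0\<close> has codimension at most 1 in \<open>W\<close>, because the
      coefficient of the generator \<open>b\<close> can be cancelled by a multiple of
      \<open>f0\<close>.\<close>
    have decomp: "\<exists>t. (\<lambda>z. f z - t * f0 z) \<in> W0" if f: "f \<in> W" for f
    proof -
      obtain c where c: "f = (\<lambda>z. \<Sum>b\<in>insert b B. c b * h b z)" using insert.prems(1)[OF f] by blast
      have "(\<lambda>z. f z - (c b / c0 b) * f0 z) = (\<lambda>z. \<Sum>d\<in>B. (c d - c b / c0 b * c0 d) * h d z)"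
        unfolding c c0 using insert.hyps c0b
        by (simp add: distrib_left left_diff_distrib sum_subtractf sum_distrib_left mult.assoc)
      then have "(\<lambda>z. f z - (c b / c0 b) * f0 z) \<in> W0" by (rule W0I[OF diff[OF f f0(1)]])
      then show ?thesis by blast
    qed
    \<comment> \<open>Interpolation at the points of \<open>Z\<close>. It reproduces every function
      in \<open>W0\<close>, so \<open>f1\<close> below measures how far \<open>f0\<close> is from
      being reproduced.\<close>
    define L where "L f z = (\<Sum>x\<in>Z. f x * g x z)" for f :: "'x \<Rightarrow> 'k" and z
    have LW: "L f \<in> W" for f
    proof -
      have "(\<lambda>z. \<Sum>x\<in>Y. f x * g x z) \<in> W" if "Y \<subseteq> Z" for Y
        using finite_subset[OF that Z] that
      proof (induction Y rule: finite_induct)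
        case (insert y Y)
        have "g y \<in> W" using gW[of y] insert.prems W0_W by simp
        from addW[OF smultW[OF this, of "f y"] insert.IH]
        show ?case using insert by simp
      qed (use zeroW in simp)
      then show ?thesis unfolding L_def[abs_def] by simp
    qed
    \<comment> \<open>The factor 1 gives the difference the shape required by
      \<open>diff\<close>.\<close>
    define f1 where "f1 z = f0 z - 1 * L f0 z" for z
    have f1W: "f1 \<in> W" unfolding f1_def[abs_def] by (rule diff[OF f0(1) LW])
    have gX: "L f y = f y" if "y \<in> Z" for f y
    proof -
      have "L f y = (\<Sum>x\<in>Z. if x = y then f x else 0)"
        unfolding L_def by (intro sum.cong refl) (simp add: g that)
      then show ?thesis using that Z by simp
    qed
    have L_add: "L (\<lambda>z. f z + a * f' z) z = L f z + a * L f' z" for f f' a z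
      unfolding L_def by (simp add: distrib_right sum.distrib sum_distrib_left mult.assoc)
    \<comment> \<open>If \<open>f1\<close> vanished everywhere, \<open>f0\<close> would equal its
      interpolation and hence lie in the span of \<open>B\<close>, against its choice.\<close>
    have "\<exists>x0. f1 x0 \<noteq> 0"
    proof (rule ccontr)
      assume "\<not> ?thesis"
      then have "f1 z = 0" for z by blast
      then have "f0 z = L f0 z" for z unfolding f1_def by (simp only: mult_1 right_minus_eq)
      then have f0L: "f0 = (\<lambda>z. L f0 z)" by (rule ext)
      have "\<exists>c. (\<lambda>z. \<Sum>x\<in>Y. f0 x * g x z) = (\<lambda>z. \<Sum>b\<in>B. c b * h b z)" if "Y \<subseteq> Z" for Y
        using finite_subset[OF that Z] that
      proof (induction Y rule: finite_induct)
        case empty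
        show ?case by (intro exI[of _ "\<lambda>_. 0"]) simp
      next
        case (insert y Y)
        then obtain c where c: "(\<lambda>z. \<Sum>x\<in>Y. f0 x * g x z) = (\<lambda>z. \<Sum>b\<in>B. c b * h b z)" by auto
        obtain d where d: "g y = (\<lambda>z. \<Sum>b\<in>B. d b * h b z)" using W0_span[OF gW[of y]] insert.prems by auto
        have "(\<Sum>x\<in>insert y Y. f0 x * g x z) = (\<Sum>b\<in>B. (f0 y * d b + c b) * h b z)" for z
          using insert.hyps fun_cong[OF c, of z] fun_cong[OF d, of z]
          by (simp add: distrib_right sum.distrib sum_distrib_left mult.assoc)
        then show ?case by (intro exI[of _ "\<lambda>b. f0 y * d b + c b"] ext)
      qed
      from this[of Z] obtain c where "(\<lambda>z. L f0 z) = (\<lambda>z. \<Sum>b\<in>B. c b * h b z)" unfolding L_def by auto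
      with f0L have "f0 = (\<lambda>z. \<Sum>b\<in>B. c b * h b z)" by (rule trans)
      with f0(2) W0I[OF f0(1)] show False by blast
    qed
    then obtain x0 where x0: "f1 x0 \<noteq> 0" by blast
    have f1X: "f1 y = 0" if "y \<in> Z" for y using gX[OF that] by (simp add: f1_def)
    then have x0X: "x0 \<notin> Z" using x0 by blast
    define k where "k z = (1 / f1 x0) * f1 z" for z
    have kW: "k \<in> W" unfolding k_def[abs_def] by (rule insert.prems(3)[OF f1W])
    have k: "k x0 = 1" "\<And>y. y \<in> Z \<Longrightarrow> k y = 0" using x0 f1X by (simp_all add: k_def)
    \<comment> \<open>\<open>k\<close> is 1 at the new point and 0 at the old ones. Subtracting a
      multiple of it makes the old dual functions vanish at \<open>x0\<close> without changing them
      on \<open>Z\<close>.\<close>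
    define g' where "g' x = (if x = x0 then k else (\<lambda>z. g x z - g x x0 * k z))" for x
    \<comment> \<open>Modulo \<open>W0\<close>, where interpolation is exact, \<open>f\<close> is a
      multiple \<open>t\<close> of \<open>f0\<close>. Comparing values at \<open>x0\<close>
      eliminates \<open>t\<close>.\<close>
    have rep: "f z = L f z + (f x0 - L f x0) * k z" if f: "f \<in> W" for f z
    proof -
      obtain t where t: "(\<lambda>z. f z - t * f0 z) \<in> W0" using decomp[OF f] by blast
      have "f z - t * f0 z = L (\<lambda>z. f z + (- t) * f0 z) z" for z
        using span[OF t, of z] by (simp add: L_def)
      then have *: "f z - L f z = t * f1 z" for z
        unfolding L_add by (simp add: f1_def algebra_simps)
      have "t * f1 z = (t * f1 x0) * k z" using x0 by (simp add: k_def)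
      then show ?thesis using *[of z] *[of x0] by (simp add: algebra_simps)
    qed
    show ?thesis
    proof (intro exI[of _ "insert x0 Z"] exI[of _ g'] conjI ballI allI)
      show "finite (insert x0 Z)" using Z by simp
      fix x assume x: "x \<in> insert x0 Z"
      show "g' x \<in> W" using x kW diff[OF W0_W[OF gW] kW, of x "g x x0"] by (auto simp: g'_def mult.commute)
      fix y assume y: "y \<in> insert x0 Z"
      show "g' x y = (if x = y then 1 else 0)" using x y x0X k g by (auto simp: g'_def)
    next
      fix f z assume f: "f \<in> W"
      have "(\<Sum>x\<in>insert x0 Z. f x * g' x z) = f x0 * k z + (\<Sum>x\<in>Z. f x * (g x z - g x x0 * k z))"
        using Z x0X by (auto simp: g'_def intro!: sum.cong)
      also have "(\<Sum>x\<in>Z. f x * (g x z - g x x0 * k z)) = L f z - L f x0 * k z"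
        by (simp add: L_def right_diff_distrib sum_subtractf sum_distrib_right mult.assoc)
      finally have "(\<Sum>x\<in>insert x0 Z. f x * g' x z) = f x0 * k z + (L f z - L f x0 * k z)" .
      also have "\<dots> = L f z + (f x0 - L f x0) * k z" by (simp add: left_diff_distrib)
      also have "\<dots> = f z" by (rule rep[OF f, symmetric])
      finally show "f z = (\<Sum>x\<in>insert x0 Z. f x * g' x z)" by (rule sym)
    qed
  qed
qed

lemma function_space_sum:
  fixes g :: "'x \<Rightarrow> 'y \<Rightarrow> 'k::real_normed_field"
  assumes "normed_space (function_space W N)" "finite Z" "\<And>x. x \<in> Z \<Longrightarrow> g x \<in> W"
  shows "(\<lambda>z. \<Sum>x\<in>Z. a x * g x z) \<in> W \<and> N (\<lambda>z. \<Sum>x\<in>Z. a x * g x z) \<le> (\<Sum>x\<in>Z. norm (a x) * N (g x))"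
  using assms(2,3)
proof (induction Z rule: finite_induct)
  case empty
  interpret normed_space "function_space W N" by (rule assms(1))
  show ?case using M.zero_closed vnorm_zero by (simp add: function_space_def)
next
  case (insert x Z)
  interpret normed_space "function_space W N" by (rule assms(1))
  have add: "(\<lambda>z. f z + f' z) \<in> W \<and> N (\<lambda>z. f z + f' z) \<le> N f + N f'" if "f \<in> W" "f' \<in> W" for f f'
    using M.a_closed[of f f'] vnorm_triangle[of f f'] that by (simp add: function_space_def)
  have smult: "(\<lambda>z. c * f z) \<in> W \<and> N (\<lambda>z. c * f z) = norm c * N f" if "f \<in> W" for f c
    using smult_in[of f c] vnorm_smult[of f c] that by (simp add: function_space_def)
  have 1: "(\<lambda>z. \<Sum>x\<in>Z. a x * g x z) \<in> W" "N (\<lambda>z. \<Sum>x\<in>Z. a x * g x z) \<le> (\<Sum>x\<in>Z. norm (a x) * N (g x))"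
    using insert by auto
  have 2: "(\<lambda>z. a x * g x z) \<in> W" "N (\<lambda>z. a x * g x z) = norm (a x) * N (g x)"
    using smult[of "g x" "a x"] insert.prems[of x] by auto
  have "(\<lambda>z. \<Sum>x\<in>insert x Z. a x * g x z) = (\<lambda>z. a x * g x z + (\<Sum>x\<in>Z. a x * g x z))"
    using insert.hyps by simp
  with add[OF 2(1) 1(1)] 1 2 insert.hyps show ?case by simp
qed

lemma (in normed_space) subspace_finsum:
  assumes "submodule M (ring_of_type_algebra :: 'k ring) E" "finite B" "f \<in> B \<rightarrow> M"
  shows "(\<Oplus>\<^bsub>subspace_of E M\<^esub>b\<in>B. f b) = (\<Oplus>b\<in>B. f b)"
proof -
  interpret S: normed_space "subspace_of E M" by (rule subspace_normed[OF assms(1)])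
  have M: "M \<subseteq> carrier E" using assms(1) by (simp add: submodule_iff)
  show ?thesis
    using assms(2,3)
  proof (induction B rule: finite_induct)
    case empty
    then show ?case by simp (simp add: subspace_of_def)
  next
    case (insert b B)
    have "(\<Oplus>\<^bsub>subspace_of E M\<^esub>b\<in>insert b B. f b) = f b \<oplus>\<^bsub>subspace_of E M\<^esub> (\<Oplus>\<^bsub>subspace_of E M\<^esub>b\<in>B. f b)"
      using insert by (intro S.M.finsum_insert) (auto simp: subspace_of_def)
    also have "\<dots> = f b \<oplus> (\<Oplus>b\<in>B. f b)" using insert by (simp add: subspace_of_def Pi_iff)
    also have "\<dots> = (\<Oplus>b\<in>insert b B. f b)"
      using insert M by (intro M.finsum_insert[symmetric]) auto
    finally show ?case .
  qed
qed

text \<open>The monomials of degree \<open>n\<close> in the coordinates span: the coefficients of a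
  polynomial are the values of its form on words of basis vectors. The generators do not depend on
  the polynomial.\<close>

lemma (in hb_space) cpoly_FIN_finite_dim:
  assumes M: "M \<in> FIN E"
  obtains B :: "'u list set" and h :: "'u list \<Rightarrow> 'u \<Rightarrow> 'k" where "finite B"
    "\<And>R. R \<in> cpoly n (subspace_of E M) \<Longrightarrow> \<exists>c. R = (\<lambda>z. \<Sum>b\<in>B. c b * h b z)"
proof -
  have sub: "submodule M (ring_of_type_algebra :: 'k ring) E" using M by (simp add: FIN_def)
  interpret S: normed_space "subspace_of E M" by (rule subspace_normed[OF sub])
  obtain B0 f C where B0: "finite B0" "B0 \<subseteq> M"
    and f: "\<And>x. x \<in> M \<Longrightarrow> x = (\<Oplus>b\<in>B0. f x b \<odot> b)"
    by (rule FIN_coordinates[OF M]) (rule that)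
  have car: "carrier (subspace_of E M) = M" "smult (subspace_of E M) = smult E" by (simp_all add: subspace_of_def)
  have smultM: "c \<odot> b \<in> M" if "b \<in> M" for c b using sub that unfolding submodule_iff by blast
  define B where "B = {bs. set bs \<subseteq> B0 \<and> length bs = n}"
  \<comment> \<open>Extended by 0 off \<open>M\<close>, as polynomials on \<open>M\<close> are, so
    that the expansion holds at every point of the type.\<close>
  define h where "h bs x = (if x \<in> M then prod_list (map (f x) bs) else 0)" for bs x
  show ?thesis
  proof (rule that[of B h])
    show "finite B" unfolding B_def by (rule finite_lists_length_eq[OF B0(1)])
    fix R assume "R \<in> cpoly n (subspace_of E M)"
    then obtain A where A: "A \<in> nforms n (subspace_of E M)" "\<And>x. x \<in> M \<Longrightarrow> R x = A (replicate n x)"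
      "\<And>x. x \<notin> M \<Longrightarrow> R x = 0"
      unfolding cpoly_def car by blast
    have "R x = (\<Sum>bs\<in>B. A bs * h bs x)" for x
    proof (cases "x \<in> M")
      case True
      have "(\<lambda>b. f x b \<odot> b) \<in> B0 \<rightarrow> M"
        using smultM B0(2) by auto
      then have x: "x = (\<Oplus>\<^bsub>subspace_of E M\<^esub>b\<in>B0. f x b \<odot>\<^bsub>subspace_of E M\<^esub> b)"
        using f[OF True] subspace_finsum[OF sub B0(1), of "\<lambda>b. f x b \<odot> b"] by (simp add: car)
      have "R x = A ([] @ replicate n (\<Oplus>\<^bsub>subspace_of E M\<^esub>b\<in>B0. f x b \<odot>\<^bsub>subspace_of E M\<^esub> b))"
        using A(2)[OF True] x by simp
      also have "\<dots> = (\<Sum>bs\<in>B. A ([] @ map (\<lambda>b. f x b \<odot>\<^bsub>subspace_of E M\<^esub> b) bs))"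
        unfolding B_def using B0 by (intro S.nforms_expand[OF A(1)]) (auto simp: car intro: smultM)
      also have "\<dots> = (\<Sum>bs\<in>B. A bs * h bs x)"
      proof (rule sum.cong[OF refl])
        fix bs assume "bs \<in> B"
        then have "A ([] @ map (\<lambda>b. f x b \<odot>\<^bsub>subspace_of E M\<^esub> b) bs) = prod_list (map (f x) bs) * A ([] @ map (\<lambda>b. b) bs)"
          using B0 by (intro S.nforms_scale[OF A(1)]) (auto simp: B_def car)
        then show "A ([] @ map (\<lambda>b. f x b \<odot>\<^bsub>subspace_of E M\<^esub> b) bs) = A bs * h bs x"
          using True by (simp add: h_def mult.commute)
      qed
      finally show ?thesis .
    next
      case False
      then show ?thesis using A(3) by (simp add: h_def)
    qed
    then show "\<exists>c. R = (\<lambda>z. \<Sum>b\<in>B. c b * h b z)" by (intro exI[of _ A] ext)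
  qed
qed

section \<open>The iterated extension of dual polynomials and of maximal ideals\<close>

context ultra_model
begin

context
  fixes e :: "'u \<Rightarrow> 'v"
  assumes inj: "inj_on e (carrier E)" and banach: "banach_space E"
begin

text \<open>The canonical embedding read on the renamed copy of \<open>E\<close>. The copy of
  \<open>P\<close> is the composition of \<open>Pext\<close> with it, see
  \<open>Pext_embed\<close>.\<close>

abbreviation embed :: "'v \<Rightarrow> 'v" where
  "embed \<equiv> (\<lambda>y. diag (the_inv_into (carrier E) e y))"

lemma renamed_banach: "banach_space (rename e E)"
  by (rule rename_banach[OF inj banach])

lemma renamed_normed: "normed_space (rename e E)"
  by (rule banach_space_normed[OF renamed_banach])

lemma model_banach: "banach_space F"
  using banach complete F.normed_space_axioms unfolding banach_space_def by blast

lemma embed: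
  "embed \<in> blinear (rename e E) F"
  "\<And>y. y \<in> carrier (rename e E) \<Longrightarrow> vnorm F (embed y) \<le> 1 * vnorm (rename e E) y"
proof -
  note s = rename_inv[OF inj] rename_add[OF inj] rename_smult[OF inj] rename_vnorm[OF inj] rename_carrier[OF inj]
  show le: "vnorm F (embed y) \<le> 1 * vnorm (rename e E) y" if "y \<in> carrier (rename e E)" for y
    using that by (auto simp: s diag_norm)
  show "embed \<in> blinear (rename e E) F"
    by (rule blinearI[OF _ _ _ le]) (auto simp: s diag diag_add diag_smult)
qed

lemma renamed_blinear:
  assumes "S \<in> blinear G E" "\<And>x. x \<in> carrier G \<Longrightarrow> vnorm E (S x) \<le> K * vnorm G x"
  shows "(\<lambda>x. e (S x)) \<in> blinear G (rename e E)"
    "\<And>x. x \<in> carrier G \<Longrightarrow> vnorm (rename e E) (e (S x)) \<le> K * vnorm G x"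
proof -
  note s = rename_add[OF inj] rename_smult[OF inj] rename_vnorm[OF inj] rename_carrier[OF inj]
  note S = blinear_in[OF assms(1)] blinear_add[OF assms(1)] blinear_smult[OF assms(1)]
  show le: "vnorm (rename e E) (e (S x)) \<le> K * vnorm G x" if "x \<in> carrier G" for x
    using assms(2)[OF that] that by (simp add: s S)
  show "(\<lambda>x. e (S x)) \<in> blinear G (rename e E)"
    by (rule blinearI[OF _ _ _ le]) (simp_all add: s S)
qed

context
  fixes n :: nat and P :: "'u \<Rightarrow> 'k"
  assumes P: "P \<in> cpoly n E"
begin

abbreviation Pext :: "'v \<Rightarrow> 'k" where "Pext \<equiv> extension n (assoc_form n E P)"

lemma Pext_cpoly: "Pext \<in> cpoly n F"
proof -
  obtain D where "bounded_form E D (assoc_form n E P)" using assoc_form(3)[OF P] by blast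
  then show ?thesis by (rule extension_cpoly[OF symmetric_nforms_nforms[OF assoc_form(1)[OF P]]])
qed

lemma Pext_embed: "y \<in> carrier (rename e E) \<Longrightarrow> Pext (embed y) = rename_fun e E P y"
proof -
  assume "y \<in> carrier (rename e E)"
  then obtain a where a: "a \<in> carrier E" "y = e a" by (auto simp: rename_carrier[OF inj])
  obtain D where "bounded_form E D (assoc_form n E P)" using assoc_form(3)[OF P] by blast
  then have "Pext (diag a) = assoc_form n E P (replicate n a)"
    by (rule extension_diag_eq[OF symmetric_nforms_nforms[OF assoc_form(1)[OF P]] _ a(1)])
  then show ?thesis using a by (simp add: rename_inv[OF inj] rename_fun_apply[OF inj] assoc_form(2)[OF P])
qed

text \<open>The local approximation is transported along \<open>e\<close>, so that it maps into a
  space to which \<alpha> and the ideal apply.\<close>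

lemma Pext_approx:
  assumes "M \<in> FIN F" "finite G" "G \<subseteq> M" "0 < \<epsilon>"
  obtains S where "S \<in> blinear (subspace_of F M) (rename e E)"
    "\<And>x. x \<in> M \<Longrightarrow> vnorm (rename e E) (S x) \<le> (1 + \<epsilon>) * vnorm F x"
    "\<And>x. x \<in> G \<Longrightarrow> norm (rename_fun e E P (S x) - Pext x) \<le> \<epsilon>"
proof -
  obtain D where D: "bounded_form E D (assoc_form n E P)" using assoc_form(3)[OF P] by blast
  obtain S where S: "S \<in> blinear (subspace_of F M) E"
    "\<And>x. x \<in> M \<Longrightarrow> vnorm E (S x) \<le> (1 + \<epsilon>) * vnorm F x"
    "\<And>x. x \<in> G \<Longrightarrow> norm (assoc_form n E P (replicate n (S x)) - Pext x) \<le> \<epsilon>"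
    by (rule local_approximation[OF assms(1) assoc_form(1)[OF P] D assms(2-4)]) (rule that)
  have car: "carrier (subspace_of F M) = M" "vnorm (subspace_of F M) = vnorm F" by (simp_all add: subspace_of_def)
  note r = renamed_blinear[OF S(1), unfolded car, OF S(2)]
  show ?thesis
  proof (rule that[OF r])
    fix x assume x: "x \<in> G"
    then have "S x \<in> carrier E" using blinear_in[OF S(1)] assms(3) by (auto simp: car)
    with S(3)[OF x] show "norm (rename_fun e E P (e (S x)) - Pext x) \<le> \<epsilon>"
      by (simp add: rename_fun_apply[OF inj] assoc_form(2)[OF P])
  qed
qed

text \<open>For the upper bound a tensor over the model is represented in a nearly optimal
  finite-dimensional \<open>M\<close> and moved by an approximating map into the copy of
  \<open>E\<close>; the metric mapping property costs the factor
  \<open>(1 + \<epsilon>) ^ n\<close>. For the lower bound the same property is applied to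
  \<open>embed\<close>, with constant 1.\<close>

lemma tensor_dual_extension:
  assumes s: "s_tensor_norm n \<alpha>" and fg: "finitely_generated n \<alpha>"
    and dual: "rename_fun e E P \<in> tensor_dual n \<alpha> (rename e E)"
  shows "Pext \<in> tensor_dual n \<alpha> F"
    "tensor_dual_norm n \<alpha> (rename e E) (rename_fun e E P) = tensor_dual_norm n \<alpha> F Pext"
proof -
  define K where "K = tensor_dual_norm n \<alpha> (rename e E) (rename_fun e E P)"
  have K0: "0 \<le> K" unfolding K_def by (rule tensor_dual_norm_nonneg[OF s renamed_normed dual])
  have bound: "norm (\<Sum>(c, x)\<leftarrow>ws. c * Pext x) \<le> K * \<alpha> F (stensor n F ws)"
    if ws: "set ws \<subseteq> UNIV \<times> carrier F" for ws
  proof (rule limit_bound)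
    have "((\<lambda>\<epsilon>. K * ((1 + \<epsilon>) ^ n * (\<alpha> F (stensor n F ws) + \<epsilon>)) + \<epsilon>) \<longlongrightarrow>
        K * ((1 + 0) ^ n * (\<alpha> F (stensor n F ws) + 0)) + 0) (at_right 0)"
      by (intro tendsto_intros)
    then show "((\<lambda>\<epsilon>. K * ((1 + \<epsilon>) ^ n * (\<alpha> F (stensor n F ws) + \<epsilon>)) + \<epsilon>) \<longlongrightarrow> K * \<alpha> F (stensor n F ws)) (at_right 0)"
      by simp
    fix \<epsilon> :: real assume \<epsilon>: "0 < \<epsilon>"
    obtain M vs where M: "M \<in> FIN F" and vs: "set vs \<subseteq> UNIV \<times> M"
      "\<alpha> (subspace_of F M) (stensor n (subspace_of F M) vs) < \<alpha> F (stensor n F ws) + \<epsilon>"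
      "stensor n F vs = stensor n F ws"
      by (rule F.finitely_generated_approx[OF s fg model_banach ws \<epsilon>]) (rule that)
    have M_sub: "M \<subseteq> carrier F" by (rule FIN_submodule[OF M])
    have vsF: "set vs \<subseteq> UNIV \<times> carrier F" using vs(1) M_sub by blast
    \<comment> \<open>The accuracy is chosen after \<open>vs\<close>, because the total error at the
      points of \<open>vs\<close> is weighted by its coefficients. The summand 1 avoids a division
      by 0 and yields \<open>\<eta> \<le> \<epsilon>\<close>.\<close>
    define \<eta> where "\<eta> = \<epsilon> / ((\<Sum>(c, x)\<leftarrow>vs. norm c) + 1)"
    have sum0: "0 \<le> (\<Sum>(c, x)\<leftarrow>vs. norm c)" by (rule sum_list_nonneg) auto
    have \<eta>: "0 < \<eta>" "\<eta> \<le> \<epsilon>" "\<eta> * (\<Sum>(c, x)\<leftarrow>vs. norm c) \<le> \<epsilon>"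
      using \<epsilon> sum0 by (simp_all add: \<eta>_def field_simps add_pos_nonneg)
    have G: "finite (snd ` set vs)" "snd ` set vs \<subseteq> M" using vs(1) by auto
    obtain S where S: "S \<in> blinear (subspace_of F M) (rename e E)"
      "\<And>x. x \<in> M \<Longrightarrow> vnorm (rename e E) (S x) \<le> (1 + \<eta>) * vnorm F x"
      "\<And>x. x \<in> snd ` set vs \<Longrightarrow> norm (rename_fun e E P (S x) - Pext x) \<le> \<eta>"
      by (rule Pext_approx[OF M G \<eta>(1)]) (rule that)
    have car: "carrier (subspace_of F M) = M" "vnorm (subspace_of F M) = vnorm F" by (simp_all add: subspace_of_def)
    have S_le: "vnorm (rename e E) (S x) \<le> (1 + \<epsilon>) * vnorm F x" if "x \<in> M" for x
    proof (rule order.trans[OF S(2)[OF that]])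
      have "0 \<le> vnorm F x" using that M_sub by (intro F.vnorm_nonneg) blast
      then show "(1 + \<eta>) * vnorm F x \<le> (1 + \<epsilon>) * vnorm F x" using \<eta>(2) by (intro mult_right_mono) auto
    qed
    define us where "us = map (\<lambda>(c, x). (c, S x)) vs"
    have us: "set us \<subseteq> UNIV \<times> carrier (rename e E)"
      using vs(1) blinear_in[OF S(1)] by (auto simp: us_def car)
    have "norm (\<Sum>(c, x)\<leftarrow>us. c * rename_fun e E P x) \<le> K * \<alpha> (rename e E) (stensor n (rename e E) us)"
      unfolding K_def by (rule tensor_dual_bound[OF s renamed_normed dual us])
    also have "\<alpha> (rename e E) (stensor n (rename e E) us) \<le>
        (1 + \<epsilon>) ^ n * \<alpha> (subspace_of F M) (stensor n (subspace_of F M) vs)"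
      unfolding us_def using \<epsilon> vs(1) S_le
      by (intro s_tensor_norm_map[OF s F.subspace_normed_FIN[OF M] renamed_normed S(1)]) (simp_all add: car)
    also have "\<dots> \<le> (1 + \<epsilon>) ^ n * (\<alpha> F (stensor n F ws) + \<epsilon>)"
      using vs(2) \<epsilon> by (intro mult_left_mono) auto
    finally have 1: "norm (\<Sum>(c, x)\<leftarrow>us. c * rename_fun e E P x) \<le> K * ((1 + \<epsilon>) ^ n * (\<alpha> F (stensor n F ws) + \<epsilon>))"
      using K0 by (simp add: mult_left_mono)
    have us_sum: "(\<Sum>(c, x)\<leftarrow>us. c * rename_fun e E P x) = (\<Sum>(c, x)\<leftarrow>vs. c * rename_fun e E P (S x))"
      by (simp add: us_def case_prod_unfold comp_def)
    have "norm ((\<Sum>(c, x)\<leftarrow>vs. c * Pext x) - (\<Sum>(c, x)\<leftarrow>vs. c * rename_fun e E P (S x))) \<le> \<eta> * (\<Sum>(c, x)\<leftarrow>vs. norm c)"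
    proof (rule norm_weighted_sum_diff_le)
      fix c x assume "(c, x) \<in> set vs"
      then have "x \<in> snd ` set vs" by force
      from S(3)[OF this] show "norm (Pext x - rename_fun e E P (S x)) \<le> \<eta>" by (simp add: norm_minus_commute)
    qed
    then have 2: "norm ((\<Sum>(c, x)\<leftarrow>vs. c * Pext x) - (\<Sum>(c, x)\<leftarrow>us. c * rename_fun e E P x)) \<le> \<epsilon>"
      using \<eta>(3) unfolding us_sum by linarith
    \<comment> \<open>The two decompositions represent the same tensor over \<open>F\<close>, so the
      linearization of \<open>Pext\<close> cannot distinguish them.\<close>
    have eq: "(\<Sum>(c, x)\<leftarrow>ws. c * Pext x) = (\<Sum>(c, x)\<leftarrow>vs. c * Pext x)"
      using linearization_stensor[OF Pext_cpoly ws] linearization_stensor[OF Pext_cpoly vsF] vs(3) by simp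
    show "norm (\<Sum>(c, x)\<leftarrow>ws. c * Pext x) \<le> K * ((1 + \<epsilon>) ^ n * (\<alpha> F (stensor n F ws) + \<epsilon>)) + \<epsilon>"
      unfolding eq using norm_triangle_sub[of "\<Sum>(c, x)\<leftarrow>vs. c * Pext x" "\<Sum>(c, x)\<leftarrow>us. c * rename_fun e E P x"] 1 2 by linarith
  qed
  show Pext_in: "Pext \<in> tensor_dual n \<alpha> F"
    unfolding tensor_dual_def using Pext_cpoly linearization_blinear[where \<alpha> = \<alpha> and K = K, OF Pext_cpoly bound] by blast
  have le: "tensor_dual_norm n \<alpha> F Pext \<le> K"
    by (rule tensor_dual_norm_le[OF s F.normed_space_axioms Pext_cpoly K0 bound])
  have "K \<le> tensor_dual_norm n \<alpha> F Pext"
    unfolding K_def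
  proof (rule tensor_dual_norm_le[OF s renamed_normed])
    show "rename_fun e E P \<in> cpoly n (rename e E)" using dual by (simp add: tensor_dual_def)
    show L0: "0 \<le> tensor_dual_norm n \<alpha> F Pext" by (rule tensor_dual_norm_nonneg[OF s F.normed_space_axioms Pext_in])
    fix ws :: "('k \<times> 'v) list" assume ws: "set ws \<subseteq> UNIV \<times> carrier (rename e E)"
    define us where "us = map (\<lambda>(c, x). (c, embed x)) ws"
    have us: "set us \<subseteq> UNIV \<times> carrier F"
      using ws blinear_in[OF embed(1)] by (auto simp: us_def)
    have "map (\<lambda>(c, x). c * rename_fun e E P x) ws = map (\<lambda>(c, x). c * Pext (embed x)) ws"
      using ws by (intro map_cong) (auto simp: Pext_embed)
    then have "(\<Sum>(c, x)\<leftarrow>ws. c * rename_fun e E P x) = (\<Sum>(c, x)\<leftarrow>ws. c * Pext (embed x))"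
      by (rule arg_cong)
    also have "\<dots> = (\<Sum>(c, x)\<leftarrow>us. c * Pext x)"
      by (simp add: us_def case_prod_unfold comp_def)
    also have "norm \<dots> \<le> tensor_dual_norm n \<alpha> F Pext * \<alpha> F (stensor n F us)"
      by (rule tensor_dual_bound[OF s F.normed_space_axioms Pext_in us])
    also have "\<dots> \<le> tensor_dual_norm n \<alpha> F Pext * (1 ^ n * \<alpha> (rename e E) (stensor n (rename e E) ws))"
      unfolding us_def
      by (intro mult_left_mono L0 s_tensor_norm_map[OF s renamed_normed F.normed_space_axioms embed(1) _ embed(2) ws]) auto
    finally show "norm (\<Sum>(c, x)\<leftarrow>ws. c * rename_fun e E P x) \<le>
      tensor_dual_norm n \<alpha> F Pext * \<alpha> (rename e E) (stensor n (rename e E) ws)" by simp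
  qed
  with le show "tensor_dual_norm n \<alpha> (rename e E) (rename_fun e E P) = tensor_dual_norm n \<alpha> F Pext"
    by (simp add: K_def)
qed

text \<open>The restrictions of the ideal to a finite-dimensional space have a basis that is dual to
  finitely many point evaluations, so approximation at these points is approximation in the
  ideal norm.\<close>

lemma ideal_restriction:
  assumes ideal: "banach_poly_ideal n Q N" and Q: "rename_fun e E P \<in> Q (rename e E)" and M: "M \<in> FIN F"
  shows "zero_ext M Pext \<in> Q (subspace_of F M)"
    "N (subspace_of F M) (zero_ext M Pext) \<le> N (rename e E) (rename_fun e E P)"
proof -
  define W where "W = Q (subspace_of F M)"
  define NM where "NM = N (subspace_of F M)"
  define K where "K = N (rename e E) (rename_fun e E P)"
  have car: "carrier (subspace_of F M) = M" "vnorm (subspace_of F M) = vnorm F" by (simp_all add: subspace_of_def)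
  have MB: "banach_space (subspace_of F M)" by (rule F.FIN_banach[OF M])
  have id1: "Q G \<subseteq> cpoly n G \<and> banach_space (function_space (Q G) (N G))" if "banach_space G" for G
    using ideal that unfolding banach_poly_ideal_def by blast
  have W_cpoly: "W \<subseteq> cpoly n (subspace_of F M)" and "banach_space (function_space W NM)"
    using id1[OF MB] by (simp_all add: W_def NM_def)
  then have WN: "normed_space (function_space W NM)" by (rule_tac banach_space_normed)
  interpret W: normed_space "function_space W NM" by (rule WN)
  have W_add: "(\<lambda>z. f z + g z) \<in> W \<and> NM (\<lambda>z. f z + g z) \<le> NM f + NM g" if "f \<in> W" "g \<in> W" for f g
    using W.M.a_closed[of f g] W.vnorm_triangle[of f g] that by (simp add: function_space_def)
  have W_smult: "(\<lambda>z. a * f z) \<in> W" if "f \<in> W" for f a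
    using W.smult_in[of f a] that by (simp add: function_space_def)
  have W_zero: "(\<lambda>_. 0) \<in> W" using W.M.zero_closed by (simp add: function_space_def)
  have W_nonneg: "0 \<le> NM f" if "f \<in> W" for f using W.vnorm_nonneg[of f] that by (simp add: function_space_def)
  have K0: "0 \<le> K"
  proof -
    interpret V: normed_space "function_space (Q (rename e E)) (N (rename e E))"
      using id1[OF renamed_banach] by (intro banach_space_normed) blast
    show ?thesis using V.vnorm_nonneg[of "rename_fun e E P"] Q by (simp add: function_space_def K_def)
  qed
  obtain B :: "'v list set" and h where B: "finite B"
    "\<And>R. R \<in> cpoly n (subspace_of F M) \<Longrightarrow> \<exists>c. R = (\<lambda>z. \<Sum>b\<in>B. c b * h b z)"
    by (rule F.cpoly_FIN_finite_dim[OF M]) (rule that)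
  have "\<exists>Z g. finite Z \<and> (\<forall>x\<in>Z. g x \<in> W) \<and> (\<forall>x\<in>Z. \<forall>y\<in>Z. g x y = (if x = y then 1 else 0)) \<and>
    (\<forall>f\<in>W. \<forall>z. f z = (\<Sum>x\<in>Z. f x * g x z))"
    by (rule point_dual_basis[OF B(1) B(2)[OF subsetD[OF W_cpoly]]]) (simp_all add: W_add W_smult W_zero)
  then obtain Z g where "finite Z \<and> (\<forall>x\<in>Z. g x \<in> W) \<and> (\<forall>x\<in>Z. \<forall>y\<in>Z. g x y = (if x = y then 1 else 0)) \<and>
    (\<forall>f\<in>W. \<forall>z. f z = (\<Sum>x\<in>Z. f x * g x z))"
    by (elim exE) (rule that)
  then have Z: "finite Z" and gW: "\<And>x. x \<in> Z \<Longrightarrow> g x \<in> W"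
    and dual: "\<And>x y. \<lbrakk>x \<in> Z; y \<in> Z\<rbrakk> \<Longrightarrow> g x y = (if x = y then 1 else 0)"
    and rep: "\<And>f z. f \<in> W \<Longrightarrow> f z = (\<Sum>x\<in>Z. f x * g x z)"
    by blast+
  have W_off: "f z = 0" if "f \<in> W" "z \<notin> M" for f z
    using that W_cpoly unfolding cpoly_def car by blast
  \<comment> \<open>Functions in \<open>W\<close> vanish off \<open>M\<close>, while
    \<open>g x\<close> has the value 1 at \<open>x\<close>. Hence the evaluation points lie in
    \<open>M\<close>, where the approximation is available.\<close>
  have ZM: "Z \<subseteq> M"
  proof
    fix x assume x: "x \<in> Z"
    show "x \<in> M" using dual[OF x x] W_off[OF gW[OF x], of x] by (cases "x \<in> M") auto
  qed
  \<comment> \<open>The composition of the copy of \<open>P\<close> with \<open>S\<close> belongs to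
    the ideal on \<open>M\<close>, and the ideal property bounds its norm. Its closeness to
    \<open>Pext\<close> is known at the points of \<open>G\<close> only.\<close>
  have approx: "\<exists>R\<in>W. NM R \<le> K * (1 + \<epsilon>) ^ n \<and> (\<forall>x\<in>G. norm (R x - Pext x) \<le> \<epsilon>)"
    if G: "finite G" "G \<subseteq> M" and \<epsilon>: "0 < \<epsilon>" for G \<epsilon>
  proof -
    obtain S where S: "S \<in> blinear (subspace_of F M) (rename e E)"
      "\<And>x. x \<in> M \<Longrightarrow> vnorm (rename e E) (S x) \<le> (1 + \<epsilon>) * vnorm F x"
      "\<And>x. x \<in> G \<Longrightarrow> norm (rename_fun e E P (S x) - Pext x) \<le> \<epsilon>"
      by (rule Pext_approx[OF M G \<epsilon>]) (rule that)
    define R where "R = zero_ext (carrier (subspace_of F M)) (rename_fun e E P \<circ> S)"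
    have R: "R \<in> W \<and> NM R \<le> K * opnorm (subspace_of F M) (rename e E) S ^ n"
      using ideal MB renamed_banach S(1) Q unfolding banach_poly_ideal_def R_def W_def NM_def K_def by blast
    have "K * opnorm (subspace_of F M) (rename e E) S ^ n \<le> K * (1 + \<epsilon>) ^ n"
      using \<epsilon> S(2) by (intro mult_left_mono K0 opnorm_power_le[OF banach_space_normed[OF MB] renamed_normed S(1)])
        (simp_all add: car)
    moreover have "norm (R x - Pext x) \<le> \<epsilon>" if "x \<in> G" for x
    proof -
      have "x \<in> M" using that G(2) by blast
      with S(3)[OF that] show ?thesis by (simp add: R_def zero_ext_def car)
    qed
    ultimately show ?thesis using R by (intro bexI[of _ R]) auto
  qed
  have comb: "(\<lambda>z. \<Sum>x\<in>Z. a x * g x z) \<in> W \<and> NM (\<lambda>z. \<Sum>x\<in>Z. a x * g x z) \<le> (\<Sum>x\<in>Z. norm (a x) * NM (g x))"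
    for a by (rule function_space_sum[OF WN Z gW])
  \<comment> \<open>The element of \<open>W\<close> that interpolates \<open>Pext\<close> at
    \<open>Z\<close>. An element of \<open>W\<close> is determined by its values on
    \<open>Z\<close>, so no other one can be the restriction of \<open>Pext\<close>.\<close>
  define R0 where "R0 z = (\<Sum>x\<in>Z. Pext x * g x z)" for z
  have R0_W: "R0 \<in> W" unfolding R0_def[abs_def] by (rule comb[THEN conjunct1])
  have R0: "zero_ext M Pext = R0"
  proof
    fix z
    show "zero_ext M Pext z = R0 z"
    proof (cases "z \<in> M")
      case True
      \<comment> \<open>Including \<open>z\<close> among the approximation points compares
        \<open>Pext z\<close> with \<open>R z\<close>; the points of \<open>Z\<close> compare
        \<open>R z\<close> with \<open>R0 z\<close>.\<close>
      have "norm (Pext z - R0 z) \<le> 0"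
      proof (rule limit_bound)
        have "((\<lambda>\<epsilon>. \<epsilon> + (\<Sum>x\<in>Z. \<epsilon> * norm (g x z))) \<longlongrightarrow> 0 + (\<Sum>x\<in>Z. 0 * norm (g x z))) (at_right 0)"
          by (intro tendsto_intros)
        then show "((\<lambda>\<epsilon>. \<epsilon> + (\<Sum>x\<in>Z. \<epsilon> * norm (g x z))) \<longlongrightarrow> 0) (at_right 0)" by simp
        fix \<epsilon> :: real assume "0 < \<epsilon>"
        with approx[of "insert z Z" \<epsilon>] Z ZM True obtain R where R: "R \<in> W"
          "\<And>x. x \<in> insert z Z \<Longrightarrow> norm (R x - Pext x) \<le> \<epsilon>" by auto
        have "R z - R0 z = (\<Sum>x\<in>Z. (R x - Pext x) * g x z)"
          using rep[OF R(1), of z] by (simp add: R0_def left_diff_distrib sum_subtractf)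
        also have "norm \<dots> \<le> (\<Sum>x\<in>Z. \<epsilon> * norm (g x z))"
          using R(2) by (intro sum_norm_le) (simp add: norm_mult mult_right_mono)
        finally show "norm (Pext z - R0 z) \<le> \<epsilon> + (\<Sum>x\<in>Z. \<epsilon> * norm (g x z))"
          using R(2)[of z] norm_triangle_ineq[of "Pext z - R z" "R z - R0 z"] by (simp add: norm_minus_commute)
      qed
      then show ?thesis using True by (simp add: zero_ext_def)
    qed (use W_off[OF R0_W] in \<open>simp add: zero_ext_def\<close>)
  qed
  show "zero_ext M Pext \<in> Q (subspace_of F M)" using R0_W unfolding R0 W_def .
  have "NM R0 \<le> K"
  proof (rule limit_bound)
    have "((\<lambda>\<epsilon>. K * (1 + \<epsilon>) ^ n + (\<Sum>x\<in>Z. \<epsilon> * NM (g x))) \<longlongrightarrow> K * (1 + 0) ^ n + (\<Sum>x\<in>Z. 0 * NM (g x))) (at_right 0)"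
      by (intro tendsto_intros)
    then show "((\<lambda>\<epsilon>. K * (1 + \<epsilon>) ^ n + (\<Sum>x\<in>Z. \<epsilon> * NM (g x))) \<longlongrightarrow> K) (at_right 0)" by simp
    fix \<epsilon> :: real assume "0 < \<epsilon>"
    with approx[OF Z ZM] obtain R where R: "R \<in> W" "NM R \<le> K * (1 + \<epsilon>) ^ n"
      "\<And>x. x \<in> Z \<Longrightarrow> norm (R x - Pext x) \<le> \<epsilon>" by blast
    \<comment> \<open>The difference of \<open>R0\<close> and \<open>R\<close>. Its coefficients are
      at most \<open>\<epsilon>\<close>, so its ideal norm is at most \<open>\<epsilon>\<close>
      times a constant that depends on \<open>M\<close> but not on \<open>R\<close>.\<close>
    define d where "d z = (\<Sum>x\<in>Z. (Pext x - R x) * g x z)" for z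
    have d: "d \<in> W" "NM d \<le> (\<Sum>x\<in>Z. norm (Pext x - R x) * NM (g x))"
      unfolding d_def[abs_def] by (rule comb[THEN conjunct1], rule comb[THEN conjunct2])
    have "R0 z = R z + d z" for z
      using rep[OF R(1), of z] by (simp add: R0_def d_def left_diff_distrib sum_subtractf)
    then have "R0 = (\<lambda>z. R z + d z)" by (rule ext)
    then have "NM R0 \<le> NM R + NM d" using W_add[OF R(1) d(1)] by simp
    moreover have "(\<Sum>x\<in>Z. norm (Pext x - R x) * NM (g x)) \<le> (\<Sum>x\<in>Z. \<epsilon> * NM (g x))"
      using R(3) gW W_nonneg by (intro sum_mono mult_right_mono) (simp_all add: norm_minus_commute)
    ultimately show "NM R0 \<le> K * (1 + \<epsilon>) ^ n + (\<Sum>x\<in>Z. \<epsilon> * NM (g x))" using R(2) d(2) by linarith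
  qed
  then show "N (subspace_of F M) (zero_ext M Pext) \<le> N (rename e E) (rename_fun e E P)"
    unfolding R0 NM_def K_def .
qed

text \<open>Maximality on the model turns the uniform bound on finite-dimensional restrictions into
  membership and into an estimate of the norm. The converse estimate is the ideal property for
  \<open>embed\<close>, whose norm is at most 1.\<close>

lemma maximal_ideal_extension:
  assumes max: "maximal_ideal n Q N" and Q: "rename_fun e E P \<in> Q (rename e E)"
  shows "Pext \<in> Q F" "N (rename e E) (rename_fun e E P) = N F Pext"
proof -
  have ideal: "banach_poly_ideal n Q N" using max by (simp add: maximal_ideal_def)
  have nonneg: "0 \<le> N G R" if "banach_space G" "R \<in> Q G" for G R
  proof -
    have "banach_space (function_space (Q G) (N G))" using ideal that(1) unfolding banach_poly_ideal_def by blast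
    then interpret V: normed_space "function_space (Q G) (N G)" by (rule banach_space_normed)
    show ?thesis using V.vnorm_nonneg[of R] that(2) by (simp add: function_space_def)
  qed
  have maxF: "Q F = {R \<in> cpoly n F. max_norm Q N F R < \<infinity>}" "\<And>R. R \<in> Q F \<Longrightarrow> ennreal (N F R) = max_norm Q N F R"
    using max model_banach unfolding maximal_ideal_def by blast+
  have le: "max_norm Q N F Pext \<le> ennreal (N (rename e E) (rename_fun e E P))"
    unfolding max_norm_def
    by (rule SUP_least) (simp add: ideal_restriction[OF ideal Q] ennreal_leI)
  then have "max_norm Q N F Pext < \<infinity>" by (rule le_less_trans) simp
  then show Pext_in: "Pext \<in> Q F" using Pext_cpoly unfolding maxF(1) by blast
  have "ennreal (N F Pext) \<le> ennreal (N (rename e E) (rename_fun e E P))"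
    using le maxF(2)[OF Pext_in] by simp
  then have 1: "N F Pext \<le> N (rename e E) (rename_fun e E P)"
    using nonneg[OF renamed_banach Q] by (simp add: ennreal_le_iff)
  have "rename_fun e E P y = zero_ext (carrier (rename e E)) (Pext \<circ> embed) y" for y
    by (cases "y \<in> carrier (rename e E)")
       (simp_all add: zero_ext_def Pext_embed, simp add: rename_fun_def zero_ext_def rename_carrier[OF inj])
  then have "rename_fun e E P = zero_ext (carrier (rename e E)) (Pext \<circ> embed)" by (rule ext)
  moreover have "N (rename e E) (zero_ext (carrier (rename e E)) (Pext \<circ> embed)) \<le>
      N F Pext * opnorm (rename e E) F embed ^ n"
    using ideal renamed_banach model_banach embed(1) Pext_in unfolding banach_poly_ideal_def by blast
  moreover have "N F Pext * opnorm (rename e E) F embed ^ n \<le> N F Pext * 1 ^ n"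
    by (rule mult_left_mono[OF opnorm_power_le[OF renamed_normed F.normed_space_axioms embed(1) _ embed(2)]
        nonneg[OF model_banach Pext_in]]) simp_all
  ultimately have 2: "N (rename e E) (rename_fun e E P) \<le> N F Pext" by simp
  from 1 2 show "N (rename e E) (rename_fun e E P) = N F Pext" by simp
qed

end

end

end

text \<open>For \<open>n\<close> equal families \<open>family_form\<close> is the iterated limit in
  \<open>iterated_extension\<close>, and off the carrier both functions are 0.\<close>

lemma rename_iterated_extension:
  fixes E :: "('k::{real_normed_field, heine_borel}, 'a) nspace"
    and j :: "('i \<Rightarrow> 'a) set \<Rightarrow> 'u"
  assumes "inj_on j (carrier (ultrapower U E))"
    and "ultra_model E U (rename j (ultrapower U E)) (\<lambda>x. urep (the_inv_into (carrier (ultrapower U E)) j x))"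
  shows "rename_fun j (ultrapower U E) (iterated_extension n U E P) =
    ultra_model.extension U (rename j (ultrapower U E)) (\<lambda>x. urep (the_inv_into (carrier (ultrapower U E)) j x)) n
      (assoc_form n E P)"
proof
  fix y
  show "rename_fun j (ultrapower U E) (iterated_extension n U E P) y =
    ultra_model.extension U (rename j (ultrapower U E)) (\<lambda>x. urep (the_inv_into (carrier (ultrapower U E)) j x)) n
      (assoc_form n E P) y"
  proof (cases "y \<in> j ` carrier (ultrapower U E)")
    case True
    then show ?thesis
      by (auto simp: ultra_model.extension_def[OF assms(2)] rename_fun_def iterated_extension_def zero_ext_def
          rename_carrier[OF assms(1)] rename_inv[OF assms(1)] family_form_replicate)
  qed (simp add: ultra_model.extension_def[OF assms(2)] rename_fun_def zero_ext_def rename_carrier[OF assms(1)])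
qed

text \<open>\<open>e\<close> and \<open>j\<close> place \<open>E\<close> and its ultrapower in the
  universe \<open>'u\<close> over whose spaces \<alpha> and \<open>Q\<close> range. The two
  placements are independent of each other; they are linked inside the proof by the canonical
  embedding.\<close>

theorem theorem3p3:
  fixes n :: nat
    and E :: "('k::{real_normed_field, heine_borel}, 'a) nspace"
    and U :: "'i filter"
    and e :: "'a \<Rightarrow> 'u"
    and j :: "('i \<Rightarrow> 'a) set \<Rightarrow> 'u"
  assumes "banach_space E"
    and "ultrafilter U"
    and "inj_on e (carrier E)"
    and "inj_on j (carrier (ultrapower U E))"
  shows "(\<forall>(\<alpha> :: ('k, 'u) tensor_norm) P.
            s_tensor_norm n \<alpha> \<longrightarrow> finitely_generated n \<alpha> \<longrightarrow>
            P \<in> cpoly n E \<longrightarrow> rename_fun e E P \<in> tensor_dual n \<alpha> (rename e E) \<longrightarrow>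
            rename_fun j (ultrapower U E) (iterated_extension n U E P)
              \<in> tensor_dual n \<alpha> (rename j (ultrapower U E)) \<and>
            tensor_dual_norm n \<alpha> (rename e E) (rename_fun e E P) =
            tensor_dual_norm n \<alpha> (rename j (ultrapower U E))
              (rename_fun j (ultrapower U E) (iterated_extension n U E P))) \<and>
         (\<forall>(Q :: ('k, 'u) nspace \<Rightarrow> ('u \<Rightarrow> 'k) set) N P.
            maximal_ideal n Q N \<longrightarrow>
            P \<in> cpoly n E \<longrightarrow> rename_fun e E P \<in> Q (rename e E) \<longrightarrow>
            rename_fun j (ultrapower U E) (iterated_extension n U E P)
              \<in> Q (rename j (ultrapower U E)) \<and>
            N (rename e E) (rename_fun e E P) =
            N (rename j (ultrapower U E))
              (rename_fun j (ultrapower U E) (iterated_extension n U E P)))"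
proof -
  interpret ultra_space E U
    using assms(1,2) banach_space_normed
    by (simp add: ultra_space_def ultra_space_axioms_def hb_space_def)
  note model = ultrapower_model[OF assms(4)]
  note eq = rename_iterated_extension[OF assms(4) model]
  show ?thesis
    unfolding eq
    by (intro conjI allI impI)
       (assumption | rule ultra_model.tensor_dual_extension[OF model assms(3,1)]
         ultra_model.maximal_ideal_extension[OF model assms(3,1)])+
qed

end
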